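(* For each $\mathbf{k}\in\mathbb{C}^4$, it is decidable whether or not $\mathbf{x},\mathbf{y}\in V_{\mathbf{k}}(\mathbb{Z})$ are in the same mapping class group orbit.
   Context: For $\mathbf{k}=(k_1,k_2,k_3,k_4)\in\mathbb{C}^4$ put $\alpha_1=k_1k_2+k_3k_4$, $\alpha_2=k_1k_4+k_2k_3$, $\alpha_3=k_1k_3+k_2k_4$, $\beta=4-\sum_{i=1}^4k_i^2-\prod_{i=1}^4k_i$. $V_{\mathbf{k}}$ is the affine cubic surface $x_1^2+x_2^2+x_3^2+x_1x_2x_3-\alpha_1x_1-\alpha_2x_2-\alpha_3x_3-\beta=0$, and $V_{\mathbf{k}}(\mathbb{Z})$ is its set of solutions $\mathbf{x}=(x_1,x_2,x_3)\in\mathbb{Z}^3$. The Vieta involutions are $\mathcal{V}_1(x_1,x_2,x_3)=(\alpha_1-x_2x_3-x_1,x_2,x_3)$, $\mathcal{V}_2(x_1,x_2,x_3)=(x_1,\alpha_2-x_3x_1-x_2,x_3)$, $\mathcal{V}_3(x_1,x_2,x_3)=(x_1,x_2,\alpha_3-x_1x_2-x_3)$. The mapping class group of the four-holed sphere acts on $V_{\mathbf{k}}(\mathbb{Z})$ through compositions of pairs of Vieta involutions; its orbits are the orbits of the group of transformations generated by $\mathcal{V}_3\mathcal{V}_2$, $\mathcal{V}_1\mathcal{V}_3$, $\mathcal{V}_2\mathcal{V}_1$. Decidable means: there exists an algorithm which terminates in finitely many steps and outputs "yes" or "no" according to whether $\mathbf{x},\mathbf{y}\in V_{\mathbf{k}}(\mathbb{Z})$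 are in the same orbit. *)

theory Defs
  imports
    "HOL-Analysis.Finite_Cartesian_Product"
    "HOL-Algebra.Bij"
    "HOL-Algebra.Generated_Groups"
    "HOL-Library.Nat_Bijection"
begin

section \<open>Partial recursive functions and decidability\<close>

text \<open>
  Programs for the partial recursive functions. Arities are not tracked: the number of
  arguments is the length of the argument list, and an ill-formed application is undefined.
\<close>

datatype recf =
    Zero_rf
  | Succ_rf
  | Proj_rf nat
  | Comp_rf recf "recf list"
  | Prim_rf recf recf
  | Min_rf recf

text \<open>
  The value \<open>None\<close> means that the computation does not terminate (or is ill-formed).
  Composition is strict, \<open>Prim_rf f g\<close> recurses on its first argument, and minimisation
  requires all values before the first zero to be defined.
\<close>

fun rec_eval :: "recf \<Rightarrow> nat list \<Rightarrow> nat option" where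
  "rec_eval Zero_rf xs = Some 0"
| "rec_eval Succ_rf xs = (case xs of [x] \<Rightarrow> Some (Suc x) | _ \<Rightarrow> None)"
| "rec_eval (Proj_rf i) xs = (if i < length xs then Some (xs ! i) else None)"
| "rec_eval (Comp_rf f gs) xs =
     Option.bind (those (map (\<lambda>g. rec_eval g xs) gs)) (rec_eval f)"
| "rec_eval (Prim_rf f g) xs =
     (case xs of
        [] \<Rightarrow> None
      | n # ys \<Rightarrow>
          rec_nat (rec_eval f ys)
            (\<lambda>m r. Option.bind r (\<lambda>y. rec_eval g (m # y # ys))) n)"
| "rec_eval (Min_rf f) xs =
     (if \<exists>n. rec_eval f (n # xs) = Some 0 \<and> (\<forall>m<n. rec_eval f (m # xs) \<noteq> None)
      then Some (LEAST n. rec_eval f (n # xs) = Some 0)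
      else None)"

text \<open>
  A decision problem has a set \<open>D\<close> of instances, encoded as tuples of natural numbers by
  \<open>enc\<close>. It is decidable if one algorithm terminates on every instance and outputs
  1 (``yes'') if \<open>P\<close> holds for it and 0 (``no'') otherwise.
\<close>

definition decidable_on :: "('a \<Rightarrow> nat list) \<Rightarrow> 'a set \<Rightarrow> ('a \<Rightarrow> bool) \<Rightarrow> bool" where
  "decidable_on enc D P \<longleftrightarrow>
     (\<exists>f. \<forall>x\<in>D. rec_eval f (enc x) = Some (if P x then 1 else 0))"


section \<open>The cubic surface and its integral points\<close>

type_synonym 'a triple = "'a \<times> 'a \<times> 'a"

definition alpha1 :: "complex ^ 4 \<Rightarrow> complex" where
  "alpha1 k = k $ 1 * k $ 2 + k $ 3 * k $ 4"

definition alpha2 :: "complex ^ 4 \<Rightarrow> complex" where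
  "alpha2 k = k $ 1 * k $ 4 + k $ 2 * k $ 3"

definition alpha3 :: "complex ^ 4 \<Rightarrow> complex" where
  "alpha3 k = k $ 1 * k $ 3 + k $ 2 * k $ 4"

definition beta :: "complex ^ 4 \<Rightarrow> complex" where
  "beta k = 4 - (\<Sum>i\<in>UNIV. (k $ i)\<^sup>2) - (\<Prod>i\<in>UNIV. k $ i)"

definition surface :: "complex ^ 4 \<Rightarrow> complex triple set" where
  "surface k = {(x1, x2, x3).
     x1\<^sup>2 + x2\<^sup>2 + x3\<^sup>2 + x1 * x2 * x3
       - alpha1 k * x1 - alpha2 k * x2 - alpha3 k * x3 - beta k = 0}"

definition of_int_triple :: "int triple \<Rightarrow> complex triple" where
  "of_int_triple = (\<lambda>(x1, x2, x3). (of_int x1, of_int x2, of_int x3))"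

definition surface_int :: "complex ^ 4 \<Rightarrow> int triple set" where
  "surface_int k = {x. of_int_triple x \<in> surface k}"


section \<open>Vieta involutions and the mapping class group action\<close>

definition vieta1 :: "complex ^ 4 \<Rightarrow> complex triple \<Rightarrow> complex triple" where
  "vieta1 k = (\<lambda>(x1, x2, x3). (alpha1 k - x2 * x3 - x1, x2, x3))"

definition vieta2 :: "complex ^ 4 \<Rightarrow> complex triple \<Rightarrow> complex triple" where
  "vieta2 k = (\<lambda>(x1, x2, x3). (x1, alpha2 k - x3 * x1 - x2, x3))"

definition vieta3 :: "complex ^ 4 \<Rightarrow> complex triple \<Rightarrow> complex triple" where
  "vieta3 k = (\<lambda>(x1, x2, x3). (x1, x2, alpha3 k - x1 * x2 - x3))"

text \<open>
  The group of transformations through which the mapping class group acts, as a subgroup of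
  the bijections of complex affine 3-space; it preserves \<open>surface k\<close>. Working
  over the complex numbers makes the action total for all \<open>k\<close>: the Vieta involutions
  preserve the integral points when the \<open>alpha\<close>s are integers, but not in general.
\<close>

definition mcg_transformations :: "complex ^ 4 \<Rightarrow> (complex triple \<Rightarrow> complex triple) set" where
  "mcg_transformations k =
     generate (BijGroup UNIV)
       {vieta3 k \<circ> vieta2 k, vieta1 k \<circ> vieta3 k, vieta2 k \<circ> vieta1 k}"

definition same_mcg_orbit :: "complex ^ 4 \<Rightarrow> int triple \<Rightarrow> int triple \<Rightarrow> bool" where
  "same_mcg_orbit k x y \<longleftrightarrow>
     (\<exists>g\<in>mcg_transformations k. g (of_int_triple x) = of_int_triple y)"

lemma vieta_involutive:
  "vieta1 k (vieta1 k x) = x" "vieta2 k (vieta2 k x) = x" "vieta3 k (vieta3 k x) = x"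
  by (simp_all add: vieta1_def vieta2_def vieta3_def split: prod.split)

lemma vieta_in_surface:
  assumes "x \<in> surface k"
  shows "vieta1 k x \<in> surface k" "vieta2 k x \<in> surface k" "vieta3 k x \<in> surface k"
  using assms
  by (auto simp: surface_def vieta1_def vieta2_def vieta3_def power2_eq_square algebra_simps)

lemma bij_vieta: "bij (vieta1 k)" "bij (vieta2 k)" "bij (vieta3 k)"
  by (auto intro!: involuntory_imp_bij simp: vieta_involutive)

lemma mcg_generators_in_BijGroup:
  "{vieta3 k \<circ> vieta2 k, vieta1 k \<circ> vieta3 k, vieta2 k \<circ> vieta1 k} \<subseteq> carrier (BijGroup UNIV)"
  by (simp add: BijGroup_def Bij_def extensional_def bij_comp bij_vieta)

lemma subgroup_mcg_transformations: "subgroup (mcg_transformations k) (BijGroup UNIV)"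
  unfolding mcg_transformations_def
  by (rule group.generate_is_subgroup[OF group_BijGroup mcg_generators_in_BijGroup])


section \<open>Encoding of pairs of integral points\<close>

definition encode_pair :: "int triple \<times> int triple \<Rightarrow> nat list" where
  "encode_pair = (\<lambda>((x1, x2, x3), (y1, y2, y3)).
     map int_encode [x1, x2, x3, y1, y2, y3])"

end

theory Submission
  imports
    Defs
    "HOL-Analysis.Cartesian_Space"
    "HOL-Computational_Algebra.Polynomial_Factorial"
    "HOL-Computational_Algebra.Fundamental_Theorem_Algebra"
begin

text \<open>
  The mapping class group acts through the words of even length in the three Vieta involutions
  (\<open>same_orbit_iff_even_word\<close>). The algorithm may depend on \<open>k\<close>, so it may contain a table for
  finitely many points. For the remaining points one has to bound the length of a shortest word
  between two integral points by a computable function, and then a search through all words up to this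
  bound decides the question (\<open>decidable_by_search\<close>). How the bound arises depends on how many of the
  three coefficients \<open>alpha1\<close>, \<open>alpha2\<close>, \<open>alpha3\<close> are irrational.

  All coefficients rational (\<open>decidable_rational\<close>). This is Markoff descent. Call the sum of the
  absolute values of the coordinates the height. If two different involutions fail to raise the height of a
  sufficiently high point, then both fix it (\<open>peak_bound\<close>). So a shortest word has no
  peak above the heights of its ends and a constant, and it visits only a bounded number of
  points (\<open>bounded_walk\<close>). The argument needs points with bounded denominators. When the coefficients are
  not integers, these are provided by the same descent for the \<open>p\<close>-adic absolute values
  (\<open>walk_vle\<close>).

  One irrational coefficient (\<open>decidable_one_irrational\<close>). The integral points lie in a plane that
  fixes the coordinate of this coefficient. The other two involutions preserve the plane and the descent applies to
  them. Outside a finite set the third one leads into a trap: a region where every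
  reduced word raises the height at each step and can never come back to the plane
  (\<open>big_walk\<close>).

  At least two irrational coefficients (\<open>decidable_two_irrational\<close>). A rational linear functional on the
  complex numbers that kills 1 turns the equation of the surface into a linear one for integral points. The plane cuts
  the surface in a cubic curve, and all but finitely many integral points lie, up to one involution, on
  one of finitely many lines of the surface on which one coordinate is constant (\<open>finite_irregular\<close>).
  Two involutions act on such a line and its companion, essentially by an affine map of the
  parameter that moves integral points to irrational ones. Leaving by the
  third involution leads into a trap wherever the parameter is large, but an irrational parameter can
  become small again. The remedy is specialisation: a word that joins two integral points still
  joins them after an irrational coefficient has been replaced by a suitable other number
  (\<open>two_specialisations\<close>), and for two different
  replacements the parameter cannot be small in both, where size is measured by the real absolute value or,
  if the affine map is not a translation, also by a \<open>p\<close>-adic one (\<open>exit_trap\<close>). So outside a finite set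
  no two different integral points lie in the same orbit (\<open>line_exit\<close>).
\<close>

section \<open>Closure properties of the recursive functions\<close>

text \<open>
  Arities are fixed here, since the programs do not track them; on lists of another length the program
  may diverge or return anything.
\<close>
definition computable :: "nat \<Rightarrow> (nat list \<Rightarrow> nat) \<Rightarrow> bool" where
  "computable n f \<longleftrightarrow> (\<exists>r. \<forall>xs. length xs = n \<longrightarrow> rec_eval r xs = Some (f xs))"

definition computable_pred :: "nat \<Rightarrow> (nat list \<Rightarrow> bool) \<Rightarrow> bool" where
  "computable_pred n P \<longleftrightarrow> computable n (\<lambda>xs. if P xs then 1 else 0)"

definition computable_int :: "nat \<Rightarrow> (nat list \<Rightarrow> int) \<Rightarrow> bool" where
  "computable_int n f \<longleftrightarrow> computable n (\<lambda>xs. int_encode (f xs))"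

lemma computable_cong:
  assumes "computable n f" "\<And>xs. length xs = n \<Longrightarrow> f xs = g xs"
  shows "computable n g"
  using assms unfolding computable_def by metis

lemma computable_nth: "i < n \<Longrightarrow> computable n (\<lambda>xs. xs ! i)"
  unfolding computable_def by (rule exI[of _ "Proj_rf i"]) simp

lemma those_map_Some: "(\<And>x. x \<in> set xs \<Longrightarrow> f x = Some (g x)) \<Longrightarrow> those (map f xs) = Some (map g xs)"
  by (induction xs) auto

lemma computable_compose:
  assumes f: "computable (length gs) f" and gs: "\<And>g. g \<in> set gs \<Longrightarrow> computable n g"
  shows "computable n (\<lambda>xs. f (map (\<lambda>g. g xs) gs))"
proof -
  obtain rf where rf: "\<And>xs. length xs = length gs \<Longrightarrow> rec_eval rf xs = Some (f xs)"
    using f unfolding computable_def by blast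
  obtain rg where rg: "\<And>g xs. g \<in> set gs \<Longrightarrow> length xs = n \<Longrightarrow> rec_eval (rg g) xs = Some (g xs)"
    using gs unfolding computable_def by metis
  have "rec_eval (Comp_rf rf (map rg gs)) xs = Some (f (map (\<lambda>g. g xs) gs))"
    if "length xs = n" for xs
  proof -
    have "those (map (\<lambda>g. rec_eval (rg g) xs) gs) = Some (map (\<lambda>g. g xs) gs)"
      using rg that by (intro those_map_Some) auto
    then show ?thesis using rf by (simp add: comp_def)
  qed
  then show ?thesis unfolding computable_def by blast
qed

lemma computable_Suc: "computable n f \<Longrightarrow> computable n (\<lambda>xs. Suc (f xs))"
proof -
  assume f: "computable n f"
  have "computable (length [f]) (\<lambda>ys. Suc (ys ! 0))"
    unfolding computable_def
    by (rule exI[of _ Succ_rf]) (auto simp: length_Suc_conv)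
  from computable_compose[OF this] f show ?thesis by simp
qed

lemma computable_const: "computable n (\<lambda>_. c)"
proof (induction c)
  case 0
  show ?case unfolding computable_def by (rule exI[of _ Zero_rf]) simp
next
  case (Suc c)
  then show ?case by (rule computable_Suc)
qed

lemma computable_tl: 
  assumes "computable n f" shows "computable (Suc n) (\<lambda>xs. f (tl xs))"
proof -
  let ?gs = "map (\<lambda>i xs. xs ! Suc i) [0..<n]"
  have "computable (Suc n) (\<lambda>xs. f (map (\<lambda>g. g xs) ?gs))"
    by (rule computable_compose) (use assms in \<open>auto intro!: computable_nth\<close>)
  then show ?thesis
  proof (rule computable_cong)
    fix xs :: "nat list" assume "length xs = Suc n"
    then have "map (\<lambda>g. g xs) ?gs = tl xs"
      by (intro nth_equalityI) (auto simp: nth_tl)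
    then show "f (map (\<lambda>g. g xs) ?gs) = f (tl xs)" by simp
  qed
qed

lemma computable_hd: "computable (Suc n) hd"
  by (rule computable_cong[OF computable_nth[of 0]]) (auto simp: hd_conv_nth length_Suc_conv)

lemma computable_hd_subst:
  assumes f: "computable (Suc n) f" and b: "computable n b"
  shows "computable n (\<lambda>xs. f (b xs # xs))"
proof -
  let ?gs = "b # map (\<lambda>i xs. xs ! i) [0..<n]"
  have "computable n (\<lambda>xs. f (map (\<lambda>g. g xs) ?gs))"
    by (rule computable_compose) (use assms in \<open>auto intro!: computable_nth\<close>)
  then show ?thesis
  proof (rule computable_cong)
    fix xs :: "nat list" assume "length xs = n"
    then have "map (\<lambda>g. g xs) ?gs = b xs # xs"
      by (intro nth_equalityI) (auto simp: nth_Cons split: nat.splits)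
    then show "f (map (\<lambda>g. g xs) ?gs) = f (b xs # xs)" by simp
  qed
qed

text \<open>
  Primitive recursion with the recursion bound \<open>b\<close> as a computable function of the arguments: the form in
  which it is used below. The step function sees the counter and the previous value
  as the first two entries of its argument list.
\<close>
lemma computable_rec:
  assumes f: "computable n f" and g: "computable (Suc (Suc n)) (\<lambda>zs. g (hd zs) (hd (tl zs)) (tl (tl zs)))"
    and b: "computable n b"
  shows "computable n (\<lambda>xs. rec_nat (f xs) (\<lambda>m y. g m y xs) (b xs))"
proof -
  obtain rf where rf: "\<And>xs. length xs = n \<Longrightarrow> rec_eval rf xs = Some (f xs)"
    using f unfolding computable_def by blast
  obtain rg where rg: "\<And>m y xs. length xs = n \<Longrightarrow> rec_eval rg (m # y # xs) = Some (g m y xs)"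
    using g unfolding computable_def by (metis length_Cons list.sel(1,3))
  have *: "rec_nat (Some (f xs)) (\<lambda>m r. Option.bind r (\<lambda>y. rec_eval rg (m # y # xs))) k
      = Some (rec_nat (f xs) (\<lambda>m y. g m y xs) k)" if "length xs = n" for k xs
    by (induction k) (auto simp: rg that)
  have "computable (Suc n) (\<lambda>zs. rec_nat (f (tl zs)) (\<lambda>m y. g m y (tl zs)) (hd zs))"
    unfolding computable_def
    by (rule exI[of _ "Prim_rf rf rg"]) (auto simp: length_Suc_conv rf *)
  from computable_hd_subst[OF this b] show ?thesis by simp
qed

lemma computable_add:
  assumes "computable n f" "computable n g" shows "computable n (\<lambda>xs. f xs + g xs)"
proof -
  have "computable n (\<lambda>xs. rec_nat (g xs) (\<lambda>m y. Suc y) (f xs))"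
    by (rule computable_rec) (use assms in \<open>auto intro!: computable_Suc computable_tl computable_hd\<close>)
  moreover have "rec_nat b (\<lambda>m y. Suc y) a = a + b" for a b by (induction a) auto
  ultimately show ?thesis by simp
qed

lemma computable_mult:
  assumes "computable n f" "computable n g" shows "computable n (\<lambda>xs. f xs * g xs)"
proof -
  have "computable n (\<lambda>xs. rec_nat 0 (\<lambda>m y. g xs + y) (f xs))"
    by (rule computable_rec)
      (use assms in \<open>auto intro!: computable_add computable_tl computable_hd computable_const\<close>)
  moreover have "rec_nat 0 (\<lambda>m y. b + y) a = a * b" for a b :: nat by (induction a) auto
  ultimately show ?thesis by simp
qed

lemma computable_diff:
  assumes "computable n f" "computable n g" shows "computable n (\<lambda>xs. f xs - g xs)"
proof -
  have pred: "computable m (\<lambda>xs. h xs - 1)" if "computable m h" for m h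
  proof -
    have "computable m (\<lambda>xs. rec_nat 0 (\<lambda>m y. m) (h xs))"
      by (rule computable_rec) (use that in \<open>auto intro!: computable_hd computable_const\<close>)
    moreover have "rec_nat 0 (\<lambda>m y. m) a = a - 1" for a by (induction a) auto
    ultimately show ?thesis by simp
  qed
  have "computable n (\<lambda>xs. rec_nat (f xs) (\<lambda>m y. y - 1) (g xs))"
    by (rule computable_rec) (use assms in \<open>auto intro!: pred[simplified] computable_tl computable_hd\<close>)
  moreover have "rec_nat a (\<lambda>m y. y - 1) b = a - b" for a b :: nat by (induction b) auto
  ultimately show ?thesis by simp
qed

lemma computable_pred_le:
  assumes "computable n f" "computable n g" shows "computable_pred n (\<lambda>xs. f xs \<le> g xs)"
proof -
  have "computable n (\<lambda>xs. 1 - (f xs - g xs))"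
    using assms by (intro computable_diff computable_const)
  then show ?thesis unfolding computable_pred_def
    by (rule computable_cong) auto
qed

lemma computable_pred_not:
  assumes "computable_pred n P" shows "computable_pred n (\<lambda>xs. \<not> P xs)"
proof -
  have "computable n (\<lambda>xs. 1 - (if P xs then 1 else 0))"
    using assms unfolding computable_pred_def by (intro computable_diff computable_const)
  then show ?thesis unfolding computable_pred_def
    by (rule computable_cong) auto
qed

lemma computable_pred_and:
  assumes "computable_pred n P" "computable_pred n Q" shows "computable_pred n (\<lambda>xs. P xs \<and> Q xs)"
proof -
  have "computable n (\<lambda>xs. (if P xs then 1 else 0) * (if Q xs then 1 else 0))"
    using assms unfolding computable_pred_def by (intro computable_mult)
  then show ?thesis unfolding computable_pred_def
    by (rule computable_cong) auto
qed

lemma computable_pred_or: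
  assumes "computable_pred n P" "computable_pred n Q" shows "computable_pred n (\<lambda>xs. P xs \<or> Q xs)"
proof -
  have "computable_pred n (\<lambda>xs. \<not> (\<not> P xs \<and> \<not> Q xs))"
    by (intro computable_pred_not computable_pred_and assms)
  then show ?thesis by simp
qed

lemma computable_pred_const: "computable_pred n (\<lambda>_. b)"
  unfolding computable_pred_def by (rule computable_const)

lemma computable_pred_eq:
  assumes "computable n f" "computable n g" shows "computable_pred n (\<lambda>xs. f xs = g xs)"
proof -
  have "computable_pred n (\<lambda>xs. f xs \<le> g xs \<and> g xs \<le> f xs)"
    by (intro computable_pred_and computable_pred_le assms)
  then show ?thesis by (simp add: order_eq_iff)
qed

lemma computable_pred_less:
  assumes "computable n f" "computable n g" shows "computable_pred n (\<lambda>xs. f xs < g xs)"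
  using computable_pred_not[OF computable_pred_le[OF assms(2,1)]] by (simp add: not_le)

lemma computable_if:
  assumes "computable_pred n P" "computable n f" "computable n g"
  shows "computable n (\<lambda>xs. if P xs then f xs else g xs)"
proof -
  have "computable n (\<lambda>xs. (if P xs then 1 else 0) * f xs + (1 - (if P xs then 1 else 0)) * g xs)"
    using assms unfolding computable_pred_def
    by (intro computable_mult computable_add computable_diff computable_const)
  then show ?thesis by (rule computable_cong) auto
qed

lemma computable_pred_bex:
  assumes P: "computable_pred (Suc n) (\<lambda>zs. P (hd zs) (tl zs))" and b: "computable n b"
  shows "computable_pred n (\<lambda>xs. \<exists>m<b xs. P m xs)"
proof -
  \<comment> \<open>the step of the recursion also receives the previous value, which has to be skipped\<close>
  have P': "computable_pred (Suc (Suc n)) (\<lambda>zs. P (hd zs) (tl (tl zs)))"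
  proof -
    let ?gs = "hd # map (\<lambda>i xs. xs ! Suc (Suc i)) [0..<n]"
    let ?f = "\<lambda>zs. if P (hd zs) (tl zs) then 1 else (0::nat)"
    have "computable (Suc (Suc n)) (\<lambda>xs. ?f (map (\<lambda>g. g xs) ?gs))"
      by (rule computable_compose)
        (use P in \<open>auto intro!: computable_nth computable_hd simp: computable_pred_def\<close>)
    then show ?thesis unfolding computable_pred_def
    proof (rule computable_cong)
      fix xs :: "nat list" assume "length xs = Suc (Suc n)"
      then have "map (\<lambda>g. g xs) ?gs = hd xs # tl (tl xs)"
        by (intro nth_equalityI) (auto simp: nth_tl nth_Cons split: nat.splits)
      then show "?f (map (\<lambda>g. g xs) ?gs) = (if P (hd xs) (tl (tl xs)) then 1 else 0)" by simp
    qed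
  qed
  have "computable n (\<lambda>xs. rec_nat 0 (\<lambda>m y. if y = 1 \<or> P m xs then 1 else 0) (b xs))"
    by (rule computable_rec)
      (intro b P' computable_if computable_pred_or computable_pred_eq computable_const
        computable_tl computable_hd)+
  moreover have "rec_nat 0 (\<lambda>m y. if y = 1 \<or> P m xs then 1 else 0) k
      = (if \<exists>m<k. P m xs then 1 else (0::nat))" for k xs
    by (induction k) (auto simp: less_Suc_eq)
  ultimately show ?thesis by (simp add: computable_pred_def)
qed

lemma computable_Least:
  assumes P: "computable_pred (Suc n) (\<lambda>zs. P (hd zs) (tl zs))"
    and ex: "\<And>xs. length xs = n \<Longrightarrow> \<exists>m. P m xs"
  shows "computable n (\<lambda>xs. LEAST m. P m xs)"
proof -
  obtain r where r: "\<And>m xs. length xs = n \<Longrightarrow> rec_eval r (m # xs) = Some (if \<not> P m xs then 1 else 0)"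
    using computable_pred_not[OF P] unfolding computable_pred_def computable_def
    by (metis (no_types, lifting) length_Cons list.sel(1,3))
  have "rec_eval (Min_rf r) xs = Some (LEAST m. P m xs)" if "length xs = n" for xs
    using r[OF that] ex[OF that] by simp
  then show ?thesis unfolding computable_def by blast
qed

lemma computable_half:
  assumes "computable n f" shows "computable n (\<lambda>xs. f xs div 2)"
proof -
  have "computable n (\<lambda>xs. LEAST k. f xs < 2 * Suc k)"
    by (rule computable_Least)
      (intro computable_pred_less computable_mult computable_Suc computable_const computable_hd
        computable_tl assms, presburger)
  moreover have "(LEAST k. m < 2 * Suc k) = m div 2" for m :: nat
    by (rule Least_equality) auto
  ultimately show ?thesis by simp
qed

subsection \<open>Integers and pairs\<close>

text \<open>
  An integer is handled as the difference of two natural numbers, its positive and its negative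
  part. In this form addition and multiplication are polynomial.
\<close>
lemma int_encode_diff:
  "int_encode (int p - int q) = (if q \<le> p then 2 * (p - q) else 2 * (q - p) - 1)"
  by (auto simp: int_encode_def sum_encode_def nat_diff_distrib)

lemma nat_of_int_encode: "nat z = (if int_encode z = 2 * (int_encode z div 2) then int_encode z div 2 else 0)"
  "nat (- z) = (if int_encode z = 2 * (int_encode z div 2) then 0 else int_encode z - int_encode z div 2)"
  by (auto simp: int_encode_def sum_encode_def)

lemma computable_int_diff_nat:
  assumes "computable n f" "computable n g"
  shows "computable_int n (\<lambda>xs. int (f xs) - int (g xs))"
  unfolding computable_int_def int_encode_diff
  by (intro computable_if computable_pred_le computable_mult computable_diff computable_const assms)

lemma computable_nat:
  assumes "computable_int n f"
  shows "computable n (\<lambda>xs. nat (f xs))" "computable n (\<lambda>xs. nat (- f xs))"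
proof -
  have f: "computable n (\<lambda>xs. int_encode (f xs))"
    using assms unfolding computable_int_def .
  show "computable n (\<lambda>xs. nat (f xs))" unfolding nat_of_int_encode(1)
    by (intro computable_if computable_pred_eq computable_mult computable_half computable_const f)
  show "computable n (\<lambda>xs. nat (- f xs))" unfolding nat_of_int_encode(2)
    by (intro computable_if computable_pred_eq computable_mult computable_half computable_diff
      computable_const f)
qed

lemma computable_int_const: "computable_int n (\<lambda>_. c)"
  unfolding computable_int_def by (rule computable_const)

lemma computable_int_decode: "computable n f \<Longrightarrow> computable_int n (\<lambda>xs. int_decode (f xs))"
  unfolding computable_int_def by simp

lemma computable_int_encode: "computable_int n f \<Longrightarrow> computable n (\<lambda>xs. int_encode (f xs))"
  unfolding computable_int_def .

lemma computable_int_diff: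
  assumes "computable_int n f" "computable_int n g"
  shows "computable_int n (\<lambda>xs. f xs - g xs)"
proof -
  have "computable_int n (\<lambda>xs. int (nat (f xs) + nat (- g xs)) - int (nat (- f xs) + nat (g xs)))"
    by (intro computable_int_diff_nat computable_add computable_nat assms)
  moreover have "int (nat a + nat (- b)) - int (nat (- a) + nat b) = a - b" for a b by auto
  ultimately show ?thesis by simp
qed

lemma computable_int_mult:
  assumes "computable_int n f" "computable_int n g"
  shows "computable_int n (\<lambda>xs. f xs * g xs)"
proof -
  have "computable_int n (\<lambda>xs. int (nat (f xs) * nat (g xs) + nat (- f xs) * nat (- g xs))
      - int (nat (f xs) * nat (- g xs) + nat (- f xs) * nat (g xs)))"
    by (intro computable_int_diff_nat computable_add computable_mult computable_nat assms)
  moreover have "int (nat a * nat b + nat (- a) * nat (- b)) - int (nat a * nat (- b) + nat (- a) * nat b)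
      = a * b" for a b
    by (cases "a \<ge> 0"; cases "b \<ge> 0") auto
  ultimately show ?thesis by simp
qed

lemma computable_pred_int_eq:
  assumes "computable_int n f" "computable_int n g"
  shows "computable_pred n (\<lambda>xs. f xs = g xs)"
  using computable_pred_eq[OF assms[unfolded computable_int_def]] by (simp add: int_encode_eq)

lemma computable_prod_encode:
  assumes "computable n f" "computable n g"
  shows "computable n (\<lambda>xs. prod_encode (f xs, g xs))"
  unfolding prod_encode_def triangle_def prod.case
  by (intro computable_add computable_half computable_mult computable_Suc assms)

text \<open>
  The components of a pair are found by searching, since both are bounded by its code.
\<close>
lemma computable_prod_decode:
  assumes "computable n f"
  shows "computable n (\<lambda>xs. fst (prod_decode (f xs)))" "computable n (\<lambda>xs. snd (prod_decode (f xs)))"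
proof -
  have bound: "a < Suc (prod_encode (a, b))" "b < Suc (prod_encode (a, b))" for a b
    using le_prod_encode_1[of a b] le_prod_encode_2[of b a] by simp_all
  have 1: "(LEAST a. \<exists>b<Suc z. prod_encode (a, b) = z) = fst (prod_decode z)" for z
    by (rule Least_equality) (metis bound prod.collapse prod_decode_inverse, force)
  have 2: "(LEAST b. \<exists>a<Suc z. prod_encode (a, b) = z) = snd (prod_decode z)" for z
    by (rule Least_equality) (metis bound prod.collapse prod_decode_inverse, force)
  have ex: "\<exists>a. \<exists>b<Suc z. prod_encode (a, b) = z" "\<exists>b. \<exists>a<Suc z. prod_encode (a, b) = z" for z
    by (metis bound prod.collapse prod_decode_inverse)+
  have "computable n (\<lambda>xs. LEAST a. \<exists>b<Suc (f xs). prod_encode (a, b) = f xs)"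
    by (rule computable_Least, rule computable_pred_bex)
      (intro computable_pred_eq computable_prod_encode computable_tl computable_hd computable_Suc assms ex)+
  then show "computable n (\<lambda>xs. fst (prod_decode (f xs)))" by (simp add: 1)
  have "computable n (\<lambda>xs. LEAST b. \<exists>a<Suc (f xs). prod_encode (a, b) = f xs)"
    by (rule computable_Least, rule computable_pred_bex)
      (intro computable_pred_eq computable_prod_encode computable_tl computable_hd computable_Suc assms ex)+
  then show "computable n (\<lambda>xs. snd (prod_decode (f xs)))" by (simp add: 2)
qed

subsection \<open>Searching for words\<close>

text \<open>
  A state holds the numerators of three rational coordinates and their common denominator. The
  denominators may grow along a word; in return all arithmetic is exact and free of division.
\<close>
type_synonym qstate = "int \<times> int \<times> int \<times> int"

text \<open>
  The Vieta involutions for the coefficients \<open>A l / N\<close>.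
\<close>
fun qvieta :: "int \<Rightarrow> (3 \<Rightarrow> int) \<Rightarrow> 3 \<Rightarrow> qstate \<Rightarrow> qstate" where
  "qvieta N A l (x, y, z, d) =
    (if l = 1 then (A 1 * (d * d) - N * (y * z) - N * (d * x), N * (d * y), N * (d * z), N * (d * d))
     else if l = 2 then (N * (d * x), A 2 * (d * d) - N * (z * x) - N * (d * y), N * (d * z), N * (d * d))
     else (N * (d * x), N * (d * y), A 3 * (d * d) - N * (x * y) - N * (d * z), N * (d * d)))"

definition letter :: "(nat \<Rightarrow> 3) \<Rightarrow> nat \<Rightarrow> 3" where
  "letter g v = (if v = 0 then g 0 else if v = 1 then g 1 else g 2)"

fun qcode :: "qstate \<Rightarrow> nat" where
  "qcode (x, y, z, d) = prod_encode (int_encode x, prod_encode (int_encode y,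
     prod_encode (int_encode z, int_encode d)))"

definition qdecode :: "nat \<Rightarrow> qstate" where
  "qdecode c = (int_decode (fst (prod_decode c)),
     int_decode (fst (prod_decode (snd (prod_decode c)))),
     int_decode (fst (prod_decode (snd (prod_decode (snd (prod_decode c)))))),
     int_decode (snd (prod_decode (snd (prod_decode (snd (prod_decode c)))))))"

lemma qdecode_qcode [simp]: "qdecode (qcode s) = s"
  by (cases s) (simp add: qdecode_def)

lemma computable_qvieta:
  assumes "computable n f"
  shows "computable n (\<lambda>xs. qcode (qvieta N A l (qdecode (f xs))))"
proof -
  have *: "qcode (if b then s else t) = (if b then qcode s else qcode t)" for b s t by simp
  show ?thesis
    unfolding qdecode_def qvieta.simps * qcode.simps
    by (intro computable_if computable_pred_const computable_prod_encode computable_int_encode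
      computable_int_diff computable_int_mult computable_int_const computable_int_decode
      computable_prod_decode assms)
qed

text \<open>
  A number is read as a word by splitting it repeatedly into a digit and a remainder; one step
  of the simulation reads one letter and applies it.
\<close>
definition read_letter :: "int \<Rightarrow> (3 \<Rightarrow> int) \<Rightarrow> (nat \<Rightarrow> 3) \<Rightarrow> nat \<Rightarrow> nat" where
  "read_letter N A g c = (let w = fst (prod_decode c); s = qdecode (snd (prod_decode c)) in
     prod_encode (snd (prod_decode w), qcode (qvieta N A (letter g (fst (prod_decode w))) s)))"

lemma computable_read_letter:
  assumes "computable n f"
  shows "computable n (\<lambda>xs. read_letter N A g (f xs))"
proof -
  have *: "qcode (qvieta N A (if b then s else t) u) =
      (if b then qcode (qvieta N A s u) else qcode (qvieta N A t u))" for b s t u by simp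
  show ?thesis
    unfolding read_letter_def Let_def letter_def *
    by (intro computable_if computable_pred_eq computable_const computable_prod_encode
      computable_qvieta computable_prod_decode assms)
qed

fun word_code :: "nat list \<Rightarrow> nat" where
  "word_code [] = 0"
| "word_code (v # vs) = prod_encode (v, word_code vs)"

text \<open>
  The code of the word of length \<open>t\<close> in which every digit is maximal.
\<close>
definition word_bound :: "nat \<Rightarrow> nat" where
  "word_bound t = rec_nat 0 (\<lambda>_ b. prod_encode (2, b)) t"

lemma triangle_mono: "m \<le> n \<Longrightarrow> triangle m \<le> triangle n"
  unfolding triangle_def by (intro div_le_mono mult_le_mono) auto

lemma prod_encode_mono: "a \<le> a' \<Longrightarrow> b \<le> b' \<Longrightarrow> prod_encode (a, b) \<le> prod_encode (a', b')"
  unfolding prod_encode_def by (auto intro!: add_mono triangle_mono)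

lemma word_code_le: "set vs \<subseteq> {0, 1, 2} \<Longrightarrow> word_code vs \<le> word_bound (length vs)"
proof (induction vs)
  case (Cons v vs)
  then show ?case by (auto simp: word_bound_def intro!: prod_encode_mono)
qed (simp add: word_bound_def)

lemma read_word_code:
  "((read_letter N A g) ^^ length vs) (prod_encode (word_code vs, qcode s)) =
     prod_encode (0, qcode (fold (qvieta N A) (map (letter g) vs) s))"
proof (induction vs arbitrary: s)
  case (Cons v vs)
  have "((read_letter N A g) ^^ length (v # vs)) (prod_encode (word_code (v # vs), qcode s))
      = ((read_letter N A g) ^^ length vs) (read_letter N A g (prod_encode (word_code (v # vs), qcode s)))"
    by (simp only: list.size funpow_simps_right add_0_right add_Suc_right comp_def)
  also have "read_letter N A g (prod_encode (word_code (v # vs), qcode s))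
      = prod_encode (word_code vs, qcode (qvieta N A (letter g v) s))"
    by (simp add: read_letter_def)
  finally show ?case using Cons.IH by simp
qed simp

lemma read_any_code:
  "\<exists>ws m. length ws = t \<and> set ws \<subseteq> {g 0, g 1, g 2} \<and>
     ((read_letter N A g) ^^ t) (prod_encode (n, qcode s)) =
     prod_encode (m, qcode (fold (qvieta N A) ws s))"
proof (induction t arbitrary: n s)
  case (Suc t)
  let ?l = "letter g (fst (prod_decode n))"
  obtain ws m where "length ws = t" "set ws \<subseteq> {g 0, g 1, g 2}"
    "((read_letter N A g) ^^ t) (prod_encode (snd (prod_decode n), qcode (qvieta N A ?l s)))
      = prod_encode (m, qcode (fold (qvieta N A) ws (qvieta N A ?l s)))"
    using Suc.IH by blast
  moreover have "((read_letter N A g) ^^ Suc t) (prod_encode (n, qcode s))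
    = ((read_letter N A g) ^^ t) (read_letter N A g (prod_encode (n, qcode s)))"
    by (simp only: funpow_simps_right comp_def)
  moreover have "read_letter N A g (prod_encode (n, qcode s))
      = prod_encode (snd (prod_decode n), qcode (qvieta N A ?l s))"
    by (simp add: read_letter_def)
  ultimately show ?case
    by (intro exI[of _ "?l # ws"] exI[of _ m]) (auto simp: letter_def)
qed simp

text \<open>
  It is enough to search through the words of one prescribed length, because a shorter word of the same
  parity can be padded with pairs of equal letters.
\<close>
definition word_search :: "int \<Rightarrow> (3 \<Rightarrow> int) \<Rightarrow> 3 set \<Rightarrow> nat \<Rightarrow> int \<times> int \<times> int \<Rightarrow> int \<times> int \<times> int \<Rightarrow> bool" where
  "word_search N A I t x z \<longleftrightarrow> (\<exists>ws. length ws = t \<and> set ws \<subseteq> I \<and>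
     (case fold (qvieta N A) ws (fst x, fst (snd x), snd (snd x), 1) of (u1, u2, u3, d) \<Rightarrow>
        N * u1 = fst z * d \<and> N * u2 = fst (snd z) * d \<and> N * u3 = snd (snd z) * d))"

lemma letters_cover: 
  assumes "I \<noteq> {}" shows "\<exists>g :: nat \<Rightarrow> 3. {g 0, g 1, g 2} = I"
proof -
  obtain a where a: "a \<in> I" using assms by blast
  define b where "b i = (if i \<in> I then i else a)" for i :: 3
  have b: "b i \<in> I" "i \<in> I \<Longrightarrow> b i = i" for i using a by (simp_all add: b_def)
  define g :: "nat \<Rightarrow> 3" where "g v = (if v = 0 then b 1 else if v = 1 then b 2 else b 3)" for v
  have "x \<in> {b 1, b 2, b 3}" if "x \<in> I" for x
    using exhaust_3[of x] b(2)[OF that] by (metis insertCI)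
  then have "{b 1, b 2, b 3} = I" using b(1) by blast
  then have "{g 0, g 1, g 2} = I" by (simp add: g_def)
  then show ?thesis by blast
qed

text \<open>
  The codes of all words of length \<open>t\<close> over three letters are bounded by \<open>word_bound t\<close>, and every number below
  the bound describes some word. So the search is a bounded quantifier over a simulation.
\<close>
lemma computable_word_search:
  assumes I: "I \<noteq> {}" and t: "computable n t"
    and x: "computable_int n x1" "computable_int n x2" "computable_int n x3"
    and z: "computable_int n z1" "computable_int n z2" "computable_int n z3"
  shows "computable_pred n (\<lambda>xs. word_search N A I (t xs) (x1 xs, x2 xs, x3 xs) (z1 xs, z2 xs, z3 xs))"
proof -
  obtain g :: "nat \<Rightarrow> 3" where g: "{g 0, g 1, g 2} = I" using letters_cover[OF I] by blast
  define run where "run m xs = (case qdecode (snd (prod_decode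
      (rec_nat (prod_encode (m, qcode (x1 xs, x2 xs, x3 xs, 1))) (\<lambda>_. read_letter N A g) (t xs)))) of
        (u1, u2, u3, d) \<Rightarrow> N * u1 = z1 xs * d \<and> N * u2 = z2 xs * d \<and> N * u3 = z3 xs * d)" for m xs
  have tl: "computable_int (Suc n) (\<lambda>zs. f (tl zs))" if "computable_int n f" for f
    using that unfolding computable_int_def by (rule computable_tl)
  have state: "computable (Suc n) (\<lambda>zs. rec_nat (prod_encode (hd zs, qcode (x1 (tl zs), x2 (tl zs), x3 (tl zs), 1)))
      (\<lambda>_. read_letter N A g) (t (tl zs)))"
    unfolding qcode.simps
    by (rule computable_rec)
      (intro computable_prod_encode computable_int_encode tl x computable_hd computable_int_const
        computable_tl t computable_read_letter)+
  have "computable_pred (Suc n) (\<lambda>zs. run (hd zs) (tl zs))"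
    unfolding run_def qdecode_def prod.case
    by (intro computable_pred_and computable_pred_int_eq computable_int_mult computable_int_const
        computable_int_decode computable_prod_decode state tl z)
  moreover have "computable n (\<lambda>xs. Suc (word_bound (t xs)))"
    unfolding word_bound_def
    by (intro computable_Suc computable_rec computable_const t computable_prod_encode computable_tl computable_hd)
  ultimately have *: "computable_pred n (\<lambda>xs. \<exists>m<Suc (word_bound (t xs)). run m xs)"
    by (rule computable_pred_bex)
  have rec_funpow: "rec_nat a (\<lambda>_. f) k = (f ^^ k) a" for a k and f :: "nat \<Rightarrow> nat"
    by (induction k) auto
  define ok where "ok xs u = (case u of (u1, u2, u3, d) \<Rightarrow>
      N * u1 = z1 xs * d \<and> N * u2 = z2 xs * d \<and> N * u3 = z3 xs * d)" for xs and u :: qstate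
  define s0 where "s0 xs = (x1 xs, x2 xs, x3 xs, 1 :: int)" for xs
  have run: "run m xs \<longleftrightarrow> ok xs (qdecode (snd (prod_decode
      (((read_letter N A g) ^^ t xs) (prod_encode (m, qcode (s0 xs)))))))" for m xs
    unfolding run_def ok_def rec_funpow s0_def ..
  have search: "word_search N A I (t xs) (x1 xs, x2 xs, x3 xs) (z1 xs, z2 xs, z3 xs) \<longleftrightarrow>
      (\<exists>ws. length ws = t xs \<and> set ws \<subseteq> I \<and> ok xs (fold (qvieta N A) ws (s0 xs)))" for xs
    unfolding word_search_def ok_def s0_def fst_conv snd_conv ..
  have "(\<exists>m<Suc (word_bound (t xs)). run m xs) \<longleftrightarrow>
      word_search N A I (t xs) (x1 xs, x2 xs, x3 xs) (z1 xs, z2 xs, z3 xs)" for xs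
  proof
    assume "\<exists>m<Suc (word_bound (t xs)). run m xs"
    then obtain m where m: "run m xs" by blast
    obtain ws m' where ws: "length ws = t xs" "set ws \<subseteq> {g 0, g 1, g 2}"
       "((read_letter N A g) ^^ t xs) (prod_encode (m, qcode (s0 xs))) =
       prod_encode (m', qcode (fold (qvieta N A) ws (s0 xs)))"
      using read_any_code[where t="t xs" and g=g and N=N and A=A and n=m and s="s0 xs"] by blast
    have "ok xs (fold (qvieta N A) ws (s0 xs))"
      using m unfolding run ws(3) prod_encode_inverse snd_conv qdecode_qcode .
    then show "word_search N A I (t xs) (x1 xs, x2 xs, x3 xs) (z1 xs, z2 xs, z3 xs)"
      using ws(1,2) unfolding search g by blast
  next
    assume "word_search N A I (t xs) (x1 xs, x2 xs, x3 xs) (z1 xs, z2 xs, z3 xs)"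
    then obtain ws where ws: "length ws = t xs" "set ws \<subseteq> I" "ok xs (fold (qvieta N A) ws (s0 xs))"
      unfolding search by blast
    have "\<exists>v. v \<in> {0, 1, 2} \<and> letter g v = l" if l: "l \<in> I" for l
    proof -
      have "letter g 0 = g 0" "letter g 1 = g 1" "letter g 2 = g 2" by (simp_all add: letter_def)
      moreover have "l = g 0 \<or> l = g 1 \<or> l = g 2" using l g by blast
      ultimately show ?thesis by (metis insertCI)
    qed
    then obtain v where v: "\<And>l. l \<in> I \<Longrightarrow> v l \<in> {0, 1, 2} \<and> letter g (v l) = l" by metis
    have "map (letter g) (map v ws) = map (\<lambda>l. l) ws"
      unfolding map_map using ws(2) v by (intro map_cong refl) (simp add: subset_iff)
    then have vs: "map (letter g) (map v ws) = ws" by simp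
    have "v l \<in> {0, 1, 2}" if "l \<in> set ws" for l
      using v[of l] that ws(2) by (meson subsetD)
    then have vs2: "set (map v ws) \<subseteq> {0, 1, 2}"
      unfolding set_map by (rule image_subsetI)
    have "((read_letter N A g) ^^ t xs) (prod_encode (word_code (map v ws), qcode (s0 xs)))
        = prod_encode (0, qcode (fold (qvieta N A) ws (s0 xs)))"
      using read_word_code[where vs="map v ws" and s="s0 xs" and N=N and A=A and g=g] unfolding vs length_map ws(1) .
    then have "run (word_code (map v ws)) xs"
      using ws(3) unfolding run by (simp only: prod_encode_inverse snd_conv qdecode_qcode)
    moreover have "word_code (map v ws) < Suc (word_bound (t xs))"
      using word_code_le[OF vs2] unfolding length_map ws(1) by (rule le_imp_less_Suc)
    ultimately show "\<exists>m<Suc (word_bound (t xs)). run m xs"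
      by (intro exI conjI)
  qed
  then show ?thesis using * by (simp only:)
qed

section \<open>Words in the Vieta involutions\<close>

text \<open>
  Points are functions on the three-element type, so that the symmetry between the coordinates
  can be used: statements are made for an arbitrary enumeration \<open>i\<close>, \<open>j\<close>, \<open>k\<close> of the
  indices. The ring is kept general because words are also evaluated on polynomials.
\<close>
definition vieta :: "(3 \<Rightarrow> 'a::comm_ring_1) \<Rightarrow> 3 \<Rightarrow> (3 \<Rightarrow> 'a) \<Rightarrow> 3 \<Rightarrow> 'a" where
  "vieta \<alpha> i p = p(i := \<alpha> i - (\<Prod>j\<in>-{i}. p j) - p i)"

definition walk :: "(3 \<Rightarrow> 'a::comm_ring_1) \<Rightarrow> 3 list \<Rightarrow> (3 \<Rightarrow> 'a) \<Rightarrow> 3 \<Rightarrow> 'a" where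
  "walk \<alpha> ws p = fold (vieta \<alpha>) ws p"

definition on_surface :: "(3 \<Rightarrow> 'a::comm_ring_1) \<Rightarrow> 'a \<Rightarrow> (3 \<Rightarrow> 'a) \<Rightarrow> bool" where
  "on_surface \<alpha> b p \<longleftrightarrow>
     (\<Sum>i\<in>UNIV. p i * p i) + (\<Prod>i\<in>UNIV. p i) = (\<Sum>i\<in>UNIV. \<alpha> i * p i) + b"

definition trio :: "3 \<Rightarrow> 3 \<Rightarrow> 3 \<Rightarrow> bool" where
  "trio i j k \<longleftrightarrow> distinct [i, j, k]"

lemma trio_UNIV: "trio i j k \<Longrightarrow> UNIV = {i, j, k}"
  unfolding trio_def
  by (rule card_subset_eq[symmetric]) (auto simp: card_insert_if)

lemma trio_neq: "trio i j k \<Longrightarrow> i \<noteq> j \<and> j \<noteq> i \<and> i \<noteq> k \<and> k \<noteq> i \<and> j \<noteq> k \<and> k \<noteq> j"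
  by (auto simp: trio_def)

lemma trio_perm: "trio i j k \<Longrightarrow> trio j i k" "trio i j k \<Longrightarrow> trio i k j" "trio i j k \<Longrightarrow> trio k j i"
  "trio i j k \<Longrightarrow> trio j k i" "trio i j k \<Longrightarrow> trio k i j"
  by (auto simp: trio_def)

lemma trio_cases: "trio i j k \<Longrightarrow> l = i \<or> l = j \<or> l = k"
  using trio_UNIV by blast

lemma trio_ex: 
  assumes "i \<noteq> j" shows "\<exists>k. trio i j k"
proof -
  have "card {i, j} < card (UNIV :: 3 set)" using assms by simp
  then have "{i, j} \<noteq> UNIV" by (metis less_irrefl)
  then show ?thesis using assms unfolding trio_def by auto
qed

lemma trio_ex1: "\<exists>j k. trio i j k"
proof -
  have "card {i} < card (UNIV :: 3 set)" by simp
  then have "{i} \<noteq> UNIV" by (metis less_irrefl)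
  then obtain j where "i \<noteq> j" by (metis UNIV_eq_I singletonI)
  then show ?thesis using trio_ex by blast
qed

lemma vieta_same: 
  assumes "trio i j k" shows "vieta \<alpha> i p i = \<alpha> i - p j * p k - p i"
proof -
  have "- {i} = {j, k}" using trio_UNIV[OF assms] trio_neq[OF assms] by auto
  then show ?thesis using trio_neq[OF assms] by (simp add: vieta_def)
qed

lemma vieta_other: "l \<noteq> i \<Longrightarrow> vieta \<alpha> i p l = p l"
  by (simp add: vieta_def)

lemma on_surface_trio:
  assumes "trio i j k"
  shows "on_surface \<alpha> b p \<longleftrightarrow> p i * p i + p j * p j + p k * p k + p i * p j * p k
    = \<alpha> i * p i + \<alpha> j * p j + \<alpha> k * p k + b"
  using trio_neq[OF assms] unfolding on_surface_def trio_UNIV[OF assms]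
  by (simp add: algebra_simps)

lemma ext_trio: "trio i j k \<Longrightarrow> f i = g i \<Longrightarrow> f j = g j \<Longrightarrow> f k = g k \<Longrightarrow> f = g"
  by (rule ext) (metis trio_cases[of i j k])

lemma vieta_twice [simp]: "vieta \<alpha> i (vieta \<alpha> i p) = p"
proof -
  obtain j k where t: "trio i j k" using trio_ex1 by blast
  show ?thesis
    by (rule ext_trio[OF t]) (use trio_neq[OF t] in \<open>simp_all add: vieta_same[OF t] vieta_other\<close>)
qed

lemma on_surface_vieta: 
  assumes "on_surface \<alpha> b p" shows "on_surface \<alpha> b (vieta \<alpha> i p)"
proof -
  obtain j k where t: "trio i j k" using trio_ex1 by blast
  show ?thesis using assms trio_neq[OF t] unfolding on_surface_trio[OF t]
    by (simp add: vieta_same[OF t] vieta_other algebra_simps)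
qed

lemma walk_simps [simp]:
  "walk \<alpha> [] p = p" "walk \<alpha> (i # ws) p = walk \<alpha> ws (vieta \<alpha> i p)"
  "walk \<alpha> (us @ ws) p = walk \<alpha> ws (walk \<alpha> us p)"
  by (simp_all add: walk_def)

lemma walk_rev [simp]: "walk \<alpha> (rev ws) (walk \<alpha> ws p) = p"
  by (induction ws arbitrary: p) auto

lemma on_surface_walk: "on_surface \<alpha> b p \<Longrightarrow> on_surface \<alpha> b (walk \<alpha> ws p)"
  by (induction ws arbitrary: p) (auto simp: on_surface_vieta)

text \<open>Free reduction: deleting a repeated letter changes neither the action nor the parity.\<close>
lemma reduce_word:
  fixes ws :: "3 list"
  shows "\<exists>us. distinct_adj us \<and> even (length us) = even (length ws) \<and>
     (\<forall>\<alpha> p :: 3 \<Rightarrow> 'a::comm_ring_1. walk \<alpha> us p = walk \<alpha> ws p)"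
proof (induction ws)
  case Nil
  show ?case by (rule exI[of _ "[]"]) simp
next
  case (Cons i ws)
  then obtain us where us: "distinct_adj us" "even (length us) = even (length ws)"
    "\<forall>\<alpha> p :: 3 \<Rightarrow> 'a. walk \<alpha> us p = walk \<alpha> ws p" by blast
  show ?case
  proof (cases "\<exists>vs. us = i # vs")
    case True
    then obtain vs where vs: "us = i # vs" by blast
    have "walk \<alpha> vs p = walk \<alpha> (i # ws) p" for \<alpha> p :: "3 \<Rightarrow> 'a"
      using us(3)[rule_format, of \<alpha> "vieta \<alpha> i p"] by (simp add: vs)
    moreover have "distinct_adj vs" "even (length vs) = even (length (i # ws))"
      using us(1,2) unfolding vs by (auto simp: distinct_adj_Cons)
    ultimately show ?thesis by blast
  next
    case False
    then have "distinct_adj (i # us)" using us(1) by (cases us) auto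
    moreover have "even (length (i # us)) = even (length (i # ws))" using us(2) by simp
    moreover have "walk \<alpha> (i # us) p = walk \<alpha> (i # ws) p" for \<alpha> p :: "3 \<Rightarrow> 'a"
      using us(3) by simp
    ultimately show ?thesis by blast
  qed
qed

section \<open>Peaks\<close>

lemma Ints_less_add_one: 
  fixes u v :: real assumes "u \<in> \<int>" "v \<in> \<int>" "u < v + 1" shows "u \<le> v"
proof -
  obtain m n where "u = of_int m" "v = of_int n" using assms by (auto elim!: Ints_cases)
  moreover from this have "m < n + 1" using assms(3) by linarith
  ultimately show ?thesis by simp
qed

text \<open>
  Suppose that the involutions at \<open>x\<close> and \<open>y\<close> do not raise the height. Then \<open>\<bar>x * z\<bar>\<close> is at most about
  \<open>2 * \<bar>y\<bar>\<close>, so \<open>\<bar>z\<bar>\<close> is at most 2 by discreteness once \<open>x\<close> is large. If \<open>\<bar>z\<bar> < 2\<close>, the quadratic form in \<open>x\<close> and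
  \<open>y\<close> is definite and bounds \<open>x\<close>. If \<open>z = \<plusminus>2\<close>, the form is the square of \<open>s = x \<plusminus> y\<close>, and the
  involutions add \<open>a - 2 * s\<close> to \<open>x\<close> and \<open>b \<minusplus> 2 * s\<close> to \<open>y\<close>. As \<open>x\<close> and \<open>y\<close> are almost
  opposite or almost equal, both changes lower the height only if \<open>s\<close> lies between half the
  coefficients. Then the equation bounds \<open>x\<close>, unless the two coefficients agree up to the sign, and in that
  case nothing moves.
\<close>
lemma peak_bound_ordered:
  fixes a b c \<beta> N :: real
  assumes N: "N \<in> \<nat>" "N \<ge> 1"
  shows "\<exists>K. \<forall>x y z. N * x \<in> \<int> \<longrightarrow> N * z \<in> \<int> \<longrightarrow>
     x * x + y * y + z * z + x * y * z = a * x + b * y + c * z + \<beta> \<longrightarrow>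
     \<bar>a - y * z - x\<bar> \<le> \<bar>x\<bar> \<longrightarrow> \<bar>b - x * z - y\<bar> \<le> \<bar>y\<bar> \<longrightarrow> \<bar>y\<bar> \<le> \<bar>x\<bar> \<longrightarrow>
     \<bar>x\<bar> + \<bar>y\<bar> + \<bar>z\<bar> > K \<longrightarrow> a - y * z - x = x \<and> b - x * z - y = y"
proof -
  define A where "A = 1 + \<bar>a\<bar> + \<bar>b\<bar> + \<bar>c\<bar>"
  define B where "B = \<bar>\<beta>\<bar>"
  define D where "D = min (if a = b then 1 else \<bar>a - b\<bar>) (if a = - b then 1 else \<bar>a + b\<bar>)"
  have A: "A \<ge> 1" "\<bar>a\<bar> \<le> A" "\<bar>b\<bar> \<le> A" "\<bar>c\<bar> \<le> A" and B: "B \<ge> 0" "\<bar>\<beta>\<bar> \<le> B"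
    by (auto simp: A_def B_def)
  have D: "D > 0" by (auto simp: D_def)
  \<comment> \<open>the four summands are the bounds for \<open>x\<close> in the four places where its size is used\<close>
  define R where "R = A * N + 2 * N * (4 * A + B) + (4 * A + B + 5) + (2 * A * A + 2 * A + B + 4) / D"
  have AN: "A * N \<ge> 1" "2 * N * (4 * A + B) \<ge> 0" "(2 * A * A + 2 * A + B + 4) / D \<ge> 0"
    using A N B D mult_mono[of 1 A 1 N] by (auto simp: field_simps)
  have R: "R \<ge> A * N" "R \<ge> 2 * N * (4 * A + B)" "R \<ge> 4 * A + B + 5"
     "R \<ge> (2 * A * A + 2 * A + B + 4) / D" "R \<ge> 0"
    unfolding R_def using AN A B by auto
  define K where "K = 2 * R + N * (2 * R + A) + A + B + 1"
  show ?thesis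
  proof (intro exI[of _ K] allI impI)
    fix x y z :: real
    assume int: "N * x \<in> \<int>" "N * z \<in> \<int>"
      and surf: "x * x + y * y + z * z + x * y * z = a * x + b * y + c * z + \<beta>"
      and nx: "\<bar>a - y * z - x\<bar> \<le> \<bar>x\<bar>" and ny: "\<bar>b - x * z - y\<bar> \<le> \<bar>y\<bar>"
      and le: "\<bar>y\<bar> \<le> \<bar>x\<bar>" and big: "\<bar>x\<bar> + \<bar>y\<bar> + \<bar>z\<bar> > K"
    have xz: "\<bar>x\<bar> * \<bar>z\<bar> \<le> 2 * \<bar>y\<bar> + A" using ny A by (simp add: abs_mult[symmetric])
    have bd: "\<bar>a * x\<bar> \<le> A * \<bar>x\<bar>" "\<bar>b * y\<bar> \<le> A * \<bar>y\<bar>" "\<bar>c * z\<bar> \<le> A * \<bar>z\<bar>" "A * \<bar>y\<bar> \<le> A * \<bar>x\<bar>"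
      using A le by (auto simp: abs_mult intro!: mult_right_mono mult_left_mono)
    have xR: "\<bar>x\<bar> > R"
    proof (rule ccontr)
      assume "\<not> \<bar>x\<bar> > R"
      then have x: "\<bar>x\<bar> \<le> R" and y: "\<bar>y\<bar> \<le> R" using le by auto
      have "\<bar>z\<bar> \<le> N * (2 * R + A) + A + B + 1"
      proof (cases "x = 0")
        case True
        then have "y = 0" using le by simp
        then have "z * z = c * z + \<beta>" using surf True by simp
        then have "\<bar>z\<bar> * \<bar>z\<bar> \<le> A * \<bar>z\<bar> + B" using bd B abs_mult_self_eq[of z] by linarith
        then have "\<bar>z\<bar> \<le> A + B + 1"
        proof (rule contrapos_pp)
          assume "\<not> \<bar>z\<bar> \<le> A + B + 1"
          then have "\<bar>z\<bar> > A + B + 1" by simp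
          then have zz: "1 \<le> \<bar>z\<bar>" "0 < \<bar>z\<bar>" using A B by linarith+
          have "(A + B + 1) * \<bar>z\<bar> < \<bar>z\<bar> * \<bar>z\<bar>" 
            by (rule mult_strict_right_mono) (use \<open>\<bar>z\<bar> > A + B + 1\<close> zz in auto)
          moreover have "B * 1 \<le> B * \<bar>z\<bar>" by (rule mult_left_mono) (use zz B in auto)
          ultimately show "\<not> \<bar>z\<bar> * \<bar>z\<bar> \<le> A * \<bar>z\<bar> + B" using zz unfolding distrib_right by linarith
        qed
        moreover have "N * (2 * R + A) \<ge> 0" using N A R by auto
        ultimately show ?thesis by linarith
      next
        case False
        have "\<bar>N * x\<bar> \<ge> 1" using int(1) False N by (intro Ints_nonzero_abs_ge1) auto
        then have "1 * \<bar>z\<bar> \<le> \<bar>N * x\<bar> * \<bar>z\<bar>" by (intro mult_right_mono) auto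
        also have "\<dots> = N * (\<bar>x\<bar> * \<bar>z\<bar>)" using N by (simp add: abs_mult)
        also have "\<dots> \<le> N * (2 * \<bar>y\<bar> + A)" using xz N by (intro mult_left_mono) auto
        also have "\<dots> \<le> N * (2 * R + A)" using y N by (intro mult_left_mono) auto
        finally show ?thesis using A B by simp
      qed
      then show False using big x y unfolding K_def by linarith
    qed
    have x0: "\<bar>x\<bar> > 0" "\<bar>x\<bar> \<ge> 1" using xR R A B by linarith+
    have "\<bar>x\<bar> * \<bar>z\<bar> \<le> 2 * \<bar>x\<bar> + A" using xz le by linarith
    then have "\<bar>z\<bar> \<le> 2 + A / \<bar>x\<bar>" using x0 by (simp add: field_simps)
    then have "N * \<bar>z\<bar> \<le> N * (2 + A / \<bar>x\<bar>)" using N by (intro mult_left_mono) auto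
    also have "\<dots> = 2 * N + A * N / \<bar>x\<bar>" by (simp add: algebra_simps)
    also have "A * N / \<bar>x\<bar> < 1" using xR R x0 by (simp add: field_simps)
    finally have Nz: "N * \<bar>z\<bar> < 2 * N + 1" by simp
    have NzI: "N * \<bar>z\<bar> \<in> \<int>" "2 * N \<in> \<int>"
      using int(2) N by (auto simp: abs_if Nats_altdef1 intro: Ints_mult)
    then have "N * \<bar>z\<bar> \<le> 2 * N" using Nz by (intro Ints_less_add_one) auto
    then have z2: "\<bar>z\<bar> \<le> 2" using N by simp
    have z2': "\<bar>z\<bar> = 2"
    proof (rule ccontr)
      assume "\<bar>z\<bar> \<noteq> 2"
      then have "N * \<bar>z\<bar> < 2 * N" using z2 N by simp
      then have "N * \<bar>z\<bar> \<le> 2 * N - 1" using NzI by (intro Ints_less_add_one Ints_diff) auto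
      then have z3: "\<bar>z\<bar> \<le> 2 - 1 / N" using N by (simp add: field_simps)
      have "\<bar>x * y\<bar> \<le> (x * x + y * y) / 2"
        using sum_squares_bound[of "\<bar>x\<bar>" "\<bar>y\<bar>"] by (simp add: power2_eq_square abs_mult)
      then have "\<bar>x * y\<bar> * \<bar>z\<bar> \<le> (x * x + y * y) / 2 * (2 - 1 / N)"
        using z3 by (intro mult_mono) auto
      then have "- (x * y * z) \<le> (x * x + y * y) / 2 * (2 - 1 / N)"
        using abs_ge_minus_self[of "x * y * z"] by (simp add: abs_mult)
      moreover have "(x * x + y * y) / 2 * (2 - 1 / N) = x * x + y * y - (x * x + y * y) / (2 * N)"
        using N by (simp add: field_simps)
      ultimately have "(x * x + y * y) / (2 * N) \<le> x * x + y * y + x * y * z" by linarith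
      also have "\<dots> \<le> a * x + b * y + c * z + \<beta>" using surf zero_le_square[of z] by linarith
      also have "\<dots> \<le> 2 * A * \<bar>x\<bar> + 2 * A + B"
      proof -
        have "A * \<bar>z\<bar> \<le> A * 2" using z2 A by (intro mult_left_mono) auto
        then show ?thesis using bd B by linarith
      qed
      also have "\<dots> \<le> (4 * A + B) * \<bar>x\<bar>"
      proof -
        have "2 * A * 1 \<le> 2 * A * \<bar>x\<bar>" by (rule mult_left_mono) (use x0 A in auto)
        moreover have "B * 1 \<le> B * \<bar>x\<bar>" by (rule mult_left_mono) (use x0 B in auto)
        ultimately show ?thesis by (simp add: algebra_simps)
      qed
      finally have "x * x + y * y \<le> (4 * A + B) * \<bar>x\<bar> * (2 * N)" using N by (simp add: field_simps)
      then have "\<bar>x\<bar> * \<bar>x\<bar> \<le> (2 * N * (4 * A + B)) * \<bar>x\<bar>"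
        using zero_le_square[of y] abs_mult_self_eq[of x] by (simp only: ac_simps)
      then have "\<bar>x\<bar> \<le> 2 * N * (4 * A + B)" by (rule mult_right_le_imp_le[OF _ x0(1)])
      then show False using xR R by linarith
    qed
    \<comment> \<open>the degenerate sections, where the form is a square\<close>
    define e where "e = z / 2"
    have e: "e = 1 \<or> e = -1" and ze: "z = 2 * e" using z2' by (auto simp: e_def abs_if split: if_splits)
    have ee: "e * e = 1" using e by auto
    define s where "s = x + e * y"
    have ey: "e * y = s - x" "y = e * (s - x)" using e by (auto simp: s_def)
    define C where "C = \<beta> - 4 + 2 * e * c"
    have ss: "s * s = a * x + b * y + C"
    proof -
      have "s * s = x * x + y * y * (e * e) + x * y * z" by (simp add: s_def ze algebra_simps)
      then show ?thesis using surf ee by (simp add: C_def ze algebra_simps)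
    qed
    have C: "\<bar>C\<bar> \<le> B + 4 + 2 * A" using e B A by (auto simp: C_def abs_if split: if_splits)
    have vx: "a - y * z - x = x + (a - 2 * s)" by (simp add: ze s_def algebra_simps)
    have vy: "b - x * z - y = e * (e * b - (x + s))"
    proof -
      have "e * (e * b - (x + s)) = (e * e) * b - 2 * e * x - (e * e) * y" by (simp add: s_def algebra_simps)
      then show ?thesis using ee by (simp add: ze algebra_simps)
    qed
    have ax: "\<bar>y\<bar> = \<bar>s - x\<bar>" using ey e by (metis abs_minus_commute abs_mult abs_1 abs_minus_cancel mult_1)
    have ny': "\<bar>e * b - (x + s)\<bar> \<le> \<bar>s - x\<bar>"
      using ny unfolding vy ax using e by (auto simp: abs_mult)
    have nx': "\<bar>x + (a - 2 * s)\<bar> \<le> \<bar>x\<bar>" using nx unfolding vx .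
    have sx: "\<bar>s\<bar> < \<bar>x\<bar>"
    proof (rule ccontr)
      assume "\<not> \<bar>s\<bar> < \<bar>x\<bar>"
      then have "\<bar>x\<bar> * \<bar>x\<bar> \<le> \<bar>s\<bar> * \<bar>s\<bar>" by (intro mult_mono) auto
      also have "\<dots> = s * s" by simp
      also have "\<dots> \<le> 2 * A * \<bar>x\<bar> + (B + 4 + 2 * A)" using ss bd C by linarith
      also have "\<dots> \<le> 2 * A * \<bar>x\<bar> + (B + 4 + 2 * A) * \<bar>x\<bar>"
        using x0 A B mult_left_mono[of 1 "\<bar>x\<bar>" "B + 4 + 2 * A"] by simp
      also have "\<dots> = (4 * A + B + 4) * \<bar>x\<bar>" by (simp add: algebra_simps)
      finally have "\<bar>x\<bar> \<le> 4 * A + B + 4" by (rule mult_right_le_imp_le[OF _ x0(1)])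
      then show False using xR R by linarith
    qed
    have between: "(a \<le> 2 * s \<and> 2 * s \<le> e * b) \<or> (e * b \<le> 2 * s \<and> 2 * s \<le> a)"
      using nx' ny' sx by (auto simp: abs_if split: if_splits)
    have eb: "\<bar>e * b\<bar> \<le> A" using e A by (auto simp: abs_mult)
    have sA: "\<bar>2 * s\<bar> \<le> A" using between eb A by linarith
    show "a - y * z - x = x \<and> b - x * z - y = y"
    proof (cases "a = e * b")
      case True
      then have "2 * s = a" using between by auto
      then have "a - y * z - x = x" using vx by simp
      moreover have "e * b - (x + s) = s - x" using True \<open>2 * s = a\<close> by linarith
      then have "b - x * z - y = e * (s - x)" using vy by simp
      ultimately show ?thesis using ey by simp
    next
      case False
      have De: "D \<le> \<bar>a - e * b\<bar>" using e False by (auto simp: D_def)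
      have "(a - e * b) * x = s * s - C - e * b * s" using ss ey(2) by (simp add: algebra_simps)
      then have "\<bar>a - e * b\<bar> * \<bar>x\<bar> \<le> \<bar>s * s\<bar> + \<bar>C\<bar> + \<bar>e * b * s\<bar>"
        unfolding abs_mult[symmetric] by linarith
      moreover have "\<bar>s * s\<bar> \<le> A * A" unfolding abs_mult using sA A by (intro mult_mono) auto
      moreover have "\<bar>e * b * s\<bar> \<le> A * A" unfolding abs_mult[of "e * b"] using sA eb A by (intro mult_mono) auto
      ultimately have "\<bar>a - e * b\<bar> * \<bar>x\<bar> \<le> 2 * A * A + 2 * A + B + 4" using C by linarith
      moreover have "D * \<bar>x\<bar> \<le> \<bar>a - e * b\<bar> * \<bar>x\<bar>" using De by (intro mult_right_mono) auto
      ultimately have "D * \<bar>x\<bar> \<le> 2 * A * A + 2 * A + B + 4" by (rule order_trans[rotated])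
      then have "\<bar>x\<bar> \<le> (2 * A * A + 2 * A + B + 4) / D"
        unfolding pos_le_divide_eq[OF D] by (simp only: mult.commute)
      then show ?thesis using xR R by linarith
    qed
  qed
qed

lemma peak_bound:
  fixes a b c \<beta> N :: real
  assumes N: "N \<in> \<nat>" "N \<ge> 1"
  shows "\<exists>K. \<forall>x y z. N * x \<in> \<int> \<longrightarrow> N * y \<in> \<int> \<longrightarrow> N * z \<in> \<int> \<longrightarrow>
     x * x + y * y + z * z + x * y * z = a * x + b * y + c * z + \<beta> \<longrightarrow>
     \<bar>a - y * z - x\<bar> \<le> \<bar>x\<bar> \<longrightarrow> \<bar>b - x * z - y\<bar> \<le> \<bar>y\<bar> \<longrightarrow>
     \<bar>x\<bar> + \<bar>y\<bar> + \<bar>z\<bar> > K \<longrightarrow> a - y * z - x = x \<and> b - x * z - y = y"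
proof -
  obtain K where K: "\<And>x y z. N * x \<in> \<int> \<Longrightarrow> N * z \<in> \<int> \<Longrightarrow>
     x * x + y * y + z * z + x * y * z = a * x + b * y + c * z + \<beta> \<Longrightarrow>
     \<bar>a - y * z - x\<bar> \<le> \<bar>x\<bar> \<Longrightarrow> \<bar>b - x * z - y\<bar> \<le> \<bar>y\<bar> \<Longrightarrow> \<bar>y\<bar> \<le> \<bar>x\<bar> \<Longrightarrow>
     \<bar>x\<bar> + \<bar>y\<bar> + \<bar>z\<bar> > K \<Longrightarrow> a - y * z - x = x \<and> b - x * z - y = y"
    using peak_bound_ordered[OF N, of a b c \<beta>] by blast
  obtain K' where K': "\<And>x y z. N * x \<in> \<int> \<Longrightarrow> N * z \<in> \<int> \<Longrightarrow>
     x * x + y * y + z * z + x * y * z = b * x + a * y + c * z + \<beta> \<Longrightarrow>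
     \<bar>b - y * z - x\<bar> \<le> \<bar>x\<bar> \<Longrightarrow> \<bar>a - x * z - y\<bar> \<le> \<bar>y\<bar> \<Longrightarrow> \<bar>y\<bar> \<le> \<bar>x\<bar> \<Longrightarrow>
     \<bar>x\<bar> + \<bar>y\<bar> + \<bar>z\<bar> > K' \<Longrightarrow> b - y * z - x = x \<and> a - x * z - y = y"
    using peak_bound_ordered[OF N, of b a c \<beta>] by blast
  show ?thesis
  proof (intro exI[of _ "max K K'"] allI impI)
    fix x y z
    assume *: "N * x \<in> \<int>" "N * y \<in> \<int>" "N * z \<in> \<int>"
     "x * x + y * y + z * z + x * y * z = a * x + b * y + c * z + \<beta>"
     "\<bar>a - y * z - x\<bar> \<le> \<bar>x\<bar>" "\<bar>b - x * z - y\<bar> \<le> \<bar>y\<bar>" "\<bar>x\<bar> + \<bar>y\<bar> + \<bar>z\<bar> > max K K'"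
    show "a - y * z - x = x \<and> b - x * z - y = y"
    proof (cases "\<bar>y\<bar> \<le> \<bar>x\<bar>")
      case True
      then show ?thesis using K[of x z y] * by simp
    next
      case False
      then have "\<bar>x\<bar> \<le> \<bar>y\<bar>" "\<bar>y\<bar> + \<bar>x\<bar> + \<bar>z\<bar> > K'" using * by simp_all
      moreover have "y * y + x * x + z * z + y * x * z = b * y + a * x + c * z + \<beta>"
        using *(4) by (simp add: algebra_simps)
      ultimately show ?thesis using K'[of y z x] * by blast
    qed
  qed
qed

definition height :: "(3 \<Rightarrow> complex) \<Rightarrow> real" where
  "height p = (\<Sum>l\<in>UNIV. cmod (p l))"

lemma height_trio: "trio i j k \<Longrightarrow> height p = cmod (p i) + cmod (p j) + cmod (p k)"
  unfolding height_def trio_UNIV[of i j k] by (auto simp: trio_def)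

definition lattice :: "nat \<Rightarrow> (3 \<Rightarrow> complex) set" where
  "lattice N = {p. \<forall>l. of_nat N * p l \<in> \<int>}"

lemma lattice_real:
  assumes "p \<in> lattice N" "N > 0"
  shows "\<exists>r :: real. p l = of_real r \<and> real N * r \<in> \<int>"
proof -
  obtain m where "of_nat N * p l = of_int m" using assms(1) by (auto simp: lattice_def elim!: Ints_cases)
  then have "p l = of_real (of_int m / real N)" "real N * (of_int m / real N) = of_int m"
    using assms(2) by (auto simp: field_simps)
  then show ?thesis by (metis Ints_of_int)
qed

lemma peak_points_pair:
  assumes N: "N > 0" and t: "trio i j k" and real: "\<alpha> i \<in> \<real>" "\<alpha> j \<in> \<real>"
  shows "\<exists>K. \<forall>p. p \<in> lattice N \<longrightarrow> on_surface \<alpha> b p \<longrightarrow>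
     height (vieta \<alpha> i p) \<le> height p \<longrightarrow> height (vieta \<alpha> j p) \<le> height p \<longrightarrow> height p > K \<longrightarrow>
     vieta \<alpha> i p = p \<and> vieta \<alpha> j p = p"
proof -
  obtain ai aj where a: "\<alpha> i = of_real ai" "\<alpha> j = of_real aj" using real by (auto elim!: Reals_cases)
  have N': "real N \<in> \<nat>" "real N \<ge> 1" using N by auto
  obtain K where K: "\<And>x y z. real N * x \<in> \<int> \<Longrightarrow> real N * y \<in> \<int> \<Longrightarrow> real N * z \<in> \<int> \<Longrightarrow>
     x * x + y * y + z * z + x * y * z = ai * x + aj * y + Re (\<alpha> k) * z + Re b \<Longrightarrow>
     \<bar>ai - y * z - x\<bar> \<le> \<bar>x\<bar> \<Longrightarrow> \<bar>aj - x * z - y\<bar> \<le> \<bar>y\<bar> \<Longrightarrow>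
     \<bar>x\<bar> + \<bar>y\<bar> + \<bar>z\<bar> > K \<Longrightarrow> ai - y * z - x = x \<and> aj - x * z - y = y"
    using peak_bound[OF N', of ai aj "Re (\<alpha> k)" "Re b"] by blast
  note ne = trio_neq[OF t]
  show ?thesis
  proof (intro exI[of _ K] allI impI)
    fix p assume p: "p \<in> lattice N" "on_surface \<alpha> b p" and h: "height (vieta \<alpha> i p) \<le> height p"
      "height (vieta \<alpha> j p) \<le> height p" and big: "height p > K"
    obtain x y z :: real where xyz: "p i = of_real x" "p j = of_real y" "p k = of_real z"
      "real N * x \<in> \<int>" "real N * y \<in> \<int>" "real N * z \<in> \<int>"
      using lattice_real[OF p(1) N] by metis
    have vi: "vieta \<alpha> i p i = of_real (ai - y * z - x)" and vj: "vieta \<alpha> j p j = of_real (aj - x * z - y)"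
      by (simp_all add: vieta_same[OF t] vieta_same[OF trio_perm(1)[OF t]] a xyz)
    have "Re (p i * p i + p j * p j + p k * p k + p i * p j * p k)
        = Re (\<alpha> i * p i + \<alpha> j * p j + \<alpha> k * p k + b)"
      using p(2) unfolding on_surface_trio[OF t] by simp
    then have surf: "x * x + y * y + z * z + x * y * z = ai * x + aj * y + Re (\<alpha> k) * z + Re b"
      by (simp add: xyz a)
    have "\<bar>ai - y * z - x\<bar> \<le> \<bar>x\<bar>" "\<bar>aj - x * z - y\<bar> \<le> \<bar>y\<bar>" "\<bar>x\<bar> + \<bar>y\<bar> + \<bar>z\<bar> > K"
      using h big ne unfolding height_trio[OF t]
      by (simp_all only: vi vj xyz vieta_other norm_of_real not_False_eq_True)
    then have "ai - y * z - x = x \<and> aj - x * z - y = y"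
      by (intro K xyz surf)
    then show "vieta \<alpha> i p = p \<and> vieta \<alpha> j p = p"
      using vi vj xyz ne by (auto intro!: ext_trio[OF t] simp: vieta_other)
  qed
qed

text \<open>
  Only the coefficients at the letters in \<open>I\<close> have to be real for this, and the
  other ones enter through their real parts.
\<close>
definition no_peak_above :: "(3 \<Rightarrow> complex) \<Rightarrow> complex \<Rightarrow> nat \<Rightarrow> 3 set \<Rightarrow> real \<Rightarrow> bool" where
  "no_peak_above \<alpha> b N I K \<longleftrightarrow> (\<forall>p i j. p \<in> lattice N \<longrightarrow> on_surface \<alpha> b p \<longrightarrow> i \<in> I \<longrightarrow> j \<in> I \<longrightarrow> i \<noteq> j \<longrightarrow>
     height (vieta \<alpha> i p) \<le> height p \<longrightarrow> height (vieta \<alpha> j p) \<le> height p \<longrightarrow> height p > K \<longrightarrow>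
     vieta \<alpha> i p = p \<and> vieta \<alpha> j p = p)"

lemma peak_points:
  assumes N: "N > 0" and real: "\<forall>i\<in>I. \<alpha> i \<in> \<real>"
  shows "\<exists>K. no_peak_above \<alpha> b N I K"
proof -
  define P where "P i j K \<longleftrightarrow> (\<forall>p. p \<in> lattice N \<longrightarrow> on_surface \<alpha> b p \<longrightarrow>
     height (vieta \<alpha> i p) \<le> height p \<longrightarrow> height (vieta \<alpha> j p) \<le> height p \<longrightarrow> height p > K \<longrightarrow>
     vieta \<alpha> i p = p \<and> vieta \<alpha> j p = p)" for i j K
  have "\<exists>K. i \<in> I \<longrightarrow> j \<in> I \<longrightarrow> i \<noteq> j \<longrightarrow> P i j K" for i j
    using peak_points_pair[OF N] trio_ex[of i j] real unfolding P_def by blast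
  then obtain K where K: "\<And>i j. i \<in> I \<Longrightarrow> j \<in> I \<Longrightarrow> i \<noteq> j \<Longrightarrow> P i j (K i j)" by metis
  define K0 where "K0 = Max (range (\<lambda>(i, j). K i j))"
  have K0: "K i j \<le> K0" for i j
    unfolding K0_def by (rule Max_ge) (auto intro: rev_image_eqI[of "(i, j)"])
  have "P i j K0" if "i \<in> I" "j \<in> I" "i \<noteq> j" for i j
    using K[OF that] K0[of i j] unfolding P_def by (meson le_less_trans)
  then show ?thesis unfolding P_def no_peak_above_def by blast
qed

section \<open>Bounded words\<close>

text \<open>
  The condition on all intermediate points matters when the letters alone do not keep the denominators bounded.
\<close>
definition walk_within :: "(3 \<Rightarrow> complex) \<Rightarrow> 3 set \<Rightarrow> (3 \<Rightarrow> complex) set \<Rightarrow> 3 list \<Rightarrow>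
    (3 \<Rightarrow> complex) \<Rightarrow> (3 \<Rightarrow> complex) \<Rightarrow> bool" where
  "walk_within \<alpha> I W ws p q \<longleftrightarrow> set ws \<subseteq> I \<and> walk \<alpha> ws p = q \<and> (\<forall>m\<le>length ws. walk \<alpha> (take m ws) p \<in> W)"

lemma walk_within_shortcut:
  assumes w: "walk_within \<alpha> I W ws p q" and m: "m < n" "n \<le> length ws"
    and eq: "walk \<alpha> (take m ws) p = walk \<alpha> (take n ws) p"
  shows "walk_within \<alpha> I W (take m ws @ drop n ws) p q"
proof -
  have "walk \<alpha> (take m ws @ drop n ws) p = walk \<alpha> (drop n ws) (walk \<alpha> (take n ws) p)"
    by (simp add: eq)
  also have "\<dots> = walk \<alpha> (take n ws @ drop n ws) p" by (simp only: walk_simps)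
  finally have 1: "walk \<alpha> (take m ws @ drop n ws) p = q" using w by (simp add: walk_within_def)
  have 2: "walk \<alpha> (take l (take m ws @ drop n ws)) p \<in> W" if l: "l \<le> length (take m ws @ drop n ws)" for l
  proof (cases "l \<le> m")
    case True
    then have "take l (take m ws @ drop n ws) = take l ws" using m by simp
    then show ?thesis using w True m unfolding walk_within_def by auto
  next
    case False
    then have "take l (take m ws @ drop n ws) = take m ws @ take (l - m) (drop n ws)" using m by simp
    then have "walk \<alpha> (take l (take m ws @ drop n ws)) p = walk \<alpha> (take n ws @ take (l - m) (drop n ws)) p"
      by (simp add: eq)
    also have "take n ws @ take (l - m) (drop n ws) = take (n + (l - m)) ws"
      by (simp add: take_add)
    finally show ?thesis using w l m False unfolding walk_within_def by auto
  qed
  have "set (take m ws @ drop n ws) \<subseteq> I"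
    using w set_take_subset[of m ws] set_drop_subset[of n ws] unfolding walk_within_def by auto
  then show ?thesis using 1 2 unfolding walk_within_def by blast
qed

text \<open>
  The explicit bound for the number of points is what makes the search bound computable.
\<close>
lemma finite_lattice_ball:
  assumes "N > 0"
  shows "finite {p \<in> lattice N. \<forall>l. cmod (p l) \<le> real B}" (is "finite ?F")
    and "card {p \<in> lattice N. \<forall>l. cmod (p l) \<le> real B} \<le> (2 * N * B + 1) ^ 3"
proof -
  let ?G = "PiE (UNIV :: 3 set) (\<lambda>_. {- int (N * B)..int (N * B)})"
  let ?f = "\<lambda>(g :: 3 \<Rightarrow> int) l. of_int (g l) / of_nat N :: complex"
  have sub: "?F \<subseteq> ?f ` ?G"
  proof
    fix p assume p: "p \<in> ?F"
    then have "\<forall>l. \<exists>m. of_nat N * p l = of_int m" unfolding lattice_def by (auto elim!: Ints_cases)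
    then obtain g where g: "\<And>l. of_nat N * p l = of_int (g l)" by metis
    have "\<bar>g l\<bar> \<le> int (N * B)" for l
    proof -
      have "real_of_int \<bar>g l\<bar> = cmod (of_nat N * p l)" by (simp add: g)
      also have "\<dots> \<le> real N * real B" using p by (simp add: norm_mult mult_left_mono)
      finally have "real_of_int \<bar>g l\<bar> \<le> real_of_int (int (N * B))" by simp
      then show ?thesis by (simp only: of_int_le_iff)
    qed
    then have "g \<in> ?G" by (auto simp: abs_le_iff minus_le_iff)
    moreover have "p = ?f g" using g assms by (auto simp: fun_eq_iff field_simps)
    ultimately show "p \<in> ?f ` ?G" by blast
  qed
  have fin: "finite ?G" by (intro finite_PiE) auto
  then show "finite ?F" using sub finite_surj by blast
  have "card ?F \<le> card ?G" using sub fin by (rule surj_card_le[rotated])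
  also have "card ?G = (2 * N * B + 1) ^ 3"
  proof -
    have "nat (int (N * B) - - int (N * B) + 1) = 2 * N * B + 1"
      by (simp add: nat_add_distrib nat_mult_distrib)
    then show ?thesis by (simp add: card_PiE)
  qed
  finally show "card ?F \<le> (2 * N * B + 1) ^ 3" .
qed

lemma ex_max_up_to: fixes L :: nat shows "\<exists>n\<le>L. \<forall>l\<le>L. f l \<le> (f n :: real)"
proof (induction L)
  case (Suc L)
  then obtain n where n: "n \<le> L" "\<forall>l\<le>L. f l \<le> f n" by blast
  show ?case
  proof (cases "f (Suc L) \<le> f n")
    case True
    then show ?thesis using n by (intro exI[of _ n]) (auto simp: le_Suc_eq)
  next
    case False
    then have "f l \<le> f (Suc L)" if "l \<le> L" for l using n(2) that by force
    then show ?thesis by (intro exI[of _ "Suc L"]) (auto simp: le_Suc_eq)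
  qed
qed simp

definition short_walks :: "(3 \<Rightarrow> complex) \<Rightarrow> 3 set \<Rightarrow> (3 \<Rightarrow> complex) set \<Rightarrow> nat \<Rightarrow> nat \<Rightarrow> bool" where
  "short_walks \<alpha> I W N K \<longleftrightarrow> (\<forall>p q B ws. real B \<ge> height p \<longrightarrow> real B \<ge> height q \<longrightarrow> B \<ge> K \<longrightarrow>
     walk_within \<alpha> I W ws p q \<longrightarrow>
     (\<exists>us. walk_within \<alpha> I W us p q \<and> even (length us) = even (length ws) \<and>
        length us \<le> 2 * (2 * N * B + 1) ^ 3))"

text \<open>
  In a shortest word no point is passed twice with the same parity. In particular the neighbours of an inner
  vertex differ. A highest vertex above \<open>B\<close> would be an inner vertex with two
  non-increasing neighbours, hence a peak in the excluded sense. So the word stays in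
  a ball, and the number of points in the ball, counted with parity, bounds its length.
\<close>
lemma bounded_walk:
  assumes N: "N > 0" and real: "\<forall>i\<in>I. \<alpha> i \<in> \<real>"
    and W: "W \<subseteq> lattice N" "\<And>p. p \<in> W \<Longrightarrow> on_surface \<alpha> b p"
  shows "\<exists>K. short_walks \<alpha> I W N K"
proof -
  obtain K0 where nop: "no_peak_above \<alpha> b N I K0"
    using peak_points[OF N real] by blast
  have K0: "vieta \<alpha> i p = p \<and> vieta \<alpha> j p = p" if "p \<in> lattice N" "on_surface \<alpha> b p" "i \<in> I" "j \<in> I" "i \<noteq> j"
     "height (vieta \<alpha> i p) \<le> height p" "height (vieta \<alpha> j p) \<le> height p" "height p > K0" for p i j
    using nop[unfolded no_peak_above_def, rule_format, OF that] .
  show ?thesis unfolding short_walks_def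
  proof (intro exI[of _ "nat \<lceil>K0\<rceil>"] allI impI)
    fix p q B ws
    assume B: "real B \<ge> height p" "real B \<ge> height q" "B \<ge> nat \<lceil>K0\<rceil>"
      and ws: "walk_within \<alpha> I W ws p q"
    define P where "P us \<longleftrightarrow> walk_within \<alpha> I W us p q \<and> even (length us) = even (length ws)" for us
    have "P ws" using ws by (simp add: P_def)
    then obtain us where us: "P us" and min: "\<And>vs. P vs \<Longrightarrow> length us \<le> length vs"
      using ex_has_least_nat[of P ws length] by metis
    define x where "x m = walk \<alpha> (take m us) p" for m
    have within: "x m \<in> W" if "m \<le> length us" for m
      using us that unfolding P_def walk_within_def x_def by blast
    \<comment> \<open>a repetition with the same parity could be cut out\<close>
    have noshort: False if m: "m < n" "n \<le> length us" "x m = x n" "even m = even n" for m n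
    proof -
      have len: "length (take m us @ drop n us) = m + (length us - n)" using m by simp
      have "walk_within \<alpha> I W us p q" using us unfolding P_def by (rule conjunct1)
      then have "walk_within \<alpha> I W (take m us @ drop n us) p q"
        by (rule walk_within_shortcut[OF _ m(1,2) m(3)[unfolded x_def]])
      moreover have "even (m + (length us - n)) = even (length us)" using m(2,4) by presburger
      then have "even (length (take m us @ drop n us)) = even (length ws)"
        using us unfolding P_def len by simp
      ultimately have "P (take m us @ drop n us)" unfolding P_def by (rule conjI)
      from min[OF this] show False using m len by simp
    qed
    have "walk \<alpha> us p = q" using us unfolding P_def walk_within_def by blast
    then have ends: "x 0 = p" "x (length us) = q" by (simp_all add: x_def)
    have step: "x (Suc m) = vieta \<alpha> (us ! m) (x m)" if "m < length us" for m
      using that by (simp add: x_def take_Suc_conv_app_nth)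
    have low: "height (x m) \<le> real B" if m: "m \<le> length us" for m
    proof -
      obtain n where n: "n \<le> length us" and max: "\<And>l. l \<le> length us \<Longrightarrow> height (x l) \<le> height (x n)"
        using ex_max_up_to[of "length us" "\<lambda>l. height (x l)"] by auto
      have "height (x n) \<le> real B"
      proof (rule ccontr)
        assume "\<not> height (x n) \<le> real B"
        then have high: "height (x n) > real B" by simp
        then have "x n \<noteq> p" "x n \<noteq> q" using B by auto
        then have n0: "0 < n" "n < length us" 
          using n ends by (cases "n = 0"; cases "n = length us"; simp)+
        define i where "i = us ! (n - 1)"
        define j where "j = us ! n"
        have I: "set us \<subseteq> I" using us unfolding P_def walk_within_def by blast
        have ij: "i \<in> I" "j \<in> I"
          unfolding i_def j_def using n0 by (auto intro!: subsetD[OF I])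
        have "x n = vieta \<alpha> i (x (n - 1))" using step[of "n - 1"] n0 by (simp add: i_def)
        then have xi: "x (n - 1) = vieta \<alpha> i (x n)" by simp
        have xj: "x (Suc n) = vieta \<alpha> j (x n)" using step[of n] n0 by (simp add: j_def)
        have "x (n - 1) = x (Suc n)"
        proof (cases "i = j")
          case True
          then show ?thesis using xi xj by simp
        next
          case False
          have "K0 \<le> real (nat \<lceil>K0\<rceil>)" by (rule real_nat_ceiling_ge)
          also have "\<dots> \<le> real B" using B(3) by simp
          finally have "height (x n) > K0" using high by simp
          moreover have "height (vieta \<alpha> i (x n)) \<le> height (x n)" "height (vieta \<alpha> j (x n)) \<le> height (x n)"
            unfolding xi[symmetric] xj[symmetric] using n0 by (auto intro!: max)
          moreover have "x n \<in> lattice N" "on_surface \<alpha> b (x n)"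
            using within[OF n] W by auto
          ultimately have "vieta \<alpha> i (x n) = x n \<and> vieta \<alpha> j (x n) = x n"
            using ij False by (intro K0)
          then show ?thesis using xi xj by simp
        qed
        moreover have "n - 1 < Suc n" "Suc n \<le> length us" "even (n - 1) = even (Suc n)"
          using n0 by auto
        ultimately show False using noshort by blast
      qed
      then show ?thesis using max[OF m] by linarith
    qed
    let ?F = "{p \<in> lattice N. \<forall>l. cmod (p l) \<le> real B}"
    have "x m \<in> ?F" if "m \<le> length us" for m
    proof -
      have "cmod (x m l) \<le> height (x m)" for l
        unfolding height_def by (rule member_le_sum) auto
      then have "cmod (x m l) \<le> real B" for l using low[OF that] order_trans by blast
      moreover have "x m \<in> lattice N" using within[OF that] W(1) by blast
      ultimately show ?thesis by blast
    qed
    then have "(\<lambda>m. (x m, even m)) ` {..length us} \<subseteq> ?F \<times> UNIV" by auto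
    moreover have "inj_on (\<lambda>m. (x m, even m)) {..length us}"
    proof (rule inj_onI)
      fix m n assume m: "m \<in> {..length us}" "n \<in> {..length us}" "(x m, even m) = (x n, even n)"
      then have "\<not> m < n" "\<not> n < m" using noshort[of m n] noshort[of n m] by auto
      then show "m = n" by simp
    qed
    ultimately have "card {..length us} \<le> card (?F \<times> (UNIV :: bool set))"
      using finite_lattice_ball(1)[OF N, of B] by (intro card_inj_on_le) auto
    then have "Suc (length us) \<le> card ?F * 2" by (simp add: card_cartesian_product)
    also have "\<dots> \<le> (2 * N * B + 1) ^ 3 * 2" using finite_lattice_ball(2)[OF N, of B] by simp
    finally show "\<exists>us. walk_within \<alpha> I W us p q \<and> even (length us) = even (length ws) \<and>
        length us \<le> 2 * (2 * N * B + 1) ^ 3"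
      using us unfolding P_def by (intro exI[of _ us]) simp
  qed
qed

section \<open>The mapping class group orbits in terms of words\<close>

definition alphas :: "complex ^ 4 \<Rightarrow> 3 \<Rightarrow> complex" where
  "alphas k i = (if i = 1 then alpha1 k else if i = 2 then alpha2 k else alpha3 k)"

definition coords :: "'a triple \<Rightarrow> 3 \<Rightarrow> 'a" where
  "coords = (\<lambda>(x1, x2, x3) i. if i = 1 then x1 else if i = 2 then x2 else x3)"

definition pt :: "int triple \<Rightarrow> 3 \<Rightarrow> complex" where
  "pt x = coords (of_int_triple x)"

lemma trio_123: "trio 1 2 3" by (simp add: trio_def)

lemma coords_inj: "coords s = coords t \<longleftrightarrow> s = t"
proof
  assume *: "coords s = coords t"
  show "s = t"
    using fun_cong[OF *, of 1] fun_cong[OF *, of 2] fun_cong[OF *, of 3]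
    by (cases s; cases t) (simp add: coords_def)
qed simp

lemma pt_inj: "pt x = pt y \<longleftrightarrow> x = y"
  by (cases x; cases y) (simp add: pt_def coords_inj of_int_triple_def)

lemma pt_nth: "pt x i = of_int (coords x i)"
  by (cases x) (simp add: pt_def of_int_triple_def coords_def)

lemma coords_vieta:
  "coords (vieta1 k t) = vieta (alphas k) 1 (coords t)"
  "coords (vieta2 k t) = vieta (alphas k) 2 (coords t)"
  "coords (vieta3 k t) = vieta (alphas k) 3 (coords t)"
proof -
  note t = trio_123
  obtain x y z where xyz: "t = (x, y, z)" by (cases t)
  show "coords (vieta1 k t) = vieta (alphas k) 1 (coords t)"
    by (rule ext_trio[OF t])
      (simp_all add: vieta_same[OF t] vieta_other xyz coords_def vieta1_def alphas_def)
  show "coords (vieta2 k t) = vieta (alphas k) 2 (coords t)"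
    by (rule ext_trio[OF t])
      (simp_all add: vieta_same[OF trio_perm(5)[OF trio_perm(5)[OF t]]] vieta_other xyz coords_def vieta2_def alphas_def)
  show "coords (vieta3 k t) = vieta (alphas k) 3 (coords t)"
    by (rule ext_trio[OF t])
      (simp_all add: vieta_same[OF trio_perm(5)[OF t]] vieta_other xyz coords_def vieta3_def alphas_def)
qed

lemma on_surface_pt: "x \<in> surface_int k \<longleftrightarrow> on_surface (alphas k) (beta k) (pt x)"
proof -
  obtain a b c where x: "x = (a, b, c)" by (cases x)
  show ?thesis
    by (simp add: x surface_int_def of_int_triple_def surface_def on_surface_trio[OF trio_123] pt_nth
        coords_def alphas_def power2_eq_square algebra_simps)
qed

lemma BijGroup_UNIV:
  "carrier (BijGroup UNIV) = {f. bij f}"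
  "bij f \<Longrightarrow> bij g \<Longrightarrow> f \<otimes>\<^bsub>BijGroup UNIV\<^esub> g = f \<circ> g"
  "\<one>\<^bsub>BijGroup UNIV\<^esub> = id"
  by (auto simp: BijGroup_def Bij_def extensional_def compose_def fun_eq_iff)

text \<open>
  The three generators and their inverses are the products of two different involutions.
\<close>
lemma mcg_vieta_pair:
  assumes f: "f \<in> {vieta1 k, vieta2 k, vieta3 k}" and g: "g \<in> {vieta1 k, vieta2 k, vieta3 k}"
  shows "g \<circ> f \<in> mcg_transformations k"
proof -
  let ?G = "BijGroup (UNIV :: complex triple set)"
  let ?S = "{vieta3 k \<circ> vieta2 k, vieta1 k \<circ> vieta3 k, vieta2 k \<circ> vieta1 k}"
  have inv: "inv\<^bsub>?G\<^esub> (u \<circ> v) = v \<circ> u"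
    if "u \<circ> u = id" "v \<circ> v = id" "bij u" "bij v" for u v
  proof (rule group.inv_equality[OF group_BijGroup])
    have "v \<circ> u \<circ> (u \<circ> v) = v \<circ> (u \<circ> u) \<circ> v" by (simp add: comp_assoc)
    then show "(v \<circ> u) \<otimes>\<^bsub>?G\<^esub> (u \<circ> v) = \<one>\<^bsub>?G\<^esub>" using that by (simp add: BijGroup_UNIV bij_comp)
  qed (use that in \<open>simp_all add: BijGroup_UNIV bij_comp\<close>)
  have invol: "vieta1 k \<circ> vieta1 k = id" "vieta2 k \<circ> vieta2 k = id" "vieta3 k \<circ> vieta3 k = id"
    by (simp_all add: fun_eq_iff vieta_involutive)
  have gen: "h \<in> mcg_transformations k" if "h \<in> ?S" for h
    unfolding mcg_transformations_def by (rule generate.incl[OF that])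
  have gen_inv: "inv\<^bsub>?G\<^esub> h \<in> mcg_transformations k" if "h \<in> ?S" for h
    unfolding mcg_transformations_def by (rule generate.inv[OF that])
  have one: "id \<in> mcg_transformations k"
    unfolding mcg_transformations_def using generate.one[of ?G ?S] by (simp add: BijGroup_UNIV)
  have "vieta2 k \<circ> vieta3 k \<in> mcg_transformations k"
    using gen_inv[of "vieta3 k \<circ> vieta2 k"] inv invol bij_vieta by simp
  moreover have "vieta3 k \<circ> vieta1 k \<in> mcg_transformations k"
    using gen_inv[of "vieta1 k \<circ> vieta3 k"] inv invol bij_vieta by simp
  moreover have "vieta1 k \<circ> vieta2 k \<in> mcg_transformations k"
    using gen_inv[of "vieta2 k \<circ> vieta1 k"] inv invol bij_vieta by simp
  moreover have "vieta3 k \<circ> vieta2 k \<in> mcg_transformations k" "vieta1 k \<circ> vieta3 k \<in> mcg_transformations k"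
    "vieta2 k \<circ> vieta1 k \<in> mcg_transformations k"
    by (rule gen; simp)+
  ultimately show ?thesis using f g one invol
    by (elim insertE emptyE) (simp_all only:)
qed

lemma bij_vieta_pairs:
  "bij (vieta3 k \<circ> vieta2 k)" "bij (vieta1 k \<circ> vieta3 k)" "bij (vieta2 k \<circ> vieta1 k)"
  by (intro bij_comp bij_vieta)+

lemma mcg_word:
  assumes "g \<in> mcg_transformations k"
  shows "bij g \<and> (\<exists>ws. even (length ws) \<and> (\<forall>t. coords (g t) = walk (alphas k) ws (coords t)))"
  using assms unfolding mcg_transformations_def
proof (induction rule: generate.induct)
  case one
  show ?case by (intro conjI exI[of _ "[]"]) (simp_all add: BijGroup_UNIV bij_id[unfolded id_def] id_def)
next
  case (incl h)
  then consider "h = vieta3 k \<circ> vieta2 k" | "h = vieta1 k \<circ> vieta3 k" | "h = vieta2 k \<circ> vieta1 k" by blast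
  then show ?case
  proof cases
    case 1
    show ?thesis unfolding 1
      by (intro conjI exI[of _ "[2, 3]"] bij_vieta_pairs) (simp_all add: coords_vieta)
  next
    case 2
    show ?thesis unfolding 2
      by (intro conjI exI[of _ "[3, 1]"] bij_vieta_pairs) (simp_all add: coords_vieta)
  next
    case 3
    show ?thesis unfolding 3
      by (intro conjI exI[of _ "[1, 2]"] bij_vieta_pairs) (simp_all add: coords_vieta)
  qed
next
  case (inv h)
  let ?G = "BijGroup (UNIV :: complex triple set)"
  obtain i j where ij: "\<And>t. coords (h t) = walk (alphas k) [i, j] (coords t)" and h: "bij h"
  proof -
    from inv consider "h = vieta3 k \<circ> vieta2 k" | "h = vieta1 k \<circ> vieta3 k" | "h = vieta2 k \<circ> vieta1 k" by blast
    then show thesis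
    proof cases
      case 1
      show ?thesis by (rule that[of 2 3]) (simp_all only: 1 bij_vieta_pairs comp_apply coords_vieta walk_simps)
    next
      case 2
      show ?thesis by (rule that[of 3 1]) (simp_all only: 2 bij_vieta_pairs comp_apply coords_vieta walk_simps)
    next
      case 3
      show ?thesis by (rule that[of 1 2]) (simp_all only: 3 bij_vieta_pairs comp_apply coords_vieta walk_simps)
    qed
  qed
  have hc: "h \<in> carrier ?G" using h by (simp add: BijGroup_UNIV)
  have ic: "inv\<^bsub>?G\<^esub> h \<in> carrier ?G" using group.inv_closed[OF group_BijGroup hc] .
  then have b: "bij (inv\<^bsub>?G\<^esub> h)" by (simp add: BijGroup_UNIV)
  have "h \<otimes>\<^bsub>?G\<^esub> (inv\<^bsub>?G\<^esub> h) = \<one>\<^bsub>?G\<^esub>" using group.r_inv[OF group_BijGroup hc] .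
  then have r: "h ((inv\<^bsub>?G\<^esub> h) t) = t" for t
    using h b by (simp add: BijGroup_UNIV) (metis comp_apply id_apply)
  have "coords ((inv\<^bsub>?G\<^esub> h) t) = walk (alphas k) [j, i] (coords t)" for t
  proof -
    have "coords t = walk (alphas k) [i, j] (coords ((inv\<^bsub>?G\<^esub> h) t))" using ij[of "(inv\<^bsub>?G\<^esub> h) t"] r by simp
    then show ?thesis by simp
  qed
  then show ?case using b by (intro conjI exI[of _ "[j, i]"]) simp_all
next
  case (eng g h)
  then obtain us ws where *: "even (length us)" "\<And>t. coords (g t) = walk (alphas k) us (coords t)"
     "even (length ws)" "\<And>t. coords (h t) = walk (alphas k) ws (coords t)" "bij g" "bij h" by blast
  have "bij (g \<circ> h)" using *(6,5) by (rule bij_comp)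
  moreover have "\<forall>t. coords ((g \<circ> h) t) = walk (alphas k) (ws @ us) (coords t)" using *(2,4) by simp
  moreover have "even (length (ws @ us))" using *(1,3) by simp
  ultimately show ?case unfolding BijGroup_UNIV(2)[OF *(5,6)] by blast
qed

lemma even_word_mcg:
  "even (length ws) \<Longrightarrow> \<exists>g\<in>mcg_transformations k. \<forall>t. coords (g t) = walk (alphas k) ws (coords t)"
proof (induction "length ws" arbitrary: ws rule: less_induct)
  case less
  let ?G = "BijGroup (UNIV :: complex triple set)"
  show ?case
  proof (cases "ws = []")
    case True
    have "id \<in> mcg_transformations k"
      unfolding mcg_transformations_def 
      using generate.one[of ?G] by (simp add: BijGroup_UNIV)
    then show ?thesis using True by (intro bexI[of _ id]) auto
  next
    case False
    then obtain i j us where ws: "ws = i # j # us"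
      using less.prems by (cases ws; cases "tl ws") auto
    have V: "\<exists>f\<in>{vieta1 k, vieta2 k, vieta3 k}. \<forall>t. coords (f t) = vieta (alphas k) l (coords t)" for l
      using trio_cases[OF trio_123, of l] coords_vieta by blast
    obtain f where f: "f \<in> {vieta1 k, vieta2 k, vieta3 k}" "\<And>t. coords (f t) = vieta (alphas k) i (coords t)"
      using V by blast
    obtain g where g: "g \<in> {vieta1 k, vieta2 k, vieta3 k}" "\<And>t. coords (g t) = vieta (alphas k) j (coords t)"
      using V by blast
    obtain h where h: "h \<in> mcg_transformations k" "\<And>t. coords (h t) = walk (alphas k) us (coords t)"
      using less.hyps[of us] less.prems ws by auto
    have gf: "g \<circ> f \<in> mcg_transformations k" using mcg_vieta_pair[OF f(1) g(1)] .
    have "h \<otimes>\<^bsub>?G\<^esub> (g \<circ> f) \<in> mcg_transformations k"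
      using h(1) gf unfolding mcg_transformations_def by (rule generate.eng)
    moreover have "h \<otimes>\<^bsub>?G\<^esub> (g \<circ> f) = h \<circ> (g \<circ> f)"
      using mcg_word[OF h(1)] mcg_word[OF gf] by (simp add: BijGroup_UNIV)
    ultimately show ?thesis
      using h(2) f(2) g(2) by (intro bexI[of _ "h \<circ> (g \<circ> f)"]) (simp_all add: ws)
  qed
qed

lemma same_orbit_iff_even_word:
  "same_mcg_orbit k x y \<longleftrightarrow> (\<exists>ws. even (length ws) \<and> walk (alphas k) ws (pt x) = pt y)"
proof
  assume "same_mcg_orbit k x y"
  then obtain g where g: "g \<in> mcg_transformations k" "g (of_int_triple x) = of_int_triple y"
    unfolding same_mcg_orbit_def by blast
  then show "\<exists>ws. even (length ws) \<and> walk (alphas k) ws (pt x) = pt y"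
    using mcg_word[OF g(1)] unfolding pt_def by metis
next
  assume "\<exists>ws. even (length ws) \<and> walk (alphas k) ws (pt x) = pt y"
  then obtain ws where ws: "even (length ws)" "walk (alphas k) ws (pt x) = pt y" by blast
  obtain g where g: "g \<in> mcg_transformations k" "\<And>t. coords (g t) = walk (alphas k) ws (coords t)"
    using even_word_mcg[OF ws(1)] by blast
  have "coords (g (of_int_triple x)) = coords (of_int_triple y)" using g(2) ws(2) by (simp add: pt_def)
  then show "same_mcg_orbit k x y" using g(1) unfolding same_mcg_orbit_def coords_inj by blast
qed

section \<open>Deciding orbits by a bounded search\<close>

definition qpt :: "qstate \<Rightarrow> 3 \<Rightarrow> complex" where
  "qpt = (\<lambda>(x, y, z, d) i. of_int (coords (x, y, z) i) / of_int d)"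

definition scaled_pt :: "int \<Rightarrow> int triple \<Rightarrow> 3 \<Rightarrow> complex" where
  "scaled_pt N z i = of_int (coords z i) / of_int N"

lemma qvieta_correct:
  assumes N: "N \<noteq> 0" and A: "of_int N * \<alpha> l = (of_int (A l) :: complex)"
    and d: "snd (snd (snd s)) \<noteq> 0"
  shows "qpt (qvieta N A l s) = vieta \<alpha> l (qpt s)" "snd (snd (snd (qvieta N A l s))) \<noteq> 0"
proof -
  obtain x y z d where s: "s = (x, y, z, d)" by (cases s)
  have d: "d \<noteq> 0" using d s by simp
  have \<alpha>: "\<alpha> l = of_int (A l) / of_int N" using A N by (simp add: field_simps)
  note t = trio_123
  show "snd (snd (snd (qvieta N A l s))) \<noteq> 0" using N d by (simp add: s)
  consider "l = 1" | "l = 2" | "l = 3" using trio_cases[OF t] by blast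
  then show "qpt (qvieta N A l s) = vieta \<alpha> l (qpt s)"
  proof cases
    case 1
    show ?thesis by (rule ext_trio[OF t])
      (use d N \<alpha> in \<open>simp_all add: 1 s vieta_same[OF t] vieta_other qpt_def coords_def field_simps\<close>)
  next
    case 2
    show ?thesis by (rule ext_trio[OF t])
      (use d N \<alpha> in \<open>simp_all add: 2 s vieta_same[OF trio_perm(5)[OF trio_perm(5)[OF t]]] vieta_other qpt_def coords_def field_simps\<close>)
  next
    case 3
    show ?thesis by (rule ext_trio[OF t])
      (use d N \<alpha> in \<open>simp_all add: 3 s vieta_same[OF trio_perm(5)[OF t]] vieta_other qpt_def coords_def field_simps\<close>)
  qed
qed

lemma qvieta_walk:
  assumes N: "N \<noteq> 0" and A: "\<forall>l\<in>I. of_int N * \<alpha> l = (of_int (A l) :: complex)"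
  shows "set ws \<subseteq> I \<Longrightarrow> snd (snd (snd s)) \<noteq> 0 \<Longrightarrow>
    qpt (fold (qvieta N A) ws s) = walk \<alpha> ws (qpt s) \<and> snd (snd (snd (fold (qvieta N A) ws s))) \<noteq> 0"
proof (induction ws arbitrary: s)
  case (Cons l ws)
  have "l \<in> I" using Cons.prems by simp
  then have l: "of_int N * \<alpha> l = of_int (A l)" using A by blast
  show ?case
    using Cons.IH[of "qvieta N A l s"] Cons.prems qvieta_correct[of N \<alpha> l A, OF N l Cons.prems(2)] by simp
qed simp

lemma word_search_iff:
  assumes N: "N \<noteq> 0" and A: "\<forall>l\<in>I. of_int N * \<alpha> l = (of_int (A l) :: complex)"
  shows "word_search N A I t x z \<longleftrightarrow>
    (\<exists>ws. length ws = t \<and> set ws \<subseteq> I \<and> walk \<alpha> ws (pt x) = scaled_pt N z)"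
proof -
  obtain x1 x2 x3 where x: "x = (x1, x2, x3)" by (cases x)
  obtain z1 z2 z3 where z: "z = (z1, z2, z3)" by (cases z)
  have start: "qpt (x1, x2, x3, 1) = pt x" by (rule ext) (simp add: qpt_def pt_nth x)
  have target: "(N * u1 = z1 * d \<and> N * u2 = z2 * d \<and> N * u3 = z3 * d) \<longleftrightarrow> qpt (u1, u2, u3, d) = scaled_pt N z"
    if d: "d \<noteq> 0" for u1 u2 u3 d
  proof -
    have *: "of_int u / of_int d = (of_int v / of_int N :: complex) \<longleftrightarrow> N * u = v * d" for u v
    proof -
      have "of_int u / of_int d = (of_int v / of_int N :: complex) \<longleftrightarrow> (of_int (N * u) :: complex) = of_int (v * d)"
        using d N by (simp add: field_simps)
      then show ?thesis by (simp only: of_int_eq_iff)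
    qed
    have "qpt (u1, u2, u3, d) = scaled_pt N z \<longleftrightarrow> (\<forall>i. qpt (u1, u2, u3, d) i = scaled_pt N z i)"
      by (rule fun_eq_iff)
    also have "\<dots> \<longleftrightarrow> (qpt (u1, u2, u3, d) 1 = scaled_pt N z 1 \<and> qpt (u1, u2, u3, d) 2 = scaled_pt N z 2
        \<and> qpt (u1, u2, u3, d) 3 = scaled_pt N z 3)"
      by (rule forall_3)
    finally show ?thesis by (simp add: qpt_def scaled_pt_def z coords_def *)
  qed
  have key: "(case fold (qvieta N A) ws (x1, x2, x3, 1) of (u1, u2, u3, d) \<Rightarrow>
        N * u1 = z1 * d \<and> N * u2 = z2 * d \<and> N * u3 = z3 * d) \<longleftrightarrow> walk \<alpha> ws (pt x) = scaled_pt N z"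
    if ws: "set ws \<subseteq> I" for ws
  proof -
    obtain u1 u2 u3 d where u: "fold (qvieta N A) ws (x1, x2, x3, 1) = (u1, u2, u3, d)"
      by (metis prod.collapse)
    have "qpt (u1, u2, u3, d) = walk \<alpha> ws (pt x) \<and> d \<noteq> 0"
      using qvieta_walk[OF N A ws, of "(x1, x2, x3, 1)"] unfolding u start by simp
    then show ?thesis using target[of d u1 u2 u3] unfolding u prod.case by simp
  qed
  show ?thesis unfolding word_search_def x z fst_conv snd_conv
    unfolding z[symmetric] x[symmetric]
    by (intro iff_exI conj_cong refl) (rule key[unfolded z[symmetric] x[symmetric]])
qed

lemma abs_le_int_encode: "\<bar>z\<bar> \<le> int (int_encode z)"
  by (simp add: int_encode_def sum_encode_def)

lemma height_pt_le:
  "height (pt (x, y, z)) \<le> real (int_encode x + int_encode y + int_encode z)"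
proof -
  have "real_of_int \<bar>u\<bar> \<le> real (int_encode u)" for u
    using abs_le_int_encode[of u] by (metis of_int_le_iff of_int_of_nat_eq)
  from add_mono[OF add_mono[OF this[of x] this[of y]] this[of z]]
  show ?thesis by (simp add: height_trio[OF trio_123] pt_nth coords_def)
qed

lemma computable_pred_finite_bex:
  "finite S \<Longrightarrow> (\<And>s. s \<in> S \<Longrightarrow> computable_pred n (P s)) \<Longrightarrow> computable_pred n (\<lambda>xs. \<exists>s\<in>S. P s xs)"
proof (induction S rule: finite_induct)
  case empty
  show ?case by (simp add: computable_pred_const)
next
  case (insert s S)
  then have "computable_pred n (\<lambda>xs. P s xs \<or> (\<exists>s\<in>S. P s xs))" by (intro computable_pred_or) auto
  then show ?case by simp
qed

lemma decidable_on_pairs: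
  assumes "computable_pred 6 Q"
    and "\<And>x y. x \<in> D \<Longrightarrow> y \<in> D \<Longrightarrow> Q (encode_pair (x, y)) \<longleftrightarrow> R x y"
  shows "decidable_on encode_pair (D \<times> D) (\<lambda>(x, y). R x y)"
proof -
  obtain r where r: "\<And>xs. length xs = 6 \<Longrightarrow> rec_eval r xs = Some (if Q xs then 1 else 0)"
    using assms(1) unfolding computable_pred_def computable_def by blast
  have "length (encode_pair xy) = 6" for xy by (cases xy) (auto simp: encode_pair_def)
  then have "rec_eval r (encode_pair (x, y)) = Some (if R x y then 1 else 0)" if "x \<in> D" "y \<in> D" for x y
    using r assms(2)[OF that] by simp
  then show ?thesis unfolding decidable_on_def by (intro exI[of _ r]) auto
qed

text \<open>Outside \<open>E\<close> the program compares codes, and inside \<open>E\<close> it consults a finite table.\<close>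
lemma decidable_on_finite_exceptions:
  assumes E: "finite E" and refl: "\<And>x. x \<in> D \<Longrightarrow> R x x"
    and triv: "\<And>x y. x \<in> D \<Longrightarrow> y \<in> D \<Longrightarrow> R x y \<Longrightarrow> x = y \<or> (x \<in> E \<and> y \<in> E)"
  shows "decidable_on encode_pair (D \<times> D) (\<lambda>(x, y). R x y)"
proof -
  define enc_eq where "enc_eq p xs \<longleftrightarrow> xs ! 0 = encode_pair p ! 0 \<and> xs ! 1 = encode_pair p ! 1 \<and>
      xs ! 2 = encode_pair p ! 2 \<and> xs ! 3 = encode_pair p ! 3 \<and> xs ! 4 = encode_pair p ! 4 \<and> xs ! 5 = encode_pair p ! 5" for p and xs :: "nat list"
  define Q where "Q xs \<longleftrightarrow> (xs ! 0 = xs ! 3 \<and> xs ! 1 = xs ! 4 \<and> xs ! 2 = xs ! 5)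
      \<or> (\<exists>p\<in>{p \<in> E \<times> E. R (fst p) (snd p)}. enc_eq p xs)" for xs :: "nat list"
  have "computable_pred 6 (enc_eq p)" for p
    unfolding enc_eq_def
    by (intro computable_pred_and computable_pred_eq computable_nth computable_const) simp_all
  then have "computable_pred 6 Q" unfolding Q_def
    using E by (intro computable_pred_or computable_pred_and computable_pred_eq computable_nth
        computable_pred_finite_bex) simp_all
  moreover have "Q (encode_pair (x, y)) \<longleftrightarrow> R x y" if xy: "x \<in> D" "y \<in> D" for x y
  proof -
    obtain x1 x2 x3 where x: "x = (x1, x2, x3)" by (cases x)
    obtain y1 y2 y3 where y: "y = (y1, y2, y3)" by (cases y)
    have eq: "enc_eq p (encode_pair (x, y)) \<longleftrightarrow> p = (x, y)" for p
    proof -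
      obtain u1 u2 u3 v1 v2 v3 where "p = ((u1, u2, u3), (v1, v2, v3))" by (metis prod.collapse)
      then show ?thesis unfolding enc_eq_def x y
        by (simp add: encode_pair_def int_encode_eq) metis
    qed
    have eq2: "(encode_pair (x, y) ! 0 = encode_pair (x, y) ! 3 \<and> encode_pair (x, y) ! 1 = encode_pair (x, y) ! 4
       \<and> encode_pair (x, y) ! 2 = encode_pair (x, y) ! 5) \<longleftrightarrow> x = y"
      unfolding x y by (simp add: encode_pair_def int_encode_eq)
    show ?thesis unfolding Q_def eq eq2 using triv[OF xy] refl[OF xy(1)] by auto
  qed
  ultimately show ?thesis by (rule decidable_on_pairs)
qed

lemma pad_word:
  assumes "length us \<le> L" "even (length us) = even L" "i \<in> I" "set us \<subseteq> I"
  shows "\<exists>ws. length ws = L \<and> set ws \<subseteq> I \<and> walk \<alpha> ws p = walk \<alpha> us p"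
proof -
  have rep: "walk \<alpha> (replicate (2 * m) i) q = q" for m q by (induction m) simp_all
  define m where "m = (L - length us) div 2"
  have m: "L - length us = 2 * m" using assms(1,2) unfolding m_def by presburger
  have "walk \<alpha> (us @ replicate (L - length us) i) p = walk \<alpha> us p"
    unfolding m by (simp only: walk_simps rep)
  moreover have "set (us @ replicate (L - length us) i) \<subseteq> I"
    using assms(3,4) by (simp add: subset_iff)
  moreover have "length (us @ replicate (L - length us) i) = L" using assms(1) by simp
  ultimately show ?thesis by blast
qed

text \<open>
  A word between two integral points is found by the search over \<open>I\<close>, or it runs through two points of the
  finite set \<open>E\<close>. In the second case the first and the last part of the word are found by the search, and what happens
  between points of \<open>E\<close> is looked up in a finite table of pairs of points with parities. The
  existence of the table is enough.
\<close>
lemma decidable_by_search: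
  fixes \<alpha> :: "3 \<Rightarrow> complex"
  assumes N: "N > 0" and I: "I \<noteq> {}"
    and A: "\<forall>l\<in>I. of_nat N * \<alpha> l \<in> \<int>"
    and W: "W \<subseteq> lattice N" "\<And>p. p \<in> W \<Longrightarrow> on_surface \<alpha> b p"
    and E: "finite E" "E \<subseteq> W"
    and complete: "\<And>x y ws. x \<in> D \<Longrightarrow> y \<in> D \<Longrightarrow> even (length ws) \<Longrightarrow> walk \<alpha> ws (pt x) = pt y \<Longrightarrow>
      (\<exists>us. walk_within \<alpha> I W us (pt x) (pt y) \<and> even (length us)) \<or>
      (\<exists>e\<in>E. \<exists>e'\<in>E. \<exists>us us'. walk_within \<alpha> I W us (pt x) e \<and> walk_within \<alpha> I W us' (pt y) e')"
  shows "decidable_on encode_pair (D \<times> D) (\<lambda>(x, y). \<exists>ws. even (length ws) \<and> walk \<alpha> ws (pt x) = pt y)"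
proof -
  define M where "M = int N"
  have M: "M \<noteq> 0" using N by (simp add: M_def)
  obtain i where i: "i \<in> I" using I by blast
  have "\<exists>m. of_int M * \<alpha> l = of_int m" if "l \<in> I" for l
    using A that unfolding M_def by (auto elim!: Ints_cases)
  then obtain c where c: "of_int M * \<alpha> l = of_int (c l)" if "l \<in> I" for l by metis
  have A': "\<forall>l\<in>I. of_int M * \<alpha> l = of_int (c l)" using c by blast
  have "\<alpha> l \<in> \<real>" if "l \<in> I" for l
  proof -
    have "\<alpha> l = of_real (of_int (c l) / of_int M)" using c[OF that] M by (simp add: field_simps)
    then show ?thesis by simp
  qed
  then have real: "\<forall>l\<in>I. \<alpha> l \<in> \<real>" by blast
  obtain K where K: "short_walks \<alpha> I W N K"
    using bounded_walk[OF N real W] by blast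
  obtain KE :: nat where KE: "\<And>e. e \<in> E \<Longrightarrow> height e \<le> real KE"
  proof -
    have "height e \<le> real (nat \<lceil>\<Sum>e\<in>E. height e\<rceil>)" if "e \<in> E" for e
    proof -
      have "height e \<le> (\<Sum>e\<in>E. height e)"
        by (rule member_le_sum[OF that _ E(1)]) (auto simp: height_def sum_nonneg)
      then show ?thesis using real_nat_ceiling_ge order_trans by blast
    qed
    then show thesis by (rule that)
  qed
  define z where "z e = (SOME z. e = scaled_pt M z)" for e
  have z: "e = scaled_pt M (z e)" if "e \<in> E" for e
  proof -
    have "\<forall>l. \<exists>m. of_nat N * e l = of_int m"
      using subsetD[OF W(1) subsetD[OF E(2) that]] unfolding lattice_def by (auto elim!: Ints_cases)
    then obtain g where g: "\<And>l. of_nat N * e l = of_int (g l)" by metis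
    have "e = scaled_pt M (g 1, g 2, g 3)"
      by (rule ext_trio[OF trio_123]) (use g N in \<open>simp_all add: scaled_pt_def coords_def M_def field_simps\<close>)
    then show ?thesis unfolding z_def by (rule someI)
  qed
  \<comment> \<open>the code of an integer is at least its absolute value, so the codes bound the heights\<close>
  define B where "B xs = K + KE + (xs ! 0 + xs ! 1 + xs ! 2) + (xs ! 3 + xs ! 4 + xs ! 5)" for xs :: "nat list"
  define L where "L xs = 2 * (2 * N * B xs + 1) ^ 3" for xs
  have L: "L xs = 2 * ((2 * N * B xs + 1) * ((2 * N * B xs + 1) * (2 * N * B xs + 1)))" for xs
    unfolding L_def by (simp only: power3_eq_cube mult.assoc)
  define X where "X xs = (int_decode (xs ! 0), int_decode (xs ! 1), int_decode (xs ! 2))" for xs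
  define Y where "Y xs = (int_decode (xs ! 3), int_decode (xs ! 4), int_decode (xs ! 5))" for xs
  define S where "S t x v \<longleftrightarrow> word_search M c I t x v" for t x v
  \<comment> \<open>the table: the parities \<open>s\<close>, \<open>s'\<close> of the outer parts must add up with the inner part to an even length\<close>
  define Tb where "Tb = {(e, s, e', s'). e \<in> E \<and> s \<in> {0, 1} \<and> e' \<in> E \<and> s' \<in> {0, 1} \<and>
     (\<exists>ws. walk \<alpha> ws e = e' \<and> even (length ws + s + s'))}"
  have "Tb \<subseteq> E \<times> {0, 1::nat} \<times> E \<times> {0, 1::nat}" unfolding Tb_def by blast
  then have finTb: "finite Tb" by (rule finite_subset) (use E(1) in simp)
  define Q where "Q xs \<longleftrightarrow> S (L xs) (X xs) (M * int_decode (xs ! 3), M * int_decode (xs ! 4), M * int_decode (xs ! 5))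
     \<or> (\<exists>q\<in>Tb. (case q of (e, s, e', s') \<Rightarrow> S (L xs + s) (X xs) (z e) \<and> S (L xs + s') (Y xs) (z e')))" for xs
  have compL: "computable 6 L"
    unfolding L B_def by (intro computable_mult computable_add computable_const computable_nth) simp_all
  have dec: "computable_int 6 (\<lambda>xs. int_decode (xs ! j))" if "j < 6" for j
    using that by (intro computable_int_decode computable_nth)
  have comp1: "computable_pred 6 (\<lambda>xs. S (L xs) (X xs)
      (M * int_decode (xs ! 3), M * int_decode (xs ! 4), M * int_decode (xs ! 5)))"
    unfolding S_def X_def
    by (intro computable_word_search[OF I] compL dec computable_int_mult computable_int_const) simp_all
  have comp2: "computable_pred 6 (\<lambda>xs. S (L xs + s) (X xs) v)" "computable_pred 6 (\<lambda>xs. S (L xs + s) (Y xs) v)" for s v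
  proof -
    obtain v1 v2 v3 where v: "v = (v1, v2, v3)" by (cases v)
    show "computable_pred 6 (\<lambda>xs. S (L xs + s) (X xs) v)" unfolding S_def X_def v
      by (intro computable_word_search[OF I] computable_add compL computable_const dec computable_int_const) simp_all
    show "computable_pred 6 (\<lambda>xs. S (L xs + s) (Y xs) v)" unfolding S_def Y_def v
      by (intro computable_word_search[OF I] computable_add compL computable_const dec computable_int_const) simp_all
  qed
  have "computable_pred 6 (\<lambda>xs. case q of (e, s, e', s') \<Rightarrow> S (L xs + s) (X xs) (z e) \<and> S (L xs + s') (Y xs) (z e'))" for q
    by (cases q) (simp only: prod.case, intro computable_pred_and comp2)
  then have "computable_pred 6 Q" unfolding Q_def
    by (intro computable_pred_or comp1 computable_pred_finite_bex finTb)
  moreover have "Q (encode_pair (x, y)) \<longleftrightarrow> (\<exists>ws. even (length ws) \<and> walk \<alpha> ws (pt x) = pt y)"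
    if xy: "x \<in> D" "y \<in> D" for x y
  proof -
    define xs where "xs = encode_pair (x, y)"
    obtain x1 x2 x3 where x: "x = (x1, x2, x3)" by (cases x)
    obtain y1 y2 y3 where y: "y = (y1, y2, y3)" by (cases y)
    have xsn: "xs ! 0 = int_encode x1" "xs ! 1 = int_encode x2" "xs ! 2 = int_encode x3"
       "xs ! 3 = int_encode y1" "xs ! 4 = int_encode y2" "xs ! 5 = int_encode y3"
      by (simp_all add: xs_def encode_pair_def x y)
    have XY: "X xs = x" "Y xs = y" by (simp_all only: X_def Y_def xsn x y int_encode_inverse)
    have sp: "scaled_pt M (M * int_decode (xs ! 3), M * int_decode (xs ! 4), M * int_decode (xs ! 5)) = pt y"
      using M by (simp add: scaled_pt_def fun_eq_iff pt_nth coords_def xsn y)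
    have hx: "height (pt x) \<le> real (B xs)" and hy: "height (pt y) \<le> real (B xs)"
      using height_pt_le[of x1 x2 x3] height_pt_le[of y1 y2 y3] by (simp_all only: B_def xsn x y)
    have hE: "height e \<le> real (B xs)" if "e \<in> E" for e
      using KE[OF that] by (simp add: B_def)
    have BK: "B xs \<ge> K" by (simp add: B_def)
    have S: "S t u v \<longleftrightarrow> (\<exists>ws. length ws = t \<and> set ws \<subseteq> I \<and> walk \<alpha> ws (pt u) = scaled_pt M v)" for t u v
      unfolding S_def by (rule word_search_iff[OF M A'])
    have short: "\<exists>ws. length ws = L xs + s \<and> set ws \<subseteq> I \<and> walk \<alpha> ws p = q"
      if h: "height p \<le> real (B xs)" "height q \<le> real (B xs)" and w: "walk_within \<alpha> I W us p q"
        and s: "even (length us) = even s" for p q us s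
    proof -
      obtain vs where vs: "walk_within \<alpha> I W vs p q" "even (length vs) = even (length us)" "length vs \<le> L xs"
        using K[unfolded short_walks_def, rule_format, OF h BK w] unfolding L_def by blast
      have "even (length vs) = even (L xs + s)" using vs(2) s by (simp add: L_def)
      then obtain ws where "length ws = L xs + s" "set ws \<subseteq> I" "walk \<alpha> ws p = walk \<alpha> vs p"
        using pad_word[of vs "L xs + s" i I \<alpha> p] vs(1,3) i unfolding walk_within_def by auto
      then show ?thesis using vs(1) unfolding walk_within_def by auto
    qed
    have evenL: "even (L xs)" by (simp add: L_def)
    show ?thesis unfolding xs_def[symmetric]
    proof
      assume "Q xs"
      then consider "S (L xs) x (M * int_decode (xs ! 3), M * int_decode (xs ! 4), M * int_decode (xs ! 5))"
        | e s e' s' where "(e, s, e', s') \<in> Tb" "S (L xs + s) x (z e)" "S (L xs + s') y (z e')"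
        unfolding Q_def XY by auto
      then show "\<exists>ws. even (length ws) \<and> walk \<alpha> ws (pt x) = pt y"
      proof cases
        case 1
        then show ?thesis using evenL unfolding S sp by metis
      next
        case 2
        obtain ws where ws: "walk \<alpha> ws e = e'" "even (length ws + s + s')" and e: "e \<in> E" "e' \<in> E"
          using 2(1) unfolding Tb_def by blast
        obtain us where us: "length us = L xs + s" "walk \<alpha> us (pt x) = e" using 2(2) z[OF e(1)] unfolding S by metis
        obtain us' where us': "length us' = L xs + s'" "walk \<alpha> us' (pt y) = e'" using 2(3) z[OF e(2)] unfolding S by metis
        have "walk \<alpha> (us @ ws @ rev us') (pt x) = walk \<alpha> (rev us') e'" using us ws by simp
        also have "\<dots> = pt y" using us'(2) walk_rev by metis
        finally have "walk \<alpha> (us @ ws @ rev us') (pt x) = pt y" .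
        moreover have "even (length (us @ ws @ rev us'))" using us(1) us'(1) ws(2) evenL by simp blast
        ultimately show ?thesis by blast
      qed
    next
      assume "\<exists>ws. even (length ws) \<and> walk \<alpha> ws (pt x) = pt y"
      then obtain ws where ws: "even (length ws)" "walk \<alpha> ws (pt x) = pt y" by blast
      from complete[OF xy ws] show "Q xs"
      proof (elim disjE exE bexE conjE)
        fix us assume us: "walk_within \<alpha> I W us (pt x) (pt y)" "even (length us)"
        have "\<exists>vs. length vs = L xs + 0 \<and> set vs \<subseteq> I \<and> walk \<alpha> vs (pt x) = pt y"
          by (rule short[OF hx hy us(1)]) (use us(2) in simp)
        then show "Q xs" unfolding Q_def XY S sp by simp
      next
        fix e e' us us' assume e: "e \<in> E" "e' \<in> E" and us: "walk_within \<alpha> I W us (pt x) e"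
          and us': "walk_within \<alpha> I W us' (pt y) e'"
        define s where "s = length us mod 2"
        define s' where "s' = length us' mod 2"
        have "S (L xs + s) x (z e)" unfolding S z[OF e(1), symmetric]
          by (rule short[OF hx hE[OF e(1)] us]) (simp add: s_def)
        moreover have "S (L xs + s') y (z e')" unfolding S z[OF e(2), symmetric]
          by (rule short[OF hy hE[OF e(2)] us']) (simp add: s'_def)
        moreover have "(e, s, e', s') \<in> Tb"
        proof -
          have "walk \<alpha> us (pt x) = e" "walk \<alpha> us' (pt y) = e'"
            using us us' unfolding walk_within_def by blast+
          then have "walk \<alpha> (rev us @ ws @ us') e = e'" using ws(2) by auto
          moreover have "even (length (rev us @ ws @ us') + s + s')"
            using ws(1) unfolding s_def s'_def by simp presburger
          moreover have "s \<in> {0, 1}" "s' \<in> {0, 1}" by (auto simp: s_def s'_def)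
          ultimately show ?thesis unfolding Tb_def using e by blast
        qed
        ultimately show "Q xs" unfolding Q_def XY by blast
      qed
    qed
  qed
  ultimately show ?thesis by (rule decidable_on_pairs)
qed

section \<open>Traps\<close>

text \<open>
  A family of regions indexed by the letters is a trap if every letter other than the last one leads from
  its region to the region of the new letter. A reduced word never leaves a trap.
\<close>
lemma trap_walk:
  assumes step: "\<And>i j q. q \<in> D i \<Longrightarrow> j \<noteq> i \<Longrightarrow> vieta \<alpha> j q \<in> D j"
  shows "q \<in> D i \<Longrightarrow> distinct_adj (i # ws) \<Longrightarrow> walk \<alpha> ws q \<in> D (last (i # ws))"
proof (induction ws arbitrary: q i)
  case (Cons j ws)
  then have "vieta \<alpha> j q \<in> D j" by (intro step[of q i]) auto
  then show ?case using Cons.IH[of "vieta \<alpha> j q" j] Cons.prems by simp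
qed simp

text \<open>
  The coordinate changed last is the largest one and no coordinate is small. Changing another
  coordinate makes it larger still, because it is replaced by about the product of the other two.
\<close>
definition big :: "real \<Rightarrow> 3 \<Rightarrow> (3 \<Rightarrow> complex) set" where
  "big T i = {q. \<forall>j. j \<noteq> i \<longrightarrow> T \<le> cmod (q j) \<and> cmod (q j) < cmod (q i)}"

lemma big_trio: "trio i j k \<Longrightarrow> q \<in> big T i \<longleftrightarrow>
    T \<le> cmod (q j) \<and> T \<le> cmod (q k) \<and> cmod (q j) < cmod (q i) \<and> cmod (q k) < cmod (q i)"
  unfolding big_def mem_Collect_eq using trio_neq[of i j k] trio_cases[of i j k] by metis

lemma big_enter:
  assumes t: "trio i j k" and T: "T \<ge> 4" "cmod (\<alpha> i) \<le> T" "cmod (q i) \<le> T"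
    and q: "T \<le> cmod (q j)" "T \<le> cmod (q k)"
  shows "vieta \<alpha> i q \<in> big T i"
proof -
  have ge: "cmod (vieta \<alpha> i q i) \<ge> cmod (q j) * cmod (q k) - 2 * T"
  proof -
    have "cmod (q j * q k) = cmod ((\<alpha> i - q i) - vieta \<alpha> i q i)" by (simp add: vieta_same[OF t])
    also have "\<dots> \<le> cmod (\<alpha> i) + cmod (q i) + cmod (vieta \<alpha> i q i)"
      by (meson add_right_mono norm_triangle_ineq4 order_trans)
    finally show ?thesis using T by (simp add: norm_mult)
  qed
  have "4 * cmod (q j) \<le> cmod (q k) * cmod (q j)" "4 * cmod (q k) \<le> cmod (q j) * cmod (q k)"
    using T q by (auto intro!: mult_right_mono)
  then have "cmod (q j) < cmod (vieta \<alpha> i q i)" "cmod (q k) < cmod (vieta \<alpha> i q i)"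
    using ge q T by (simp_all add: mult.commute[of "cmod (q k)"])
  then show ?thesis using q trio_neq[OF t] by (simp add: big_trio[OF t] vieta_other)
qed

lemma big_step:
  assumes T: "T \<ge> 4" "\<forall>l. cmod (\<alpha> l) \<le> T" and q: "q \<in> big T i" and j: "j \<noteq> i"
  shows "vieta \<alpha> j q \<in> big T j"
proof -
  obtain k where t: "trio i j k" using trio_ex[of i j] j by blast
  have t': "trio j i k" using trio_perm(1)[OF t] .
  have q: "T \<le> cmod (q j)" "T \<le> cmod (q k)" "cmod (q j) < cmod (q i)" "cmod (q k) < cmod (q i)"
    using q by (simp_all add: big_trio[OF t])
  have "cmod (q i * q k) = cmod ((\<alpha> j - q j) - vieta \<alpha> j q j)" by (simp add: vieta_same[OF t'])
  also have "\<dots> \<le> cmod (\<alpha> j) + cmod (q j) + cmod (vieta \<alpha> j q j)"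
    by (meson add_right_mono norm_triangle_ineq4 order_trans)
  finally have ge: "cmod (q i) * cmod (q k) \<le> T + cmod (q j) + cmod (vieta \<alpha> j q j)"
    using T(2)[rule_format, of j] by (simp add: norm_mult)
  have "4 * cmod (q i) \<le> cmod (q k) * cmod (q i)" using T q by (intro mult_right_mono) auto
  then have "cmod (q i) < cmod (vieta \<alpha> j q j)" using ge q T(1) by (simp add: mult.commute[of "cmod (q k)"])
  then show ?thesis using q T trio_neq[OF t'] by (simp add: big_trio[OF t'] vieta_other)
qed

lemma big_walk:
  assumes T: "T \<ge> 4" "\<forall>l. cmod (\<alpha> l) \<le> T" and q: "q \<in> big T i" and ws: "distinct_adj (i # ws)"
  shows "walk \<alpha> ws q \<in> big T (last (i # ws))"
  using trap_walk[of "big T" \<alpha>, OF big_step[OF T] q ws] .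

lemma big_ge:
  assumes "q \<in> big T i" shows "T \<le> cmod (q l)"
proof (cases "l = i")
  case True
  obtain j k where t: "trio i j k" using trio_ex1 by blast
  show ?thesis using assms True unfolding big_trio[OF t] by simp
qed (use assms in \<open>simp add: big_def\<close>)

section \<open>Valuation rings of the complex numbers\<close>

definition subring :: "complex set \<Rightarrow> bool" where
  "subring A \<longleftrightarrow> 1 \<in> A \<and> (\<forall>x\<in>A. \<forall>y\<in>A. x - y \<in> A \<and> x * y \<in> A)"

lemma subringD:
  assumes "subring A"
  shows "1 \<in> A" "0 \<in> A" "x \<in> A \<Longrightarrow> y \<in> A \<Longrightarrow> x - y \<in> A" "x \<in> A \<Longrightarrow> y \<in> A \<Longrightarrow> x * y \<in> A"
    "x \<in> A \<Longrightarrow> - x \<in> A" "x \<in> A \<Longrightarrow> y \<in> A \<Longrightarrow> x + y \<in> A"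
proof -
  show 1: "1 \<in> A" and d: "\<And>x y. x \<in> A \<Longrightarrow> y \<in> A \<Longrightarrow> x - y \<in> A" and "x \<in> A \<Longrightarrow> y \<in> A \<Longrightarrow> x * y \<in> A"
    using assms by (auto simp: subring_def)
  show 0: "0 \<in> A" using d[OF 1 1] by simp
  show m: "- x \<in> A" if "x \<in> A" for x using d[OF 0 that] by simp
  show "x + y \<in> A" if "x \<in> A" "y \<in> A" using d[OF that(1) m[OF that(2)]] by simp
qed

lemma subring_power: "subring A \<Longrightarrow> x \<in> A \<Longrightarrow> x ^ n \<in> A"
  by (induction n) (auto intro: subringD)

lemma subring_sum: "subring A \<Longrightarrow> (\<And>i. i \<in> S \<Longrightarrow> f i \<in> A) \<Longrightarrow> sum f S \<in> A"
  by (induction S rule: infinite_finite_induct) (auto intro: subringD)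

lemma subring_of_nat: "subring A \<Longrightarrow> of_nat n \<in> A"
  by (induction n) (auto intro: subringD)

lemma subring_of_int: "subring A \<Longrightarrow> of_int n \<in> A"
  by (cases n rule: int_cases2) (auto intro: subringD(5) subring_of_nat)

definition adjoin :: "complex set \<Rightarrow> complex \<Rightarrow> complex set" where
  "adjoin A x = {poly f x | f. \<forall>i. coeff f i \<in> A}"

lemma adjoinI: "(\<And>i. coeff f i \<in> A) \<Longrightarrow> poly f x \<in> adjoin A x"
  unfolding adjoin_def by blast

lemma subring_adjoin:
  assumes A: "subring A" shows "subring (adjoin A x)" "A \<subseteq> adjoin A x" "x \<in> adjoin A x"
proof -
  show sub: "A \<subseteq> adjoin A x"
  proof
    fix a assume "a \<in> A"
    then have "poly [:a:] x \<in> adjoin A x"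
      using subringD[OF A] by (intro adjoinI) (auto simp: coeff_pCons split: nat.split)
    then show "a \<in> adjoin A x" by simp
  qed
  have "poly [:0, 1:] x \<in> adjoin A x"
    using subringD[OF A] by (intro adjoinI) (auto simp: coeff_pCons split: nat.split)
  then show "x \<in> adjoin A x" by simp
  show "subring (adjoin A x)" unfolding subring_def
  proof (intro conjI ballI)
    show "1 \<in> adjoin A x" using sub subringD(1)[OF A] by blast
    fix u v assume "u \<in> adjoin A x" "v \<in> adjoin A x"
    then obtain f g where f: "u = poly f x" "\<And>i. coeff f i \<in> A" and g: "v = poly g x" "\<And>i. coeff g i \<in> A"
      unfolding adjoin_def by blast
    have "poly (f - g) x \<in> adjoin A x" by (rule adjoinI) (use f g subringD(3)[OF A] in simp)
    then show "u - v \<in> adjoin A x" using f g by simp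
    have "poly (f * g) x \<in> adjoin A x"
      by (rule adjoinI) (use f g in \<open>auto simp: coeff_mult intro!: subring_sum[OF A] subringD(4)[OF A]\<close>)
    then show "u * v \<in> adjoin A x" using f g by simp
  qed
qed

text \<open>Reversing the coefficients turns an expression in \<open>1 / u\<close> into one in \<open>u\<close>.\<close>
lemma poly_inverse_clear:
  assumes A: "subring A" "u \<in> A" "u \<noteq> 0" and f: "\<And>i. coeff f i \<in> A"
  shows "u ^ degree f * poly f (inverse u) \<in> A"
proof -
  have "u ^ degree f * poly f (inverse u) = (\<Sum>i\<le>degree f. coeff f i * u ^ (degree f - i))"
  proof -
    have "u ^ degree f * (coeff f i * inverse u ^ i) = coeff f i * u ^ (degree f - i)"
      if "i \<le> degree f" for i
    proof -
      have "u ^ degree f = u ^ (degree f - i) * u ^ i" using that by (simp flip: power_add)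
      then show ?thesis using A(3) by (simp add: power_inverse)
    qed
    then show ?thesis unfolding poly_altdef sum_distrib_left by (intro sum.cong) auto
  qed
  also have "\<dots> \<in> A" using A f by (intro subring_sum subringD(4) subring_power) auto
  finally show ?thesis .
qed

definition proper_at :: "complex \<Rightarrow> complex set \<Rightarrow> bool" where
  "proper_at p A \<longleftrightarrow> subring A \<and> (\<forall>a\<in>A. p * a \<noteq> 1)"

lemma proper_at_Union:
  assumes C: "subset.chain {A. proper_at p A} C" "C \<noteq> {}"
  shows "proper_at p (\<Union>C)"
proof -
  have mem: "proper_at p A" if "A \<in> C" for A using C(1) that unfolding subset_chain_def by blast
  have two: "\<exists>A\<in>C. x \<in> A \<and> y \<in> A" if xy: "x \<in> \<Union>C" "y \<in> \<Union>C" for x y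
  proof -
    obtain A B where AB: "A \<in> C" "x \<in> A" "B \<in> C" "y \<in> B" using xy by blast
    then have "A \<subseteq> B \<or> B \<subseteq> A" using C(1) unfolding subset_chain_def by blast
    then show ?thesis using AB by blast
  qed
  have "x - y \<in> \<Union>C \<and> x * y \<in> \<Union>C" if xy: "x \<in> \<Union>C" "y \<in> \<Union>C" for x y
  proof -
    obtain A where A: "A \<in> C" "x \<in> A" "y \<in> A" using two[OF xy] by blast
    then have "subring A" using mem unfolding proper_at_def by blast
    then show ?thesis using A subringD(3,4)[of A x y] by blast
  qed
  moreover have "1 \<in> \<Union>C"
  proof -
    obtain A where "A \<in> C" using C(2) by blast
    then show ?thesis using mem subringD(1) unfolding proper_at_def by blast
  qed
  moreover have "\<forall>a\<in>\<Union>C. p * a \<noteq> 1" using mem unfolding proper_at_def by blast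
  ultimately show ?thesis unfolding proper_at_def subring_def by blast
qed

text \<open>
  Zorn's lemma, starting from the integers.
\<close>
lemma maximal_proper_exists:
  assumes p: "prime (p :: nat)"
  shows "\<exists>A. proper_at (of_nat p) A \<and> (\<forall>B. proper_at (of_nat p) B \<longrightarrow> A \<subseteq> B \<longrightarrow> B = A)"
proof -
  have base: "proper_at (of_nat p) \<int>"
  proof -
    have "(of_nat p :: complex) * of_int n \<noteq> 1" for n
    proof
      assume "(of_nat p :: complex) * of_int n = 1"
      then have "(of_int (int p * n) :: complex) = of_int 1" by simp
      then have "int p * n = 1" by (simp only: of_int_eq_iff)
      then have "int p dvd 1" by (metis dvd_triv_left)
      then show False using p by (simp add: prime_nat_iff)
    qed
    then show ?thesis unfolding proper_at_def subring_def by (auto elim!: Ints_cases)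
  qed
  have "\<exists>M\<in>{A. proper_at (of_nat p) A}. \<forall>X\<in>{A. proper_at (of_nat p) A}. M \<subseteq> X \<longrightarrow> X = M"
  proof (rule subset_Zorn_nonempty)
    show "{A. proper_at (of_nat p) A} \<noteq> {}" using base by blast
    show "\<Union>C \<in> {A. proper_at (of_nat p) A}" if "C \<noteq> {}" "subset.chain {A. proper_at (of_nat p) A} C" for C
      using proper_at_Union[OF that(2,1)] by simp
  qed
  then show ?thesis by blast
qed

text \<open>A relation for \<open>x\<close> and one for its inverse can be played off against each other to lower the degree.\<close>
lemma degree_lowering:
  assumes A: "subring A" and unit: "\<And>b. b \<in> A \<Longrightarrow> 1 - p * b \<noteq> 0 \<and> inverse (1 - p * b) \<in> A"
    and pA: "p \<in> A" and x: "x \<noteq> 0"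
    and f: "\<And>i. coeff f i \<in> A" "p * poly f x = 1"
    and g: "\<And>i. coeff g i \<in> A" "p * poly g (inverse x) = 1"
    and deg: "degree g \<le> degree f"
  shows "\<exists>h. (\<forall>i. coeff h i \<in> A) \<and> p * poly h x = 1 \<and> (degree f = 0 \<or> degree h < degree f)"
proof (cases "degree f = 0")
  case True
  then show ?thesis using f by blast
next
  case False
  define n where "n = degree f"
  define m where "m = degree g"
  define c where "c = inverse (1 - p * coeff g 0)"
  have c: "c \<in> A" "c * (1 - p * coeff g 0) = 1" using unit[OF g(1), of 0] by (simp_all add: c_def)
  have mn: "m \<le> n" using deg by (simp add: n_def m_def)
  have gx: "(\<Sum>i=1..m. coeff g i * inverse x ^ i) = poly g (inverse x) - coeff g 0"
  proof -
    have "poly g (inverse x) = (\<Sum>i=0..m. coeff g i * inverse x ^ i)"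
      unfolding poly_altdef m_def by (simp add: atMost_atLeast0)
    also have "\<dots> = coeff g 0 + (\<Sum>i=1..m. coeff g i * inverse x ^ i)"
      by (simp add: sum.atLeast_Suc_atMost)
    finally show ?thesis by simp
  qed
  have one: "1 = c * p * (\<Sum>i=1..m. coeff g i * inverse x ^ i)"
    unfolding gx using c(2) g(2) by (simp add: algebra_simps)
  define r where "r = (\<Sum>i=1..m. monom (coeff f n * c * p * coeff g i) (n - i))"
  have r: "poly r x = coeff f n * x ^ n"
  proof -
    have "coeff f n * x ^ n = (\<Sum>i=1..m. coeff f n * c * p * coeff g i * (x ^ n * inverse x ^ i))"
    proof -
      have "coeff f n * x ^ n = coeff f n * x ^ n * (c * p * (\<Sum>i=1..m. coeff g i * inverse x ^ i))"
        using one by simp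
      then show ?thesis by (simp add: sum_distrib_left mult_ac)
    qed
    also have "\<dots> = (\<Sum>i=1..m. coeff f n * c * p * coeff g i * x ^ (n - i))"
    proof (rule sum.cong)
      fix i assume "i \<in> {1..m}"
      then have "i \<le> n" using mn by simp
      then have "x ^ n = x ^ (n - i) * x ^ i" by (simp flip: power_add)
      then show "coeff f n * c * p * coeff g i * (x ^ n * inverse x ^ i) = coeff f n * c * p * coeff g i * x ^ (n - i)"
        using x by (simp add: power_inverse)
    qed simp
    also have "\<dots> = poly r x" unfolding r_def poly_sum poly_monom ..
    finally show ?thesis by simp
  qed
  define h where "h = f - monom (coeff f n) n + r"
  have "coeff h i \<in> A" for i
    unfolding h_def r_def coeff_add coeff_diff coeff_sum coeff_monom
    using A f g c pA by (intro subringD(6)[OF A] subringD(3)[OF A] subring_sum[OF A])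
      (auto intro!: subringD(2)[OF A] subringD(4)[OF A])
  moreover have "p * poly h x = 1" using f(2) by (simp add: h_def poly_monom r)
  moreover have "degree h < n"
  proof -
    have "coeff h i = 0" if "i \<ge> n" for i
    proof -
      have "coeff (f - monom (coeff f n) n) i = 0"
        using that by (cases "i = n") (simp_all add: coeff_eq_0 n_def)
      moreover have "coeff r i = 0" unfolding r_def coeff_sum coeff_monom
        using that False by (intro sum.neutral) (auto simp: n_def)
      ultimately show ?thesis by (simp add: h_def)
    qed
    then have "degree h \<le> n - 1" using False by (intro degree_le) (auto simp: n_def)
    then show ?thesis using False by (simp add: n_def)
  qed
  ultimately show ?thesis unfolding n_def by blast
qed

text \<open>
  The existence of \<open>p\<close>-adic valuations, in the form of a valuation ring: a subring that is maximal
  among those in which \<open>p\<close> is not invertible.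
\<close>
lemma p_adic_valuation_ring:
  assumes p: "prime (p :: nat)"
  shows "\<exists>A. subring A \<and> (\<forall>x. x \<in> A \<or> inverse x \<in> A) \<and> inverse (of_nat p) \<notin> A"
proof -
  obtain A where A: "proper_at (of_nat p) A" and max: "\<And>B. proper_at (of_nat p) B \<Longrightarrow> A \<subseteq> B \<Longrightarrow> B = A"
    using maximal_proper_exists[OF p] by blast
  have sub: "subring A" and noinv: "\<And>a. a \<in> A \<Longrightarrow> of_nat p * a \<noteq> 1" using A unfolding proper_at_def by blast+
  have p0: "(of_nat p :: complex) \<noteq> 0" using p by (simp add: prime_gt_0_nat)
  have pA: "of_nat p \<in> A" using subring_of_nat[OF sub] .
  have rel: "\<exists>f. (\<forall>i. coeff f i \<in> A) \<and> of_nat p * poly f x = 1" if "x \<notin> A" for x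
  proof (rule ccontr)
    assume "\<not> ?thesis"
    then have "proper_at (of_nat p) (adjoin A x)"
      using subring_adjoin(1)[OF sub] unfolding proper_at_def adjoin_def by blast
    then have "adjoin A x = A" using max subring_adjoin(2)[OF sub] by blast
    then show False using that subring_adjoin(3)[OF sub] by blast
  qed
  have unit: "1 - of_nat p * b \<noteq> 0 \<and> inverse (1 - of_nat p * b) \<in> A" if b: "b \<in> A" for b
  proof -
    let ?u = "1 - of_nat p * b"
    have u0: "?u \<noteq> 0" using noinv[OF b] by simp
    have uA: "?u \<in> A" using b pA sub by (intro subringD(3)[OF sub] subringD(1)[OF sub] subringD(4)[OF sub])
    have "inverse ?u \<in> A"
    proof (rule ccontr)
      assume "inverse ?u \<notin> A"
      then obtain f where f: "\<forall>i. coeff f i \<in> A" "of_nat p * poly f (inverse ?u) = 1" using rel by blast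
      define F where "F = ?u ^ degree f * poly f (inverse ?u)"
      have F: "F \<in> A" unfolding F_def by (rule poly_inverse_clear[OF sub uA u0]) (use f in blast)
      have "of_nat p * F = ?u ^ degree f * (of_nat p * poly f (inverse ?u))" by (simp add: F_def)
      then have pF: "of_nat p * F = ?u ^ degree f" using f(2) by simp
      have "\<exists>a\<in>A. ?u ^ n = 1 - of_nat p * a" for n
      proof (induction n)
        case 0
        show ?case using subringD(2)[OF sub] by (intro bexI[of _ 0]) simp_all
      next
        case (Suc n)
        then obtain a where a: "a \<in> A" "?u ^ n = 1 - of_nat p * a" by blast
        have "?u ^ Suc n = 1 - of_nat p * (a + b - of_nat p * a * b)"
          unfolding power_Suc a(2) by (simp add: algebra_simps)
        moreover have "a + b - of_nat p * a * b \<in> A" using a b pA by (intro subringD[OF sub])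
        ultimately show ?case by blast
      qed
      then obtain a where a: "a \<in> A" "?u ^ degree f = 1 - of_nat p * a" by blast
      have "of_nat p * (F + a) = 1" using pF a(2) by (simp add: algebra_simps)
      then show False using noinv[of "F + a"] subringD(6)[OF sub F a(1)] by blast
    qed
    then show ?thesis using u0 by blast
  qed
  have "x \<in> A \<or> inverse x \<in> A" for x
  proof (rule ccontr)
    assume "\<not> (x \<in> A \<or> inverse x \<in> A)"
    then have xA: "x \<notin> A" "inverse x \<notin> A" by auto
    have x0: "x \<noteq> 0" using xA subringD(2)[OF sub] by auto
    define P where "P y n \<longleftrightarrow> (\<exists>f. (\<forall>i. coeff f i \<in> A) \<and> of_nat p * poly f y = 1 \<and> degree f = n)" for y n
    have ex: "\<exists>n. P y n" if "y \<notin> A" for y using rel[OF that] unfolding P_def by blast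
    define N where "N y = (LEAST n. P y n)" for y
    have N: "P y (N y)" "\<And>n. P y n \<Longrightarrow> N y \<le> n" if "y \<notin> A" for y
      using LeastI_ex[OF ex[OF that]] Least_le[of "P y"] unfolding N_def by auto
    have no: "\<not> N (inverse y) \<le> N y" if y: "y \<notin> A" "inverse y \<notin> A" "y \<noteq> 0" for y
    proof
      assume le: "N (inverse y) \<le> N y"
      obtain f where f: "\<forall>i. coeff f i \<in> A" "of_nat p * poly f y = 1" "degree f = N y"
        using N(1)[OF y(1)] unfolding P_def by blast
      obtain g where g: "\<forall>i. coeff g i \<in> A" "of_nat p * poly g (inverse y) = 1" "degree g = N (inverse y)"
        using N(1)[OF y(2)] unfolding P_def by blast
      obtain h where h: "\<forall>i. coeff h i \<in> A" "of_nat p * poly h y = 1" "degree f = 0 \<or> degree h < degree f"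
        using degree_lowering[OF sub unit pA y(3), of f g] f g le by auto
      have "N y \<le> degree h" using N(2)[OF y(1)] h unfolding P_def by blast
      then have "degree f = 0" using h(3) f(3) by simp
      then obtain a where "f = [:a:]" by (rule degree_eq_zeroE)
      then have "a \<in> A" "of_nat p * a = 1" using f(1)[rule_format, of 0] f(2) by simp_all
      then show False using noinv by blast
    qed
    have "\<not> N (inverse x) \<le> N x" by (rule no[OF xA x0])
    moreover have "\<not> N (inverse (inverse x)) \<le> N (inverse x)"
      by (rule no) (use xA x0 in simp_all)
    ultimately show False by simp
  qed
  moreover have "inverse (of_nat p) \<notin> A" using noinv[of "inverse (of_nat p)"] p0 by auto
  ultimately show ?thesis using sub by blast
qed

section \<open>Valuations and integral walks\<close>

locale valuation =
  fixes A :: "complex set"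
  assumes subring: "subring A" and valuation: "x \<in> A \<or> inverse x \<in> A"
begin

text \<open>
  The order of absolute values \<open>\<bar>x\<bar> \<le> \<bar>y\<bar>\<close> without a value group. Strict inequality is the
  negation of the opposite relation.
\<close>
definition vle :: "complex \<Rightarrow> complex \<Rightarrow> bool" where
  "vle x y \<longleftrightarrow> (\<exists>a\<in>A. x = a * y)"

lemma vle_refl: "vle x x"
  unfolding vle_def using subringD(1)[OF subring] by (intro bexI[of _ 1]) auto

lemma vle_trans: "vle x y \<Longrightarrow> vle y z \<Longrightarrow> vle x z"
  unfolding vle_def using subringD(4)[OF subring] by (metis mult.assoc)

lemma vle_0: "vle 0 x"
  unfolding vle_def using subringD(2)[OF subring] by (intro bexI[of _ 0]) auto

lemma vle_total: "vle x y \<or> vle y x"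
proof (cases "x = 0 \<or> y = 0")
  case True
  then show ?thesis using vle_0 by auto
next
  case False
  have "x = (x * inverse y) * y" "y = inverse (x * inverse y) * x" using False by auto
  then show ?thesis unfolding vle_def using valuation[of "x * inverse y"] by metis
qed

lemma vle_1: "vle x 1 \<longleftrightarrow> x \<in> A"
  unfolding vle_def by auto

lemma vle_mult: "vle a b \<Longrightarrow> vle c d \<Longrightarrow> vle (a * c) (b * d)"
proof -
  assume "vle a b" "vle c d"
  then obtain s t where "s \<in> A" "a = s * b" "t \<in> A" "c = t * d" unfolding vle_def by blast
  then have "s * t \<in> A" "a * c = (s * t) * (b * d)" using subringD(4)[OF subring] by auto
  then show ?thesis unfolding vle_def by blast
qed

lemma vle_add: "vle x z \<Longrightarrow> vle y z \<Longrightarrow> vle (x + y) z"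
  unfolding vle_def using subringD(6)[OF subring] by (metis distrib_right)

lemma vle_minus: "vle x z \<Longrightarrow> vle (- x) z"
  unfolding vle_def using subringD(5)[OF subring] by (metis minus_mult_left)

lemma vle_diff: "vle x z \<Longrightarrow> vle y z \<Longrightarrow> vle (x - y) z"
  using vle_add[OF _ vle_minus] by (metis diff_conv_add_uminus)

lemma vless_add: "\<not> vle z x \<Longrightarrow> \<not> vle z y \<Longrightarrow> \<not> vle z (x + y)"
  by (metis vle_add vle_refl vle_total vle_trans)

lemma vless_minus: "\<not> vle z x \<Longrightarrow> \<not> vle z (- x)"
  by (metis vle_minus vle_refl vle_trans minus_minus)

lemma vless_mult: "y \<noteq> 0 \<Longrightarrow> \<not> vle z x \<Longrightarrow> \<not> vle (z * y) (x * y)"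
  unfolding vle_def by auto

lemma vle_cancel: "y \<noteq> 0 \<Longrightarrow> vle (x * y) (z * y) \<Longrightarrow> vle x z"
  unfolding vle_def by auto

lemma vle_dominant: "\<not> vle z x \<Longrightarrow> vle z (x - z)"
proof -
  assume z: "\<not> vle z x"
  have "z = x - (x - z)" by simp
  then show ?thesis using z vle_diff[of x _ "x - z"] vle_total[of x "x - z"] vle_refl vle_diff[of x x "x - z"]
    by metis
qed

lemma vle_of_int: "vle (of_int n) 1"
  unfolding vle_1 by (rule subring_of_int[OF subring])

text \<open>
  The counterpart of \<open>big\<close> for a valuation. Integers have absolute value at most 1, so a point in this trap
  is never integral. The coefficients have to be bounded explicitly, because there is no threshold that
  exceeds them all by choice.
\<close>
definition vbig :: "(3 \<Rightarrow> complex) \<Rightarrow> 3 \<Rightarrow> (3 \<Rightarrow> complex) set" where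
  "vbig \<alpha> i = {q. (\<forall>j. j \<noteq> i \<longrightarrow> \<not> vle (q j) 1 \<and> vle (q j) (q i)) \<and> (\<forall>l. vle (\<alpha> l) (q i))}"

lemma vbig_trio: "trio i j k \<Longrightarrow> q \<in> vbig \<alpha> i \<longleftrightarrow>
    \<not> vle (q j) 1 \<and> \<not> vle (q k) 1 \<and> vle (q j) (q i) \<and> vle (q k) (q i) \<and> (\<forall>l. vle (\<alpha> l) (q i))"
  unfolding vbig_def mem_Collect_eq using trio_neq[of i j k] trio_cases[of i j k] by metis

lemma vbig_enter:
  assumes t: "trio i j k"
    and q: "\<not> vle (q j) 1" "\<not> vle (q k) 1"
    and m: "\<not> vle (q j * q k) (\<alpha> i - q i)" "\<forall>l. vle (\<alpha> l) (q j * q k)"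
  shows "vieta \<alpha> i q \<in> vbig \<alpha> i"
proof -
  have new: "vle (q j * q k) (vieta \<alpha> i q i)"
    using vle_dominant[OF m(1)] by (simp add: vieta_same[OF t] algebra_simps)
  have "vle 1 (q j)" "vle 1 (q k)" using q vle_total by blast+
  then have "vle (q j) (q j * q k)" "vle (q k) (q j * q k)"
    using vle_mult[of "q j" "q j" 1 "q k"] vle_mult[of 1 "q j" "q k" "q k"] vle_refl by auto
  then have "vle (q j) (vieta \<alpha> i q i)" "vle (q k) (vieta \<alpha> i q i)" using new vle_trans by blast+
  moreover have "\<forall>l. vle (\<alpha> l) (vieta \<alpha> i q i)" using m(2) new vle_trans by blast
  ultimately show ?thesis using q trio_neq[OF t] unfolding vbig_trio[OF t] by (simp add: vieta_other)
qed

lemma vbig_step: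
  assumes q: "q \<in> vbig \<alpha> i" and j: "j \<noteq> i"
  shows "vieta \<alpha> j q \<in> vbig \<alpha> j"
proof -
  obtain k where t: "trio i j k" using trio_ex[of i j] j by blast
  have q: "\<not> vle (q j) 1" "\<not> vle (q k) 1" "vle (q j) (q i)" "vle (q k) (q i)" "\<forall>l. vle (\<alpha> l) (q i)"
    using q by (simp_all add: vbig_trio[OF t])
  have qi1: "\<not> vle (q i) 1" using q(1,3) vle_trans by blast
  have qi: "q i \<noteq> 0" using qi1 vle_0 by metis
  have "\<not> vle (q k * q i) (1 * q i)" by (rule vless_mult[OF qi q(2)])
  then have m1: "\<not> vle (q i * q k) (q i)" by (simp add: mult.commute)
  have m2: "vle (q i) (q i * q k)" using m1 vle_total by blast
  have "vle (\<alpha> j - q j) (q i)" using q vle_diff by blast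
  then have "\<not> vle (q i * q k) (\<alpha> j - q j)" using m1 vle_trans by blast
  moreover have "\<forall>l. vle (\<alpha> l) (q i * q k)" using q(5) m2 vle_trans by blast
  ultimately show ?thesis by (intro vbig_enter[OF trio_perm(1)[OF t]] qi1 q(2))
qed

lemma vbig_walk:
  assumes "q \<in> vbig \<alpha> i" "distinct_adj (i # ws)"
  shows "walk \<alpha> ws q \<in> vbig \<alpha> (last (i # ws))"
  using trap_walk[of "vbig \<alpha>" \<alpha>, OF vbig_step assms] .

lemma vbig_not_int: "q \<in> vbig \<alpha> i \<Longrightarrow> \<exists>l. q l \<notin> \<int>"
proof -
  assume q: "q \<in> vbig \<alpha> i"
  obtain j k where t: "trio i j k" using trio_ex1 by blast
  have "\<not> vle (q j) 1" using q by (simp add: vbig_trio[OF t])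
  then have "q j \<notin> \<int>" using vle_of_int by (auto elim!: Ints_cases)
  then show ?thesis by blast
qed

lemma ex_vmax:
  assumes "finite S" "S \<noteq> {}"
  shows "\<exists>m\<in>S. \<forall>n\<in>S. vle (f n) (f m)"
  using assms
proof (induction S rule: finite_ne_induct)
  case (singleton x)
  then show ?case by (simp add: vle_refl)
next
  case (insert x S)
  then obtain m where m: "m \<in> S" "\<forall>n\<in>S. vle (f n) (f m)" by blast
  show ?case
  proof (cases "vle (f x) (f m)")
    case True
    then show ?thesis using m by (intro bexI[of _ m]) auto
  next
    case False
    then have xm: "vle (f m) (f x)" using vle_total by blast
    have "\<forall>n\<in>insert x S. vle (f n) (f x)"
    proof
      fix n assume "n \<in> insert x S"
      then show "vle (f n) (f x)"
        using m(2) vle_refl vle_trans[OF _ xm] by (cases "n = x") auto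
    qed
    then show ?thesis by blast
  qed
qed

text \<open>
  The height of a reduced word that starts and ends at integral points never exceeds the level \<open>c\<close>
  of the coefficients. At the first vertex where the maximal height would be attained, the coordinate
  that has just been changed is strictly the largest one, and the next move changes another
  coordinate; the move does not lead higher, so the third coordinate is at most 1. But
  then the square of the largest coordinate dominates the equation of the surface.
\<close>
lemma walk_vle:
  assumes c: "vle 1 c" "\<forall>l. vle (\<alpha> l) c" "vle b c"
    and p: "on_surface \<alpha> b p" "\<forall>l. p l \<in> \<int>"
    and ws: "distinct_adj ws" "\<forall>l. walk \<alpha> ws p l \<in> \<int>" and m: "m \<le> length ws"
  shows "vle (walk \<alpha> (take m ws) p l) c"
proof (rule ccontr)
  assume neg: "\<not> vle (walk \<alpha> (take m ws) p l) c"
  define x where "x n = walk \<alpha> (take n ws) p" for n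
  define S where "S = {..length ws} \<times> (UNIV :: 3 set)"
  have S: "finite S" "S \<noteq> {}" by (auto simp: S_def)
  obtain n0 l0 where n0: "n0 \<le> length ws" and max0: "\<And>n l. n \<le> length ws \<Longrightarrow> vle (x n l) (x n0 l0)"
    using ex_vmax[OF S, of "\<lambda>(n, l). x n l"] by (auto simp: S_def)
  define h where "h = x n0 l0"
  have max: "vle (x n l) h" if "n \<le> length ws" for n l using max0[OF that] by (simp add: h_def)
  have hc: "\<not> vle h c" using neg max[OF m, of l] vle_trans unfolding x_def by blast
  have h1: "\<not> vle h 1" using hc c(1) vle_trans by blast
  have h0: "h \<noteq> 0" using h1 vle_0 by metis
  define P where "P n \<longleftrightarrow> n \<le> length ws \<and> (\<exists>l. vle h (x n l))" for n
  have "P n0" unfolding P_def h_def using n0 vle_refl by blast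
  then obtain n where Pn: "P n" and least: "\<And>n'. n' < n \<Longrightarrow> \<not> P n'" by (metis LeastI not_less_Least)
  have int: "\<not> vle h z" if "z \<in> \<int>" for z
    using that vle_of_int h1 vle_trans by (metis Ints_cases)
  have "x 0 l \<in> \<int>" "x (length ws) l \<in> \<int>" for l using p(2) ws(2) by (simp_all add: x_def)
  then have "\<not> P 0" "\<not> P (length ws)" unfolding P_def using int by blast+
  then have "n \<noteq> 0" "n \<noteq> length ws" using Pn by metis+
  then have n: "0 < n" "n < length ws" using Pn by (auto simp: P_def)
  define i where "i = ws ! (n - 1)"
  define j where "j = ws ! n"
  have ij: "i \<noteq> j" using ws(1) n unfolding distinct_adj_conv_nth i_def j_def
    by (metis One_nat_def Suc_pred)
  obtain k where t: "trio i j k" using trio_ex[OF ij] by blast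
  have step: "x (Suc m) = vieta \<alpha> (ws ! m) (x m)" if "m < length ws" for m
    using that by (simp add: x_def take_Suc_conv_app_nth)
  define q where "q = x n"
  have "q = vieta \<alpha> i (x (n - 1))" using step[of "n - 1"] n by (simp add: q_def i_def)
  then have prev: "x (n - 1) = vieta \<alpha> i q" by simp
  have "\<not> P (n - 1)" using least n by simp
  then have low: "\<not> vle h (x (n - 1) l)" for l using n unfolding P_def by auto
  have qj: "\<not> vle h (q j)" and qk: "\<not> vle h (q k)"
    using low[of j] low[of k] trio_neq[OF t] unfolding prev by (simp_all add: vieta_other)
  obtain l' where "vle h (q l')" using Pn unfolding P_def q_def by blast
  then have qi: "vle h (q i)" using trio_cases[OF t, of l'] qj qk by metis
  have qi': "vle (q i) h" using max[of n i] n by (simp add: q_def)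
  have "x (Suc n) j = \<alpha> j - q i * q k - q j"
    using step[OF n(2)] by (simp add: q_def j_def[symmetric] vieta_same[OF trio_perm(1)[OF t]])
  then have "vle (\<alpha> j - q i * q k - q j) h" using max[of "Suc n" j] n by simp
  moreover have ch: "vle c h" using hc vle_total by blast
  then have ah: "vle (\<alpha> l) h" for l using c(2) vle_trans by blast
  moreover have "vle (q j) h" using qj vle_total by blast
  ultimately have "vle (\<alpha> j - q j - (\<alpha> j - q i * q k - q j)) h" using vle_diff by blast
  then have "vle (q k * q i) (1 * h)" by (simp add: algebra_simps)
  moreover have "vle (1 * h) (1 * q i)" using qi by simp
  ultimately have "vle (q k * q i) (1 * q i)" using vle_trans by blast
  moreover have qi0: "q i \<noteq> 0"
  proof
    assume "q i = 0"
    then have "vle h 1" using qi vle_0 vle_trans by metis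
    then show False using h1 by simp
  qed
  ultimately have k1: "vle (q k) 1" using vle_cancel by blast
  have hh: "vle h (h * h)" using vle_mult[of 1 h h h] h1 vle_total vle_refl by auto
  have H: "\<not> vle (h * h) (y * z)" if "\<not> vle h y" "vle z h" for y z
  proof -
    have "\<not> vle (h * h) (y * h)" by (rule vless_mult[OF h0 that(1)])
    moreover have "vle (y * z) (y * h)" using vle_mult[OF vle_refl that(2)] .
    ultimately show ?thesis using vle_trans by blast
  qed
  have surf: "q i * q i = - (q j * q j) + (- (q k * q k) + (- (q k * (q j * q i)) + (\<alpha> i * q i + (\<alpha> j * q j + (\<alpha> k * q k + b)))))"
  proof -
    have "on_surface \<alpha> b q" unfolding q_def x_def by (rule on_surface_walk[OF p(1)])
    then have "q i * q i + q j * q j + q k * q k + q i * q j * q k = \<alpha> i * q i + \<alpha> j * q j + \<alpha> k * q k + b"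
      unfolding on_surface_trio[OF t] .
    then show ?thesis by (simp add: algebra_simps)
  qed
  have qjh: "vle (q j) h" "vle (q k) h" using qj qk vle_total by blast+
  have al: "\<not> vle h (\<alpha> l)" for l using hc c(2) vle_trans by blast
  have bb: "\<not> vle (h * h) b" using hh hc c(3) vle_trans by blast
  have kji: "\<not> vle (h * h) (q k * (q j * q i))"
  proof -
    have "vle (q k * (q j * q i)) (1 * (q j * q i))" using vle_mult[OF k1 vle_refl] .
    then show ?thesis using H[OF qj qi'] vle_trans by (metis mult_1)
  qed
  have "\<not> vle (h * h) (q i * q i)" unfolding surf
    by (intro vless_add vless_minus H qj qk qjh al qi' bb kji)
  then show False using vle_mult[OF qi qi] by blast
qed

end

lemma p_adic:
  assumes "prime (p :: nat)"
  shows "\<exists>A. valuation A \<and> inverse (of_nat p) \<notin> A"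
  using p_adic_valuation_ring[OF assms] unfolding valuation_def by blast

text \<open>
  A prime factor of the denominator would be invertible in the corresponding valuation ring.
\<close>
lemma Ints_from_valuations:
  assumes r: "r \<in> \<rat>" and loc: "\<And>p A. prime (p :: nat) \<Longrightarrow> valuation A \<Longrightarrow> inverse (of_nat p) \<notin> A \<Longrightarrow> r \<in> A"
  shows "(r :: complex) \<in> \<int>"
proof -
  obtain m d where d: "d > 0" "coprime m d" "r = of_int m / of_int d"
    using r by (cases rule: Rats_cases') auto
  have "d = 1"
  proof (rule ccontr)
    assume "d \<noteq> 1"
    then have "nat d \<noteq> 1" using d(1) by linarith
    then obtain p where p: "prime p" "p dvd nat d" using prime_factor_nat[of "nat d"] by blast
    then have pd: "int p dvd d" using d(1) by (metis int_dvd_int_iff int_nat_eq less_imp_le)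
    then obtain e where e: "d = int p * e" by (rule dvdE)
    have p0: "(of_nat p :: complex) \<noteq> 0" using p(1) by (simp add: prime_gt_0_nat)
    have e0: "e \<noteq> 0" using e d(1) by auto
    obtain A where A: "valuation A" "inverse (of_nat p) \<notin> A" using p_adic[OF p(1)] by blast
    have sub: "subring A" using A(1) unfolding valuation_def by blast
    have "coprime m (int p)" using d(2) pd coprime_divisors[OF dvd_refl] by blast
    then obtain u v where "u * m + v * int p = 1" using bezout_int[of m "int p"] by (auto simp: coprime_iff_gcd_eq_1)
    then have "of_int u * of_int m + of_int v * of_nat p = (1 :: complex)"
      by (metis of_int_1 of_int_add of_int_mult of_int_of_nat_eq)
    then have "inverse (of_nat p) = of_int u * (of_int m / of_nat p) + (of_int v :: complex)"
      using p0 by (simp add: field_simps)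
    moreover have "of_int m / of_nat p = r * of_int e" using e0 p0 by (simp add: d(3) e)
    moreover have "r \<in> A" using loc[OF p(1) A] .
    ultimately have "inverse (of_nat p) \<in> A"
      using subring_of_int[OF sub] subringD(4,6)[OF sub] by simp
    then show False using A(2) by simp
  qed
  then show ?thesis using d(3) by simp
qed

lemma Rats_common_denominator:
  "finite S \<Longrightarrow> S \<subseteq> \<rat> \<Longrightarrow> \<exists>N>0. \<forall>z\<in>S. of_nat N * z \<in> (\<int> :: complex set)"
proof (induction S rule: finite_induct)
  case empty
  show ?case by (intro exI[of _ 1]) simp
next
  case (insert z S)
  then obtain N where N: "N > 0" "\<forall>z\<in>S. of_nat N * z \<in> (\<int> :: complex set)" by auto
  have "z \<in> \<rat>" using insert.prems by simp
  then obtain m d where d: "d > 0" "z = of_int m / of_int d" by (cases rule: Rats_cases') auto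
  have "of_nat (nat d * N) * z = of_nat N * of_int m" using d by simp
  moreover have "of_nat (nat d * N) * y = of_nat (nat d) * (of_nat N * y)" for y :: complex by simp
  ultimately have "\<forall>y\<in>insert z S. of_nat (nat d * N) * y \<in> (\<int> :: complex set)"
    using N(2) by (metis Ints_mult Ints_of_int Ints_of_nat insertE)
  then show ?case using d(1) N(1) by (intro exI[of _ "nat d * N"]) simp
qed

section \<open>Rational coefficients\<close>

text \<open>
  If \<open>N\<close> clears the denominators of the coefficients and of \<open>b\<close>, every point on a reduced word between
  integral points has coordinates with denominator \<open>N\<close>: its absolute values are bounded by that of \<open>1 / N\<close>
  at all primes. So the descent applies to all three letters.
\<close>
lemma decidable_rational:
  assumes real: "\<forall>l. \<alpha> l \<in> \<rat>" and D: "\<And>x. x \<in> D \<Longrightarrow> on_surface \<alpha> b (pt x)"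
  shows "decidable_on encode_pair (D \<times> D) (\<lambda>(x, y). \<exists>ws. even (length ws) \<and> walk \<alpha> ws (pt x) = pt y)"
proof (cases "D = {}")
  case True
  then show ?thesis by (simp add: decidable_on_def)
next
  case False
  then obtain x0 where x0: "x0 \<in> D" by blast
  note t = trio_123
  have ptQ: "pt x l \<in> \<rat>" for x l by (simp add: pt_nth)
  have "b = pt x0 1 * pt x0 1 + pt x0 2 * pt x0 2 + pt x0 3 * pt x0 3 + pt x0 1 * pt x0 2 * pt x0 3
     - (\<alpha> 1 * pt x0 1 + \<alpha> 2 * pt x0 2 + \<alpha> 3 * pt x0 3)"
    using D[OF x0] unfolding on_surface_trio[OF t] by (simp add: algebra_simps)
  then have bQ: "b \<in> \<rat>" using real ptQ by (auto intro!: Rats_add Rats_mult Rats_diff)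
  have "finite (insert b (range \<alpha>))" "insert b (range \<alpha>) \<subseteq> \<rat>" using bQ real by auto
  from Rats_common_denominator[OF this]
  obtain N where N: "N > 0" and ints: "\<forall>z\<in>insert b (range \<alpha>). of_nat N * z \<in> \<int>" by blast
  have N\<alpha>: "of_nat N * \<alpha> l \<in> \<int>" for l using ints by blast
  have Nb: "of_nat N * b \<in> \<int>" using ints by blast
  define W where "W = {q \<in> lattice N. on_surface \<alpha> b q}"
  have inW: "walk \<alpha> (take m ws) (pt x) \<in> W"
    if x: "x \<in> D" and ws: "distinct_adj ws" "walk \<alpha> ws (pt x) = pt y" and m: "m \<le> length ws" for x y ws m
  proof -
    let ?q = "walk \<alpha> (take m ws) (pt x)"
    have rat: "\<forall>l. walk \<alpha> us q l \<in> \<rat>" if "\<forall>l. q l \<in> \<rat>" for us q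
      using that
    proof (induction us arbitrary: q)
      case (Cons i us)
      have "\<forall>l. vieta \<alpha> i q l \<in> \<rat>"
      proof
        fix l
        obtain j k where "trio i j k" using trio_ex1 by blast
        then show "vieta \<alpha> i q l \<in> \<rat>" using Cons.prems real
          by (cases "l = i") (auto simp: vieta_same vieta_other intro!: Rats_diff Rats_mult)
      qed
      then show ?case using Cons.IH by simp
    qed simp
    have "of_nat N * ?q l \<in> \<int>" for l
    proof (rule Ints_from_valuations)
      show "of_nat N * ?q l \<in> \<rat>" using rat[of "pt x"] ptQ by (intro Rats_mult) auto
      fix p A assume "prime (p :: nat)" and A: "valuation A"
      interpret valuation A by (rule A)
      have N0: "(of_nat N :: complex) \<noteq> 0" using N by simp
      let ?c = "inverse (of_nat N) :: complex"
      have c: "vle z ?c" if "of_nat N * z \<in> \<int>" for z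
      proof -
        have "vle (of_nat N * z * ?c) (1 * ?c)"
          by (rule vle_mult[OF _ vle_refl]) (use that vle_of_int in \<open>auto elim!: Ints_cases\<close>)
        moreover have "of_nat N * z * ?c = z" using N0 by (simp add: field_simps)
        ultimately show ?thesis by simp
      qed
      have "vle (?q l) ?c"
      proof (rule walk_vle[where b = b])
        show "vle 1 ?c" by (rule c) simp
        show "\<forall>l. vle (\<alpha> l) ?c" using c N\<alpha> by blast
        show "vle b ?c" by (rule c[OF Nb])
        show "on_surface \<alpha> b (pt x)" by (rule D[OF x])
      qed (use ws m in \<open>auto simp: pt_nth\<close>)
      then have "vle (of_nat N * ?q l) (of_nat N * ?c)" by (rule vle_mult[OF vle_refl])
      then show "of_nat N * ?q l \<in> A" using N0 by (simp add: vle_1)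
    qed
    then show ?thesis unfolding W_def lattice_def using on_surface_walk[OF D[OF x]] by blast
  qed
  show ?thesis
  proof (rule decidable_by_search[where I = UNIV and N = N and W = W and E = "{}" and b = b])
    show "N > 0" by (rule N)
    show "\<forall>l\<in>UNIV. of_nat N * \<alpha> l \<in> \<int>" using N\<alpha> by blast
    show "on_surface \<alpha> b q" if "q \<in> W" for q using that unfolding W_def by blast
    show "W \<subseteq> lattice N" unfolding W_def by auto
    fix x y ws assume x: "x \<in> D" and ws: "even (length ws)" "walk \<alpha> ws (pt x) = pt y"
    obtain us where us: "distinct_adj us" "even (length us) = even (length ws)"
       "\<forall>\<alpha> p :: 3 \<Rightarrow> complex. walk \<alpha> us p = walk \<alpha> ws p" using reduce_word[of ws] by blast
    have w: "walk \<alpha> us (pt x) = pt y" using us(3) ws(2) by simp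
    have "walk_within \<alpha> UNIV W us (pt x) (pt y)"
      unfolding walk_within_def using inW[OF x us(1) w] w by blast
    then show "(\<exists>us. walk_within \<alpha> UNIV W us (pt x) (pt y) \<and> even (length us)) \<or>
      (\<exists>e\<in>{}. \<exists>e'\<in>{}. \<exists>us us'. walk_within \<alpha> UNIV W us (pt x) e \<and> walk_within \<alpha> UNIV W us' (pt y) e')"
      using us(2) ws(1) by blast
  qed simp_all
qed

section \<open>One irrational coefficient\<close>

lemma quadratic_root_bound:
  fixes z u v :: complex
  assumes "z * z = u * z + v" "cmod u \<le> R" "cmod v \<le> S"
  shows "cmod z \<le> R + S + 1"
proof (rule ccontr)
  assume "\<not> cmod z \<le> R + S + 1"
  then have z: "cmod z > R + S + 1" by simp
  have RS: "R \<ge> 0" "S \<ge> 0" using assms norm_ge_zero order_trans by blast+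
  have "cmod z * cmod z = cmod (u * z + v)" using assms(1) by (simp flip: norm_mult)
  also have "\<dots> \<le> cmod u * cmod z + cmod v" using norm_triangle_ineq[of "u * z" v] by (simp add: norm_mult)
  also have "\<dots> \<le> R * cmod z + S * cmod z"
  proof -
    have "cmod u * cmod z \<le> R * cmod z" using assms(2) by (rule mult_right_mono) simp
    moreover have "S * 1 \<le> S * cmod z" using z RS by (intro mult_left_mono) auto
    ultimately show ?thesis using assms(3) by linarith
  qed
  also have "\<dots> = (R + S) * cmod z" by (simp add: distrib_right)
  also have "\<dots> < cmod z * cmod z" using z RS by (intro mult_strict_right_mono) linarith+
  finally show False by simp
qed

text \<open>
  In a plane where one coordinate is constant, a bound for a second coordinate bounds the
  third one, which satisfies a monic quadratic equation.
\<close>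
lemma finite_near_plane:
  assumes N: "N > 0"
  shows "finite {q \<in> lattice N. on_surface \<alpha> b q \<and> q i = c \<and> (\<exists>j. j \<noteq> i \<and> cmod (q j) < T)}" (is "finite ?E")
proof -
  define A where "A = (\<Sum>l\<in>UNIV. cmod (\<alpha> l))"
  have A: "cmod (\<alpha> l) \<le> A" for l unfolding A_def by (rule member_le_sum) auto
  define R where "R = A + cmod c * T"
  define S where "S = A * cmod c + A * T + cmod b + cmod c * cmod c + T * T"
  define B where "B = nat \<lceil>cmod c + \<bar>T\<bar> + \<bar>R + S + 1\<bar>\<rceil>"
  have B: "cmod c \<le> real B" "\<bar>T\<bar> \<le> real B" "R + S + 1 \<le> real B"
    unfolding B_def using real_nat_ceiling_ge[of "cmod c + \<bar>T\<bar> + \<bar>R + S + 1\<bar>"] norm_ge_zero[of c] by linarith+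
  have "?E \<subseteq> {q \<in> lattice N. \<forall>l. cmod (q l) \<le> real B}"
  proof
    fix q assume q: "q \<in> ?E"
    then obtain j where j: "j \<noteq> i" "cmod (q j) < T" by blast
    obtain k where t: "trio i j k" using trio_ex[of i j] j by blast
    have qi: "q i = c" and lat: "q \<in> lattice N" and s: "on_surface \<alpha> b q" using q by blast+
    have Tj: "cmod (q j) \<le> T" "T \<ge> 0" using j norm_ge_zero[of "q j"] by linarith+
    have "q k * q k = (\<alpha> k - c * q j) * q k + (\<alpha> i * c + \<alpha> j * q j + b - c * c - q j * q j)"
      using s unfolding on_surface_trio[OF t] qi by (simp add: algebra_simps)
    moreover have "cmod (\<alpha> k - c * q j) \<le> R"
    proof -
      have "cmod (c * q j) \<le> cmod c * T" using Tj by (simp add: norm_mult mult_left_mono)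
      then show ?thesis using norm_triangle_ineq4[of "\<alpha> k" "c * q j"] A[of k] unfolding R_def by linarith
    qed
    moreover have "cmod (\<alpha> i * c + \<alpha> j * q j + b - c * c - q j * q j) \<le> S"
    proof -
      have "cmod (\<alpha> i * c) \<le> A * cmod c" using A by (simp add: norm_mult mult_right_mono)
      moreover have "cmod (\<alpha> j * q j) \<le> A * T" unfolding norm_mult using A Tj
        by (intro mult_mono order_trans[OF norm_ge_zero A]) auto
      moreover have "cmod (q j * q j) \<le> T * T" unfolding norm_mult using Tj by (intro mult_mono) auto
      moreover have "cmod (c * c) = cmod c * cmod c" by (rule norm_mult)
      moreover have "cmod (\<alpha> i * c + \<alpha> j * q j + b - c * c - q j * q j)
         \<le> cmod (\<alpha> i * c) + cmod (\<alpha> j * q j) + cmod b + cmod (c * c) + cmod (q j * q j)"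
        by (intro order_trans[OF norm_triangle_ineq4] add_mono order_trans[OF norm_triangle_ineq] order_refl)
      ultimately show ?thesis unfolding S_def by linarith
    qed
    ultimately have "cmod (q k) \<le> R + S + 1" by (rule quadratic_root_bound)
    then have "cmod (q k) \<le> real B" using B by linarith
    moreover have "cmod (q j) \<le> real B" "cmod (q i) \<le> real B" using B Tj qi by auto
    ultimately have "cmod (q l) \<le> real B" for l using trio_cases[OF t, of l] by metis
    then show "q \<in> {q \<in> lattice N. \<forall>l. cmod (q l) \<le> real B}" using lat by blast
  qed
  then show ?thesis using finite_lattice_ball(1)[OF N] by (rule finite_subset)
qed

text \<open>
  Two integral points with different \<open>i\<close>-th coordinate would make the coefficient at \<open>i\<close> rational. In the plane
  that contains them all, the letters other than \<open>i\<close> act with bounded denominators. The letter \<open>i\<close> can be used without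
  falling into a trap only at one of finitely many points; reading the word backwards gives another one.
\<close>
lemma decidable_one_irrational:
  assumes irr: "\<alpha> i \<notin> \<rat>" and real: "\<forall>l. l \<noteq> i \<longrightarrow> \<alpha> l \<in> \<rat>" and D: "\<And>x. x \<in> D \<Longrightarrow> on_surface \<alpha> b (pt x)"
  shows "decidable_on encode_pair (D \<times> D) (\<lambda>(x, y). \<exists>ws. even (length ws) \<and> walk \<alpha> ws (pt x) = pt y)"
proof (cases "D = {}")
  case True
  then show ?thesis by (simp add: decidable_on_def)
next
  case False
  then obtain x0 where x0: "x0 \<in> D" by blast
  define c where "c = pt x0 i"
  obtain j0 k0 where t0: "trio i j0 k0" using trio_ex1 by blast
  have ptZ: "pt x l \<in> \<int>" and ptQ: "pt x l \<in> \<rat>" for x l by (simp_all add: pt_nth)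
  have plane: "pt x i = c" if x: "x \<in> D" for x
  proof (rule ccontr)
    assume ne: "pt x i \<noteq> c"
    define rest where "rest y = pt y i * pt y i + pt y j0 * pt y j0 + pt y k0 * pt y k0
       + pt y i * pt y j0 * pt y k0 - \<alpha> j0 * pt y j0 - \<alpha> k0 * pt y k0" for y
    have rest: "rest y = \<alpha> i * pt y i + b" if "y \<in> D" for y
      using D[OF that] unfolding on_surface_trio[OF t0] rest_def by (simp add: algebra_simps)
    have restQ: "rest y \<in> \<rat>" for y unfolding rest_def
      using ptQ real trio_neq[OF t0] by (intro Rats_diff Rats_add Rats_mult) auto
    have "rest x - rest x0 = \<alpha> i * (pt x i - c)"
      unfolding rest[OF x] rest[OF x0] by (simp add: c_def algebra_simps)
    then have "\<alpha> i = (rest x - rest x0) / (pt x i - c)" using ne by simp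
    also have "\<dots> \<in> \<rat>" using restQ ptQ by (auto simp: c_def intro!: Rats_divide Rats_diff)
    finally show False using irr by simp
  qed
  have "finite (\<alpha> ` (- {i}))" "\<alpha> ` (- {i}) \<subseteq> \<rat>" using real by auto
  from Rats_common_denominator[OF this]
  obtain N where N: "N > 0" and ints: "\<forall>z\<in>\<alpha> ` (- {i}). of_nat N * z \<in> \<int>" by blast
  have N\<alpha>: "of_nat N * \<alpha> l \<in> \<int>" if "l \<noteq> i" for l using ints that by blast
  define T where "T = 4 + (\<Sum>l\<in>UNIV. cmod (\<alpha> l)) + cmod c"
  have sumA: "cmod (\<alpha> l) \<le> (\<Sum>l\<in>UNIV. cmod (\<alpha> l))" for l by (rule member_le_sum) auto
  have sum0: "(\<Sum>l\<in>UNIV. cmod (\<alpha> l)) \<ge> 0" by (rule sum_nonneg) simp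
  have T: "T \<ge> 4" "\<forall>l. cmod (\<alpha> l) \<le> T" "cmod c < T"
    unfolding T_def using sum0 order_trans[OF sumA] norm_ge_zero[of c] by (auto simp: add_increasing2 intro: order_trans[OF sumA])
  define W where "W = {q \<in> lattice N. on_surface \<alpha> b q \<and> q i = c}"
  define E where "E = {q \<in> lattice N. on_surface \<alpha> b q \<and> q i = c \<and> (\<exists>j. j \<noteq> i \<and> cmod (q j) < T)}"
  have cZ: "c \<in> \<int>" unfolding c_def by (rule ptZ)
  have ptW: "pt x \<in> W" if "x \<in> D" for x
    using D[OF that] plane[OF that] ptZ unfolding W_def lattice_def by auto
  have Wstep: "vieta \<alpha> l q \<in> W" if q: "q \<in> W" and l: "l \<noteq> i" for q l
  proof -
    obtain m where t: "trio i l m" using trio_ex[of i l] l by blast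
    have q': "on_surface \<alpha> b q" "q i = c" "\<And>l. of_nat N * q l \<in> \<int>" using q unfolding W_def lattice_def by auto
    have "of_nat N * vieta \<alpha> l q l = of_nat N * \<alpha> l - c * (of_nat N * q m) - of_nat N * q l"
      by (simp add: vieta_same[OF trio_perm(1)[OF t]] q'(2) algebra_simps)
    also have "\<dots> \<in> \<int>" using N\<alpha>[OF l] cZ q'(3) by auto
    finally have "of_nat N * vieta \<alpha> l q l \<in> \<int>" .
    then have "of_nat N * vieta \<alpha> l q l' \<in> \<int>" for l' using q'(3) by (cases "l' = l") (auto simp: vieta_other)
    then show ?thesis using on_surface_vieta[OF q'(1)] q'(2) l unfolding W_def lattice_def
      by (auto simp: vieta_other)
  qed
  have inW: "walk \<alpha> us q \<in> W" if "q \<in> W" "set us \<subseteq> - {i}" for us q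
    using that
  proof (induction us arbitrary: q)
    case (Cons l us)
    then show ?case using Cons.IH[of "vieta \<alpha> l q"] Wstep[of q l] by auto
  qed simp
  have within: "walk_within \<alpha> (- {i}) W us q (walk \<alpha> us q)" if q: "q \<in> W" and us: "set us \<subseteq> - {i}" for us q
    unfolding walk_within_def using us order_trans[OF set_take_subset us] by (auto intro!: inW[OF q])
  \<comment> \<open>the first use of the letter \<open>i\<close> takes place at a point of \<open>E\<close>\<close>
  have exit: "\<exists>e\<in>E. \<exists>us. walk_within \<alpha> (- {i}) W us q e"
    if q: "q \<in> W" and ws: "distinct_adj ws" "i \<in> set ws" and fin: "walk \<alpha> ws q \<in> W" for q ws
  proof -
    obtain us vs where split: "ws = us @ i # vs" "i \<notin> set us" using split_list_first[OF ws(2)] by blast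
    have us: "set us \<subseteq> - {i}" using split(2) by auto
    define e where "e = walk \<alpha> us q"
    have eW: "e \<in> W" unfolding e_def by (rule inW[OF q us])
    have "e \<in> E"
    proof (rule ccontr)
      assume "e \<notin> E"
      then have large: "T \<le> cmod (e j)" if "j \<noteq> i" for j using eW that unfolding E_def W_def by auto
      have ei: "e i = c" using eW unfolding W_def by blast
      have "vieta \<alpha> i e \<in> big T i"
        using T ei large trio_neq[OF t0] by (intro big_enter[OF t0]) auto
      moreover have "distinct_adj (i # vs)" using ws(1) unfolding split(1) by (simp add: distinct_adj_append_iff)
      ultimately have "walk \<alpha> vs (vieta \<alpha> i e) \<in> big T (last (i # vs))" by (rule big_walk[OF T(1,2)])
      moreover have "walk \<alpha> vs (vieta \<alpha> i e) = walk \<alpha> ws q" by (simp add: split(1) e_def)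
      ultimately have "T \<le> cmod (walk \<alpha> ws q i)" by (metis big_ge)
      then show False using fin T(3) unfolding W_def by simp
    qed
    then show ?thesis using within[OF q us] unfolding e_def by blast
  qed
  show ?thesis
  proof (rule decidable_by_search[where I = "- {i}" and N = N and W = W and E = E and b = b])
    show "N > 0" by (rule N)
    show "- {i} \<noteq> {}" using trio_neq[OF t0] by blast
    show "\<forall>l\<in>- {i}. of_nat N * \<alpha> l \<in> \<int>" using N\<alpha> by blast
    show "W \<subseteq> lattice N" "E \<subseteq> W" unfolding W_def E_def by blast+
    show "on_surface \<alpha> b q" if "q \<in> W" for q using that unfolding W_def by blast
    show "finite E" unfolding E_def by (rule finite_near_plane[OF N])
    fix x y ws assume xy: "x \<in> D" "y \<in> D" and ws: "even (length ws)" "walk \<alpha> ws (pt x) = pt y"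
    obtain us where us: "distinct_adj us" "even (length us) = even (length ws)"
       "\<forall>\<alpha> p :: 3 \<Rightarrow> complex. walk \<alpha> us p = walk \<alpha> ws p" using reduce_word[of ws] by blast
    have w: "walk \<alpha> us (pt x) = pt y" using us(3) ws(2) by simp
    show "(\<exists>us. walk_within \<alpha> (- {i}) W us (pt x) (pt y) \<and> even (length us)) \<or>
      (\<exists>e\<in>E. \<exists>e'\<in>E. \<exists>us us'. walk_within \<alpha> (- {i}) W us (pt x) e \<and> walk_within \<alpha> (- {i}) W us' (pt y) e')"
    proof (cases "i \<in> set us")
      case False
      then have "walk_within \<alpha> (- {i}) W us (pt x) (pt y)"
        using within[OF ptW[OF xy(1)], of us] w by auto
      then show ?thesis using us(2) ws(1) by blast
    next
      case True
      have "walk \<alpha> (rev us) (pt y) = pt x" using walk_rev[of \<alpha> us "pt x"] w by simp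
      then have "\<exists>e\<in>E. \<exists>vs. walk_within \<alpha> (- {i}) W vs (pt y) e"
        using exit[OF ptW[OF xy(2)], of "rev us"] us(1) True ptW[OF xy(1)] by simp
      moreover have "\<exists>e\<in>E. \<exists>vs. walk_within \<alpha> (- {i}) W vs (pt x) e"
        using exit[OF ptW[OF xy(1)] us(1) True] w ptW[OF xy(2)] by simp
      ultimately show ?thesis by blast
    qed
  qed
qed

section \<open>Specialisation\<close>

text \<open>
  The coordinates along a word are polynomials over the rationals in two quantities \<open>a\<close> and \<open>c\<close>. Polynomials
  in \<open>c\<close> with coefficients that are polynomials in \<open>a\<close> allow one to specialise
  \<open>a\<close> first and then to follow with \<open>c\<close>.
\<close>
definition ev1 :: "complex \<Rightarrow> rat poly \<Rightarrow> complex" where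
  "ev1 a g = poly (map_poly of_rat g) a"

definition ev2 :: "complex \<Rightarrow> complex \<Rightarrow> rat poly poly \<Rightarrow> complex" where
  "ev2 a c f = poly (map_poly (ev1 a) f) c"

lemma map_poly_ring_hom:
  fixes h :: "'a::comm_ring_1 \<Rightarrow> 'b::comm_ring_1"
  assumes "\<And>x y. h (x + y) = h x + h y" "\<And>x y. h (x * y) = h x * h y" "h 0 = 0"
  shows "map_poly h (f + g) = map_poly h f + map_poly h g" "map_poly h (f * g) = map_poly h f * map_poly h g"
proof -
  have sum: "h (sum u S) = (\<Sum>i\<in>S. h (u i))" for u :: "nat \<Rightarrow> 'a" and S
    by (induction S rule: infinite_finite_induct) (auto simp: assms)
  show "map_poly h (f + g) = map_poly h f + map_poly h g"
    by (rule poly_eqI) (simp add: coeff_map_poly assms)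
  show "map_poly h (f * g) = map_poly h f * map_poly h g"
    by (rule poly_eqI) (simp add: coeff_map_poly coeff_mult sum assms)
qed

lemma ev1_hom:
  "ev1 a (f + g) = ev1 a f + ev1 a g" "ev1 a (f * g) = ev1 a f * ev1 a g" "ev1 a 0 = 0" "ev1 a 1 = 1"
  "ev1 a [:r:] = of_rat r" "ev1 a [:0, 1:] = a" "ev1 a (- f) = - ev1 a f"
proof -
  show add: "ev1 a (f + g) = ev1 a f + ev1 a g" for f g
    unfolding ev1_def by (subst map_poly_ring_hom(1)) (simp_all add: of_rat_add of_rat_mult)
  show "ev1 a (f * g) = ev1 a f * ev1 a g" 
    unfolding ev1_def by (subst map_poly_ring_hom(2)) (simp_all add: of_rat_add of_rat_mult)
  show z: "ev1 a 0 = 0" by (simp add: ev1_def)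
  show "ev1 a 1 = 1" by (simp add: ev1_def)
  show "ev1 a [:r:] = of_rat r" by (simp add: ev1_def map_poly_pCons)
  show "ev1 a [:0, 1:] = a" by (simp add: ev1_def map_poly_pCons)
  show "ev1 a (- f) = - ev1 a f" using add[of f "- f"] z by (simp add: add_eq_0_iff)
qed

lemma ev2_hom:
  "ev2 a c (f + g) = ev2 a c f + ev2 a c g" "ev2 a c (f * g) = ev2 a c f * ev2 a c g"
  "ev2 a c [:u:] = ev1 a u" "ev2 a c [:0, 1:] = c" "ev2 a c 0 = 0" "ev2 a c (- f) = - ev2 a c f"
proof -
  show add: "ev2 a c (f + g) = ev2 a c f + ev2 a c g" for f g
    unfolding ev2_def by (subst map_poly_ring_hom(1)) (simp_all add: ev1_hom)
  show "ev2 a c (f * g) = ev2 a c f * ev2 a c g" 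
    unfolding ev2_def by (subst map_poly_ring_hom(2)) (simp_all add: ev1_hom)
  show "ev2 a c [:u:] = ev1 a u" by (simp add: ev2_def map_poly_pCons ev1_hom)
  show "ev2 a c [:0, 1:] = c" by (simp add: ev2_def map_poly_pCons ev1_hom)
  show z: "ev2 a c 0 = 0" by (simp add: ev2_def)
  show "ev2 a c (- f) = - ev2 a c f" using add[of f "- f"] z by (simp add: add_eq_0_iff)
qed

lemma ev2_diff: "ev2 a c (f - g) = ev2 a c f - ev2 a c g"
  using ev2_hom(1)[of a c f "- g"] by (simp add: ev2_hom)

lemma ev2_coeff_0: "(\<And>i. ev1 a (coeff f i) = 0) \<Longrightarrow> ev2 a c f = 0"
proof -
  assume "\<And>i. ev1 a (coeff f i) = 0"
  then have "map_poly (ev1 a) f = 0" by (intro poly_eqI) (simp add: coeff_map_poly ev1_hom)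
  then show ?thesis by (simp add: ev2_def)
qed

text \<open>
  \<open>a \<mapsto> a'\<close> is a specialisation if all algebraic relations over the rationals are preserved.
\<close>
definition kernel_le1 :: "complex \<Rightarrow> complex \<Rightarrow> bool" where
  "kernel_le1 a a' \<longleftrightarrow> (\<forall>g. ev1 a g = 0 \<longrightarrow> ev1 a' g = 0)"

definition kernel_le2 :: "complex \<Rightarrow> complex \<Rightarrow> complex \<Rightarrow> complex \<Rightarrow> bool" where
  "kernel_le2 a c a' c' \<longleftrightarrow> (\<forall>f. ev2 a c f = 0 \<longrightarrow> ev2 a' c' f = 0)"

lemma ev2_truncate:
  assumes f: "ev2 a c f = 0" and i: "ev1 a (coeff f i) \<noteq> 0"
  shows "\<exists>g. ev2 a c g = 0 \<and> ev1 a (lead_coeff g) \<noteq> 0 \<and> degree g \<le> degree f"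
  using f i
proof (induction "degree f" arbitrary: f rule: less_induct)
  case less
  show ?case
  proof (cases "ev1 a (lead_coeff f) = 0")
    case False
    then show ?thesis using less.prems by blast
  next
    case True
    define g where "g = f - monom (lead_coeff f) (degree f)"
    have "ev2 a c (monom (lead_coeff f) (degree f)) = 0"
      by (rule ev2_coeff_0) (use True in \<open>auto simp: ev1_hom\<close>)
    then have g0: "ev2 a c g = 0" using less.prems by (simp add: g_def ev2_diff)
    have ne: "i \<noteq> degree f" using True less.prems by auto
    then have gi: "ev1 a (coeff g i) \<noteq> 0" using less.prems by (simp add: g_def)
    have "i \<le> degree f" using less.prems by (metis ev1_hom(3) le_degree)
    then have pos: "degree f > 0" using ne by simp
    have "coeff g j = 0" if "j \<ge> degree f" for j
      using that by (cases "j = degree f") (simp_all add: g_def coeff_eq_0)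
    then have "degree g \<le> degree f - 1" using pos by (intro degree_le) auto
    then have lt: "degree g < degree f" using pos by simp
    from less.hyps[OF lt g0 gi] show ?thesis using lt by auto
  qed
qed

text \<open>
  A specialisation of \<open>a\<close> extends to \<open>c\<close>: if \<open>c\<close> is algebraic over the field generated by \<open>a\<close>,
  send it to a root of the specialised minimal polynomial, which is possible as soon as the leading
  coefficient survives. Pseudo-division shows that this respects all relations.
\<close>
lemma extend_specialisation:
  "\<exists>L. ev1 a L \<noteq> 0 \<and> (\<forall>a'. kernel_le1 a a' \<longrightarrow> ev1 a' L \<noteq> 0 \<longrightarrow> (\<exists>c'. kernel_le2 a c a' c'))"
proof (cases "\<exists>f i. ev2 a c f = 0 \<and> ev1 a (coeff f i) \<noteq> 0")
  case False
  have "kernel_le2 a c a' 0" if "kernel_le1 a a'" for a'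
    unfolding kernel_le2_def
  proof (intro allI impI)
    fix f assume "ev2 a c f = 0"
    then have "ev1 a (coeff f i) = 0" for i using False by blast
    then show "ev2 a' 0 f = 0" using that by (intro ev2_coeff_0) (simp add: kernel_le1_def)
  qed
  then show ?thesis by (intro exI[of _ 1]) (auto simp: ev1_hom)
next
  case True
  define F where "F f \<longleftrightarrow> ev2 a c f = 0 \<and> ev1 a (lead_coeff f) \<noteq> 0" for f
  have "\<exists>f. F f" using True ev2_truncate unfolding F_def by metis
  then obtain g where g: "F g" and min: "\<And>f. F f \<Longrightarrow> degree g \<le> degree f"
    using ex_has_least_nat[of F _ degree] by metis
  define L where "L = lead_coeff g"
  have L: "ev1 a L \<noteq> 0" and g0: "ev2 a c g = 0" using g by (simp_all add: F_def L_def)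
  have gne: "g \<noteq> 0" using L by (auto simp: L_def ev1_hom)
  have dg: "degree g > 0"
  proof (rule ccontr)
    assume "\<not> degree g > 0"
    then obtain u where "g = [:u:]" using degree_eq_zeroE[of g] by auto
    then show False using L g0 by (simp add: L_def ev2_hom)
  qed
  have "\<exists>c'. kernel_le2 a c a' c'" if k: "kernel_le1 a a'" and L': "ev1 a' L \<noteq> 0" for a'
  proof -
    have "coeff (map_poly (ev1 a') g) (degree g) \<noteq> 0" using L' by (simp add: L_def coeff_map_poly ev1_hom)
    then have "degree (map_poly (ev1 a') g) \<ge> degree g" by (rule le_degree)
    then have "\<not> constant (poly (map_poly (ev1 a') g))" using dg by (simp add: constant_degree)
    then obtain c' where "poly (map_poly (ev1 a') g) c' = 0" using fundamental_theorem_of_algebra by blast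
    then have c': "ev2 a' c' g = 0" by (simp add: ev2_def)
    have "ev2 a' c' f = 0" if f: "ev2 a c f = 0" for f
    proof -
      obtain q r where qr: "pseudo_divmod f g = (q, r)" by (cases "pseudo_divmod f g")
      define e where "e = Suc (degree f) - degree g"
      have eq: "smult (L ^ e) f = g * q + r" and dr: "r = 0 \<or> degree r < degree g"
        using pseudo_divmod[OF gne qr] by (simp_all add: L_def e_def)
      have sm: "ev2 x y (smult u f) = ev1 x u * ev2 x y f" for x y u
        using ev2_hom(2)[of x y "[:u:]" f] by (simp add: ev2_hom(3))
      have pow: "ev1 a' (L ^ e) = ev1 a' L ^ e" by (induction e) (simp_all add: ev1_hom)
      have r0: "ev2 a c r = 0"
      proof -
        have "ev2 a c (smult (L ^ e) f) = ev2 a c (g * q + r)" by (simp only: eq)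
        then show ?thesis using f g0 by (simp add: sm ev2_hom)
      qed
      have "ev1 a (coeff r i) = 0" for i
      proof (rule ccontr)
        assume "ev1 a (coeff r i) \<noteq> 0"
        moreover from this have "degree r < degree g" using dr by (auto simp: ev1_hom)
        ultimately show False using ev2_truncate[OF r0] min unfolding F_def by fastforce
      qed
      then have "ev2 a' c' r = 0" using k by (intro ev2_coeff_0) (simp add: kernel_le1_def)
      moreover have "ev2 a' c' (smult (L ^ e) f) = ev2 a' c' (g * q + r)" by (simp only: eq)
      ultimately have "ev1 a' L ^ e * ev2 a' c' f = 0" using c' by (simp add: sm ev2_hom pow)
      then show ?thesis using L' by simp
    qed
    then show ?thesis unfolding kernel_le2_def by blast
  qed
  then show ?thesis using L by blast
qed

definition min_poly :: "complex \<Rightarrow> rat poly \<Rightarrow> bool" where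
  "min_poly a m \<longleftrightarrow> m \<noteq> 0 \<and> ev1 a m = 0 \<and> (\<forall>g. g \<noteq> 0 \<longrightarrow> ev1 a g = 0 \<longrightarrow> degree m \<le> degree g)"

lemma min_poly_exists: "g \<noteq> 0 \<Longrightarrow> ev1 a g = 0 \<Longrightarrow> \<exists>m. min_poly a m"
  unfolding min_poly_def using ex_has_least_nat[of "\<lambda>g. g \<noteq> 0 \<and> ev1 a g = 0" g degree] by blast

lemma min_poly_dvd: 
  assumes m: "min_poly a m" and g: "ev1 a g = 0" shows "m dvd g"
proof -
  have m0: "m \<noteq> 0" "ev1 a m = 0" using m unfolding min_poly_def by blast+
  have "g = m * (g div m) + g mod m" by simp
  then have "ev1 a g = ev1 a m * ev1 a (g div m) + ev1 a (g mod m)" by (metis ev1_hom(1,2))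
  then have "ev1 a (g mod m) = 0" using g m0 by simp
  moreover have "g mod m = 0 \<or> degree (g mod m) < degree m" using degree_mod_less[OF m0(1)] .
  ultimately have "g mod m = 0" using m unfolding min_poly_def by (meson not_le)
  then show ?thesis by (simp add: dvd_eq_mod_eq_0)
qed

text \<open>
  The minimal polynomial is separable: a multiple root would be a root of its derivative.
\<close>
lemma min_poly_other_root:
  assumes m: "min_poly a m" and a: "a \<notin> \<rat>"
  shows "\<exists>a'. a' \<noteq> a \<and> ev1 a' m = 0"
proof -
  define M :: "complex poly" where "M = map_poly of_rat m"
  have m0: "m \<noteq> 0" "ev1 a m = 0" using m unfolding min_poly_def by blast+
  have dM: "degree M = degree m" unfolding M_def using m0(1) by (intro degree_map_poly) auto
  have deg: "degree m \<ge> 2"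
  proof (rule ccontr)
    assume "\<not> degree m \<ge> 2"
    then have "degree m \<le> 1" by simp
    define u where "u = coeff m 0"
    define v where "v = coeff m 1"
    have uv: "m = [:u, v:]"
    proof (rule poly_eqI)
      fix n
      have "coeff m n = 0" if "n \<ge> 2" using that \<open>degree m \<le> 1\<close> by (intro coeff_eq_0) simp
      moreover have "n = 0 \<or> n = 1 \<or> n \<ge> 2" by linarith
      ultimately show "coeff m n = coeff [:u, v:] n"
        by (auto simp: u_def v_def coeff_pCons split: nat.split)
    qed
    have "of_rat u + a * of_rat v = 0" using m0(2) unfolding uv by (simp add: ev1_def map_poly_pCons)
    moreover from this have "v \<noteq> 0" using m0(1) uv by auto
    ultimately have "a = - (of_rat u / of_rat v)" by (simp add: eq_neg_iff_add_eq_0 field_simps)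
    then have "a \<in> \<rat>" by (simp only:) (intro Rats_minus_iff[THEN iffD2] Rats_divide Rats_of_rat)
    then show False using a by simp
  qed
  have "poly M a = 0" using m0(2) by (simp add: M_def ev1_def)
  then obtain Q where Q: "M = [:- a, 1:] * Q" using poly_eq_0_iff_dvd by blast
  have M0: "M \<noteq> 0" using dM deg by auto
  have Q0: "Q \<noteq> 0" using M0 Q by auto
  have "degree M = 1 + degree Q" unfolding Q using Q0 by (subst degree_mult_eq) auto
  then have "degree Q > 0" using dM deg by simp
  then obtain a' where a': "poly Q a' = 0"
    using fundamental_theorem_of_algebra[of Q] by (auto simp: constant_degree)
  have "a' \<noteq> a"
  proof
    assume "a' = a"
    then have "poly (pderiv M) a = 0" unfolding Q pderiv_mult using a' by (simp add: pderiv_pCons)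
    moreover have "pderiv M = map_poly of_rat (pderiv m)"
      by (rule poly_eqI) (simp add: M_def coeff_pderiv coeff_map_poly of_rat_mult of_rat_add)
    ultimately have "ev1 a (pderiv m) = 0" by (simp add: ev1_def)
    moreover have "pderiv m \<noteq> 0" using deg by (auto simp: pderiv_eq_0_iff)
    ultimately have "degree m \<le> degree (pderiv m)" using m unfolding min_poly_def by blast
    then show False using deg by (simp add: degree_pderiv)
  qed
  moreover have "ev1 a' m = 0" using a' by (simp add: ev1_def M_def[symmetric] Q)
  ultimately show ?thesis by blast
qed

lemma ev1_root_algebraic:
  assumes "g \<noteq> 0" "ev1 a g = 0" shows "algebraic a"
proof (rule algebraicI')
  show "coeff (map_poly of_rat g :: complex poly) i \<in> \<rat>" for i by (simp add: coeff_map_poly)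
  have "coeff (map_poly of_rat g :: complex poly) (degree g) \<noteq> 0" using assms(1) by (simp add: coeff_map_poly)
  then show "(map_poly of_rat g :: complex poly) \<noteq> 0" by auto
  show "poly (map_poly of_rat g) a = 0" using assms(2) by (simp add: ev1_def)
qed

lemma infinite_two: "infinite S \<Longrightarrow> \<exists>x y. x \<noteq> y \<and> x \<in> S \<and> y \<in> S"
proof -
  assume S: "infinite S"
  then obtain x where x: "x \<in> S" using infinite_imp_nonempty by blast
  have "infinite (S - {x})" using S by simp
  then obtain y where "y \<in> S - {x}" using infinite_imp_nonempty by blast
  then show ?thesis using x by blast
qed

text \<open>
  An algebraic number can be left alone or sent to a conjugate; a transcendental one can be sent to almost any
  natural number.
\<close>
lemma two_specialisations1:
  assumes a: "a \<notin> \<rat>" and L: "ev1 a L \<noteq> 0"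
  shows "\<exists>a1 a2. a1 \<noteq> a2 \<and> (\<forall>z\<in>{a1, a2}. kernel_le1 a z \<and> ev1 z L \<noteq> 0 \<and> algebraic z)"
proof (cases "\<exists>g. g \<noteq> 0 \<and> ev1 a g = 0")
  case True
  then obtain m where m: "min_poly a m" using min_poly_exists by blast
  have m0: "m \<noteq> 0" "ev1 a m = 0" using m unfolding min_poly_def by blast+
  obtain a' where a': "a' \<noteq> a" "ev1 a' m = 0" using min_poly_other_root[OF m a] by blast
  obtain m' where m': "min_poly a' m'" using min_poly_exists[OF m0(1) a'(2)] by blast
  have m'0: "m' \<noteq> 0" "ev1 a' m' = 0" using m' unfolding min_poly_def by blast+
  have k: "kernel_le1 a a'" unfolding kernel_le1_def
  proof (intro allI impI)
    fix g assume "ev1 a g = 0"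
    then obtain q where "g = m * q" using min_poly_dvd[OF m] by (auto elim: dvdE)
    then show "ev1 a' g = 0" using a'(2) by (simp add: ev1_hom)
  qed
  have am': "ev1 a m' = 0"
  proof (rule ccontr)
    assume ne: "ev1 a m' \<noteq> 0"
    obtain q where q: "m = m' * q" using min_poly_dvd[OF m' a'(2)] by (auto elim: dvdE)
    then have "ev1 a q = 0" using m0(2) ne by (simp add: ev1_hom)
    moreover have q0: "q \<noteq> 0" using q m0(1) by auto
    ultimately have "degree m \<le> degree q" using m unfolding min_poly_def by blast
    moreover have "degree m = degree m' + degree q" using q q0 m'0(1) by (simp add: degree_mult_eq)
    ultimately have "degree m' = 0" by simp
    then obtain u where "m' = [:u:]" by (rule degree_eq_zeroE)
    then show False using m'0 by (simp add: ev1_hom)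
  qed
  have "ev1 a' L \<noteq> 0"
  proof
    assume "ev1 a' L = 0"
    then obtain q where "L = m' * q" using min_poly_dvd[OF m'] by (auto elim: dvdE)
    then show False using am' L by (simp add: ev1_hom)
  qed
  moreover have "kernel_le1 a a" by (simp add: kernel_le1_def)
  moreover have "algebraic a" "algebraic a'"
    using ev1_root_algebraic[OF m0] ev1_root_algebraic[OF m'0] by blast+
  ultimately show ?thesis using a'(1) k L by (intro exI[of _ a] exI[of _ a']) auto
next
  case False
  have k: "kernel_le1 a z" for z unfolding kernel_le1_def
  proof (intro allI impI)
    fix g assume "ev1 a g = 0"
    then have "g = 0" using False by blast
    then show "ev1 z g = 0" by (simp add: ev1_hom)
  qed
  define M where "M = map_poly (of_rat :: rat \<Rightarrow> complex) L"
  have "M \<noteq> 0" using L by (auto simp: M_def ev1_def)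
  then have "finite {z. poly M z = 0}" by (rule poly_roots_finite)
  then have "infinite (range (of_nat :: nat \<Rightarrow> complex) - {z. poly M z = 0})"
    by (intro Diff_infinite_finite) (simp_all add: range_inj_infinite inj_of_nat)
  then have "\<exists>z1 z2. z1 \<noteq> z2 \<and> z1 \<in> range of_nat - {z. poly M z = 0} \<and> z2 \<in> range of_nat - {z. poly M z = 0}"
    by (rule infinite_two)
  then obtain z1 z2 where z: "z1 \<noteq> z2" "z1 \<in> range of_nat" "z2 \<in> range of_nat" "poly M z1 \<noteq> 0" "poly M z2 \<noteq> 0"
    by blast
  have "z1 \<in> \<rat>" "z2 \<in> \<rat>" using z by auto
  then have alg: "algebraic z1" "algebraic z2" by (auto intro: rat_imp_algebraic)
  show ?thesis using z alg k by (intro exI[of _ z1] exI[of _ z2]) (simp add: ev1_def M_def)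
qed

lemma Rats_ex: "z \<in> \<rat> \<Longrightarrow> \<exists>r. z = of_rat r"
  by (auto simp: Rats_def)

lemma walk_ev2:
  "(\<lambda>l. ev2 a c (walk F ws P l)) = walk (\<lambda>l. ev2 a c (F l)) ws (\<lambda>l. ev2 a c (P l))"
proof (induction ws arbitrary: P)
  case (Cons i ws)
  obtain j k where t: "trio i j k" using trio_ex1 by blast
  have "(\<lambda>l. ev2 a c (vieta F i P l)) = vieta (\<lambda>l. ev2 a c (F l)) i (\<lambda>l. ev2 a c (P l))"
    by (rule ext_trio[OF t])
      (use trio_neq[OF t] in \<open>simp_all add: vieta_same[OF t] vieta_other ev2_hom ev2_diff\<close>)
  then show ?case using Cons.IH[of "vieta F i P"] by simp
qed simp

definition specialises :: "(3 \<Rightarrow> complex) \<Rightarrow> (3 \<Rightarrow> complex) \<Rightarrow> bool" where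
  "specialises \<alpha> \<beta> \<longleftrightarrow> (\<forall>ws p q. (\<forall>l. p l \<in> \<rat>) \<longrightarrow> (\<forall>l. q l \<in> \<rat>) \<longrightarrow> walk \<alpha> ws p = q \<longrightarrow> walk \<beta> ws p = q)"

lemma specialisesI:
  assumes k: "kernel_le2 a c a' c'" and F: "\<And>l. \<alpha> l = ev2 a c (F l)" "\<And>l. \<beta> l = ev2 a' c' (F l)"
  shows "specialises \<alpha> \<beta>"
  unfolding specialises_def
proof (intro allI impI)
  fix ws p q assume p: "\<forall>l. p l \<in> \<rat>" and q: "\<forall>l. q l \<in> \<rat>" and w: "walk \<alpha> ws p = q"
  have "\<forall>l. \<exists>r. p l = of_rat r" "\<forall>l. \<exists>r. q l = of_rat r" using p q Rats_ex by blast+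
  then obtain r s where r: "\<And>l. p l = of_rat (r l)" and s: "\<And>l. q l = of_rat (s l)" by metis
  define P where "P l = [:[:r l:]:]" for l
  have P: "(\<lambda>l. ev2 x y (P l)) = p" for x y by (rule ext) (simp add: P_def ev2_hom ev1_hom r)
  have \<alpha>: "\<alpha> = (\<lambda>l. ev2 a c (F l))" and \<beta>: "\<beta> = (\<lambda>l. ev2 a' c' (F l))" using F by auto
  have wF: "(\<lambda>l. ev2 a c (walk F ws P l)) = q" using w unfolding walk_ev2 P \<alpha> .
  have "ev2 a' c' (walk F ws P l) = q l" for l
  proof -
    have "ev2 a c (walk F ws P l - [:[:s l:]:]) = 0"
      using fun_cong[OF wF, of l] by (simp add: ev2_diff ev2_hom ev1_hom s)
    then have "ev2 a' c' (walk F ws P l - [:[:s l:]:]) = 0" using k unfolding kernel_le2_def by blast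
    then show ?thesis by (simp add: ev2_diff ev2_hom ev1_hom s)
  qed
  then have "(\<lambda>l. ev2 a' c' (walk F ws P l)) = q" by blast
  then show "walk \<beta> ws p = q" unfolding walk_ev2 P \<beta> .
qed

text \<open>
  Rational coordinates are constants under specialisation, so a word that joins rational points for \<open>\<alpha>\<close> joins
  them for \<open>\<beta>\<close> too. The values at \<open>j\<close> are algebraic, which makes them comparable with the
  powers of a prime at every valuation above it.
\<close>
lemma two_specialisations:
  assumes t: "trio i j k" and irr: "\<alpha> j \<notin> \<rat>" and r: "r \<in> \<rat>" "s \<in> \<rat>" "\<alpha> i = r + s * \<alpha> j"
  shows "\<exists>\<beta>1 \<beta>2. \<beta>1 j \<noteq> \<beta>2 j \<and> (\<forall>\<beta>\<in>{\<beta>1, \<beta>2}. specialises \<alpha> \<beta> \<and> algebraic (\<beta> j) \<and>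
     \<beta> i = r + s * \<beta> j \<and> (\<alpha> k \<in> \<rat> \<longrightarrow> \<beta> k = \<alpha> k))"
proof -
  obtain r' where r': "r = of_rat r'" using Rats_ex[OF r(1)] by blast
  obtain s' where s': "s = of_rat s'" using Rats_ex[OF r(2)] by blast
  note ne = trio_neq[OF t]
  define F where "F l = (if l = j then [:[:0, 1:]:] else if l = i then [:[:r':] + [:s':] * [:0, 1:]:] else [:0, 1:])" for l
  define B where "B x y l = ev2 x y (F l)" for x y l
  have Bj: "B x y j = x" and Bi: "B x y i = r + s * x" and Bk: "B x y k = y" for x y
    using ne by (simp_all add: B_def F_def ev2_hom(3,4) ev1_hom(1,2,5,6) r' s' del: mult_pCons_left mult_pCons_right add_pCons)
  have \<alpha>: "\<alpha> = B (\<alpha> j) (\<alpha> k)" by (rule ext_trio[OF t]) (simp_all add: Bj Bi Bk r(3))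
  obtain L where L: "ev1 (\<alpha> j) L \<noteq> 0"
    "\<And>a'. kernel_le1 (\<alpha> j) a' \<Longrightarrow> ev1 a' L \<noteq> 0 \<Longrightarrow> \<exists>c'. kernel_le2 (\<alpha> j) (\<alpha> k) a' c'"
    using extend_specialisation[of "\<alpha> j" "\<alpha> k"] by blast
  obtain a1 a2 where a: "a1 \<noteq> a2" "\<forall>z\<in>{a1, a2}. kernel_le1 (\<alpha> j) z \<and> ev1 z L \<noteq> 0 \<and> algebraic z"
    using two_specialisations1[OF irr L(1)] by blast
  have "\<exists>\<beta>. \<beta> j = z \<and> specialises \<alpha> \<beta> \<and> algebraic (\<beta> j) \<and> \<beta> i = r + s * \<beta> j \<and> (\<alpha> k \<in> \<rat> \<longrightarrow> \<beta> k = \<alpha> k)"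
    if z: "z \<in> {a1, a2}" for z
  proof -
    obtain c' where c': "kernel_le2 (\<alpha> j) (\<alpha> k) z c'" using L(2) a(2) z by blast
    have "specialises \<alpha> (B z c')"
    proof (rule specialisesI[OF c'])
      show "\<alpha> l = ev2 (\<alpha> j) (\<alpha> k) (F l)" for l using fun_cong[OF \<alpha>, of l] by (simp only: B_def)
      show "B z c' l = ev2 z c' (F l)" for l by (simp only: B_def)
    qed
    moreover have "c' = \<alpha> k" if kQ: "\<alpha> k \<in> \<rat>"
    proof -
      obtain u where u: "\<alpha> k = of_rat u" using Rats_ex[OF kQ] by blast
      have "ev2 (\<alpha> j) (\<alpha> k) ([:0, 1:] - [:[:u:]:]) = 0" unfolding ev2_diff ev2_hom(3,4) ev1_hom(5) u by simp
      then have "ev2 z c' ([:0, 1:] - [:[:u:]:]) = 0" using c' unfolding kernel_le2_def by blast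
      then show ?thesis unfolding ev2_diff ev2_hom(3,4) ev1_hom(5) u by simp
    qed
    moreover have "algebraic z" using a(2) z by blast
    ultimately show ?thesis by (intro exI[of _ "B z c'"]) (simp add: Bi Bj Bk)
  qed
  from this[of a1] this[of a2] show ?thesis using a(1) by (metis insert_iff singletonD)
qed


section \<open>Differences of algebraic numbers\<close>

interpretation rat_space: vector_space "\<lambda>(r :: rat) (z :: complex). of_rat r * z"
  by unfold_locales (simp_all add: algebra_simps of_rat_add of_rat_mult)

lemma algebraic_power_relation:
  fixes x :: complex
  assumes "algebraic x"
  shows "\<exists>d r. x ^ d = (\<Sum>k<d. of_rat (r k) * x ^ k)"
proof -
  obtain p where p: "\<And>i. coeff p i \<in> \<rat>" "p \<noteq> 0" "poly p x = 0" using assms unfolding algebraic_altdef by blast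
  define d where "d = degree p"
  have lc: "coeff p d \<noteq> 0" using p(2) by (simp add: d_def)
  have "\<forall>k. \<exists>r. - (coeff p k / coeff p d) = of_rat r"
  proof
    fix k
    have "- (coeff p k / coeff p d) \<in> \<rat>" using p(1) by (intro Rats_minus_iff[THEN iffD2] Rats_divide)
    then show "\<exists>r. - (coeff p k / coeff p d) = of_rat r" by (rule Rats_ex)
  qed
  from choice[OF this] obtain r where r: "\<forall>k. - (coeff p k / coeff p d) = of_rat (r k)" by blast
  have "0 = (\<Sum>k\<le>d. coeff p k * x ^ k)" using p(3) by (simp add: poly_altdef d_def)
  also have "\<dots> = (\<Sum>k<d. coeff p k * x ^ k) + coeff p d * x ^ d"
    by (simp add: lessThan_Suc_atMost[symmetric])
  finally have "coeff p d * x ^ d = - (\<Sum>k<d. coeff p k * x ^ k)" by (simp add: eq_neg_iff_add_eq_0 add.commute)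
  then have "x ^ d = - (\<Sum>k<d. coeff p k * x ^ k) / coeff p d" using lc by (simp add: field_simps)
  also have "\<dots> = (\<Sum>k<d. - (coeff p k / coeff p d) * x ^ k)"
    by (simp add: sum_divide_distrib sum_negf)
  also have "\<dots> = (\<Sum>k<d. of_rat (r k) * x ^ k)" using r by simp
  finally show ?thesis by blast
qed

lemma span_closed_mult:
  assumes "\<And>t. t \<in> T \<Longrightarrow> x * t \<in> rat_space.span T" and "v \<in> rat_space.span T"
  shows "x * v \<in> rat_space.span T"
  using assms(2)
proof (induction rule: rat_space.span_induct_alt)
  case base
  show ?case using rat_space.span_zero by simp
next
  case (step c t v)
  have "x * (of_rat c * t + v) = of_rat c * (x * t) + x * v" by (simp add: algebra_simps)
  then show ?case using rat_space.span_add[OF rat_space.span_scale[OF assms(1)[OF step(1)]] step(2)] by simp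
qed

text \<open>The powers of \<open>x - y\<close> lie in a finite-dimensional space, so they are linearly dependent.\<close>
lemma algebraic_diff:
  fixes x y :: complex
  assumes "algebraic x" "algebraic y"
  shows "algebraic (x - y)"
proof -
  obtain d r where d: "x ^ d = (\<Sum>k<d. of_rat (r k) * x ^ k)" using algebraic_power_relation[OF assms(1)] by blast
  obtain e s where e: "y ^ e = (\<Sum>k<e. of_rat (s k) * y ^ k)" using algebraic_power_relation[OF assms(2)] by blast
  define T where "T = (\<lambda>(i, j). x ^ i * y ^ j) ` ({..<d} \<times> {..<e})"
  have T: "x ^ i * y ^ j \<in> T" if "i < d" "j < e" for i j using that unfolding T_def by auto
  have finT: "finite T" by (simp add: T_def)
  let ?S = "rat_space.span T"
  have base: "x ^ i * y ^ j \<in> ?S" if "i < d" "j < e" for i j by (rule rat_space.span_base[OF T[OF that]])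
  have xd: "x ^ d * y ^ j \<in> ?S" if "j < e" for j
  proof -
    have "x ^ d * y ^ j = (\<Sum>k<d. of_rat (r k) * (x ^ k * y ^ j))" by (simp add: d sum_distrib_right mult.assoc)
    also have "\<dots> \<in> ?S" by (intro rat_space.span_sum rat_space.span_scale base) (use that in auto)
    finally show ?thesis .
  qed
  have ye: "x ^ i * y ^ e \<in> ?S" if "i < d" for i
  proof -
    have "x ^ i * y ^ e = (\<Sum>k<e. of_rat (s k) * (x ^ i * y ^ k))" by (simp add: e sum_distrib_left mult_ac)
    also have "\<dots> \<in> ?S" by (intro rat_space.span_sum rat_space.span_scale base) (use that in auto)
    finally show ?thesis .
  qed
  have mx: "x * t \<in> ?S" if t: "t \<in> T" for t
  proof -
    obtain i j where ij: "t = x ^ i * y ^ j" "i < d" "j < e" using t unfolding T_def by auto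
    have "x * t = x ^ Suc i * y ^ j" by (simp add: ij)
    moreover have "x ^ Suc i * y ^ j \<in> ?S"
    proof (cases "Suc i = d")
      case True
      show ?thesis unfolding True by (rule xd[OF ij(3)])
    next
      case False
      then show ?thesis using ij(2,3) by (intro base) simp_all
    qed
    ultimately show ?thesis by (simp only:)
  qed
  have my: "y * t \<in> ?S" if t: "t \<in> T" for t
  proof -
    obtain i j where ij: "t = x ^ i * y ^ j" "i < d" "j < e" using t unfolding T_def by auto
    have "y * t = x ^ i * y ^ Suc j" by (simp add: ij)
    moreover have "x ^ i * y ^ Suc j \<in> ?S"
    proof (cases "Suc j = e")
      case True
      show ?thesis unfolding True by (rule ye[OF ij(2)])
    next
      case False
      then show ?thesis using ij(2,3) by (intro base) simp_all
    qed
    ultimately show ?thesis by (simp only:)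
  qed
  define z where "z = x - y"
  have mz: "z * v \<in> ?S" if "v \<in> ?S" for v
    using rat_space.span_diff[OF span_closed_mult[OF mx that] span_closed_mult[OF my that]]
    by (simp add: z_def algebra_simps)
  have de: "d > 0" "e > 0" using d e by (auto intro!: gr0I)
  have powS: "z ^ n \<in> ?S" for n
  proof (induction n)
    case 0
    show ?case using base[OF de] by simp
  next
    case (Suc n)
    then show ?case using mz by simp
  qed
  show ?thesis
  proof (cases "inj (\<lambda>n. z ^ n)")
    case False
    then obtain m n where mn: "m \<noteq> n" "z ^ m = z ^ n" unfolding inj_def by blast
    define p where "p = monom (1 :: complex) m - monom 1 n"
    have "coeff p m \<noteq> 0" using mn by (simp add: p_def)
    then have "p \<noteq> 0" by auto
    moreover have "poly p z = 0" using mn by (simp add: p_def poly_monom)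
    moreover have "coeff p i \<in> \<rat>" for i by (simp add: p_def)
    ultimately show ?thesis unfolding z_def[symmetric] by (intro algebraicI')
  next
    case True
    have "rat_space.dependent (range (\<lambda>n. z ^ n))"
    proof (rule ccontr)
      assume "\<not> rat_space.dependent (range (\<lambda>n. z ^ n))"
      then have "finite (range (\<lambda>n. z ^ n))"
        using rat_space.independent_span_bound[OF finT] powS by blast
      then show False using True finite_imageD[of "\<lambda>n. z ^ n" UNIV] by auto
    qed
    then obtain U u v where U: "finite U" "U \<subseteq> range (\<lambda>n. z ^ n)" "(\<Sum>v\<in>U. of_rat (u v) * v) = 0" "v \<in> U" "u v \<noteq> 0"
      unfolding rat_space.dependent_explicit by blast
    define I where "I = (\<lambda>n. z ^ n) -` U"
    have I: "finite I" unfolding I_def by (rule finite_vimageI[OF U(1) True])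
    have UI: "U = (\<lambda>n. z ^ n) ` I" unfolding I_def image_vimage_eq using U(2) by blast
    define p where "p = (\<Sum>n\<in>I. monom (of_rat (u (z ^ n)) :: complex) n)"
    have "v \<in> (\<lambda>n. z ^ n) ` I" using U(4) UI by (simp only:)
    then obtain n where n: "v = z ^ n" "n \<in> I" by (rule imageE)
    have "coeff p n = (\<Sum>m\<in>I. if m = n then of_rat (u (z ^ m)) else 0)"
      unfolding p_def coeff_sum coeff_monom ..
    also have "\<dots> = of_rat (u v)" using n I by (simp add: sum.delta)
    finally have "coeff p n = of_rat (u v)" .
    then have "p \<noteq> 0" using U(5) by auto
    moreover have "coeff p i \<in> \<rat>" for i unfolding p_def coeff_sum by (intro Rats_sum) simp
    moreover have "poly p z = 0"
    proof -
      have "poly p z = (\<Sum>n\<in>I. of_rat (u (z ^ n)) * z ^ n)" by (simp add: p_def poly_sum poly_monom)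
      also have "\<dots> = (\<Sum>v\<in>U. of_rat (u v) * v)"
        unfolding UI by (subst sum.reindex[OF inj_on_subset[OF True subset_UNIV]]) simp
      finally show ?thesis using U(3) by simp
    qed
    ultimately show ?thesis unfolding z_def[symmetric] by (intro algebraicI')
  qed
qed

section \<open>Lines on the surface\<close>

text \<open>
  The line consists of the points \<open>q\<close> with \<open>q k = - (\<rho> + 1 / \<rho>)\<close> and \<open>q j = \<rho> * q i + \<tau>\<close>. Exchanging \<open>i\<close> and \<open>j\<close>
  replaces \<open>\<rho>\<close> by its inverse, so the bound on \<open>\<rho>\<close> is a choice of the order.
\<close>
locale line =
  fixes i j k :: 3 and \<rho> \<tau> :: complex
  assumes t: "trio i j k" and rat: "\<rho> \<in> \<rat>" "\<tau> \<in> \<rat>" and \<rho>1: "cmod \<rho> \<ge> 1"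
begin

definition ell :: complex where "ell = - (\<rho> + 1 / \<rho>)"
text \<open>
  One round along the chain is the affine map \<open>X \<mapsto> lam * X + kap c\<close> of the parameter. Its
  fixed point is \<open>fp c\<close>, unless \<open>lam = 1\<close> and the map is a translation.
\<close>
definition lam :: complex where "lam = 1 / (\<rho> * \<rho>)"
definition kap :: "complex \<Rightarrow> complex" where "kap c = (c - 2 * \<tau>) / \<rho>"
definition fp :: "complex \<Rightarrow> complex" where "fp c = kap c / (1 - lam)"

text \<open>
  The condition under which the line and its companion lie in the surface, when the constant of the surface
  is chosen accordingly. It is inherited by specialisations.
\<close>
definition fits :: "(3 \<Rightarrow> complex) \<Rightarrow> bool" where
  "fits \<beta> \<longleftrightarrow> \<beta> i = (\<rho> * \<tau> - \<tau> / \<rho>) + (- \<rho>) * \<beta> j"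

text \<open>
  For a coefficient vector that fits, the section of the surface at \<open>ell\<close> is a pair of lines, exchanged by
  the two involutions that preserve the section. The flag tells the lines apart, \<open>c\<close> is the
  coefficient at \<open>j\<close>.
\<close>
definition chain_pt :: "complex \<Rightarrow> complex \<Rightarrow> bool \<Rightarrow> 3 \<Rightarrow> complex" where
  "chain_pt c X s l = (if l = i then X else if l = j then (if s then X / \<rho> + c - \<tau> else \<rho> * X + \<tau>) else ell)"

text \<open>
  The parameter after \<open>n\<close> rounds. Negative \<open>n\<close> means the opposite direction.
\<close>
definition xi :: "complex \<Rightarrow> complex \<Rightarrow> int \<Rightarrow> complex" where
  "xi c x n = (if \<rho> * \<rho> = 1 then x + of_int n * kap c else lam powi n * (x - fp c) + fp c)"

text \<open>
  The position on the chain that a word leads to. It depends on the word alone, so it is the same for all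
  specialisations of the coefficients.
\<close>
fun cidx :: "3 list \<Rightarrow> int \<times> bool \<Rightarrow> int \<times> bool" where
  "cidx [] p = p"
| "cidx (l # w) (n, s) = cidx w (if l = i then (if s then n + 1 else n - 1) else n, \<not> s)"

lemma ne: "i \<noteq> j" "j \<noteq> i" "i \<noteq> k" "k \<noteq> i" "j \<noteq> k" "k \<noteq> j"
  using trio_neq[OF t] by auto

lemma \<rho>0: "\<rho> \<noteq> 0" using \<rho>1 by auto

lemma lam0: "lam \<noteq> 0" using \<rho>0 by (simp add: lam_def)

lemma ell_rat: "ell \<in> \<rat>" unfolding ell_def using rat(1) by (intro Rats_minus_iff[THEN iffD2] Rats_add Rats_divide) auto

lemma chain_simps: "chain_pt c X s i = X" "chain_pt c X s j = (if s then X / \<rho> + c - \<tau> else \<rho> * X + \<tau>)"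
  "chain_pt c X s k = ell"
  using ne by (simp_all add: chain_pt_def)

lemma chain_j: "vieta \<beta> j (chain_pt (\<beta> j) X s) = chain_pt (\<beta> j) X (\<not> s)"
proof (rule ext_trio[OF t])
  show "vieta \<beta> j (chain_pt (\<beta> j) X s) j = chain_pt (\<beta> j) X (\<not> s) j"
    unfolding vieta_same[OF trio_perm(1)[OF t]] chain_simps using \<rho>0 by (simp add: ell_def field_simps)
qed (use ne in \<open>simp_all add: vieta_other chain_simps\<close>)

lemma chain_i:
  assumes "fits \<beta>"
  shows "vieta \<beta> i (chain_pt (\<beta> j) X True) = chain_pt (\<beta> j) (lam * X + kap (\<beta> j)) False"
proof (rule ext_trio[OF t])
  have bi: "\<beta> i = (\<rho> * \<tau> - \<tau> / \<rho>) + (- \<rho>) * \<beta> j" using assms unfolding fits_def .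
  show "vieta \<beta> i (chain_pt (\<beta> j) X True) i = chain_pt (\<beta> j) (lam * X + kap (\<beta> j)) False i"
    unfolding vieta_same[OF t] chain_simps bi using \<rho>0
    by (simp add: ell_def lam_def kap_def field_simps)
  show "vieta \<beta> i (chain_pt (\<beta> j) X True) j = chain_pt (\<beta> j) (lam * X + kap (\<beta> j)) False j"
    unfolding vieta_other[OF ne(2)] chain_simps using \<rho>0 by (simp add: lam_def kap_def field_simps)
qed (use ne in \<open>simp add: vieta_other chain_simps\<close>)

lemma chain_i':
  assumes "fits \<beta>"
  shows "vieta \<beta> i (chain_pt (\<beta> j) (lam * X + kap (\<beta> j)) False) = chain_pt (\<beta> j) X True"
  using chain_i[OF assms, of X] vieta_twice by metis

lemma lam_neq_1: "\<rho> * \<rho> \<noteq> 1 \<Longrightarrow> lam \<noteq> 1"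
  using \<rho>0 by (auto simp: lam_def)

lemma xi_0: "xi c x 0 = x"
  by (simp add: xi_def)

lemma xi_step: "xi c x (n + 1) = lam * xi c x n + kap c"
proof (cases "\<rho> * \<rho> = 1")
  case True
  then show ?thesis by (simp add: xi_def lam_def algebra_simps)
next
  case False
  have "fp c * (1 - lam) = kap c" using lam_neq_1[OF False] by (simp add: fp_def)
  then have "lam * fp c + kap c = fp c" by (simp add: algebra_simps)
  moreover have "lam powi (n + 1) = lam * lam powi n" using lam0 by (simp add: power_int_add_1')
  ultimately show ?thesis using False by (simp add: xi_def algebra_simps)
qed

lemma chain_walk:
  assumes \<beta>: "fits \<beta>"
  shows "set w \<subseteq> {i, j} \<Longrightarrow> walk \<beta> w (chain_pt (\<beta> j) (xi (\<beta> j) x n) s)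
     = chain_pt (\<beta> j) (xi (\<beta> j) x (fst (cidx w (n, s)))) (snd (cidx w (n, s)))"
proof (induction w arbitrary: n s)
  case (Cons l w)
  have "vieta \<beta> l (chain_pt (\<beta> j) (xi (\<beta> j) x n) s)
      = chain_pt (\<beta> j) (xi (\<beta> j) x (if l = i then (if s then n + 1 else n - 1) else n)) (\<not> s)"
  proof (cases "l = i")
    case True
    show ?thesis
    proof (cases s)
      case True
      show ?thesis using chain_i[OF \<beta>, of "xi (\<beta> j) x n"] \<open>l = i\<close> True by (simp add: xi_step)
    next
      case False
      have "xi (\<beta> j) x n = lam * xi (\<beta> j) x (n - 1) + kap (\<beta> j)" using xi_step[of "\<beta> j" x "n - 1"] by simp
      then show ?thesis using chain_i'[OF \<beta>, of "xi (\<beta> j) x (n - 1)"] \<open>l = i\<close> False by simp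
    qed
  next
    case False
    then have "l = j" using Cons.prems by simp
    then show ?thesis using chain_j ne by simp
  qed
  then show ?case using Cons by simp
qed simp

lemma cidx_parity: "snd (cidx w (n, s)) = (s \<noteq> odd (length w))"
  by (induction w arbitrary: n s) auto

lemma Rats_\<rho>: "ell \<in> \<rat>" "lam \<in> \<rat>"
  using ell_rat rat unfolding lam_def by (auto intro!: Rats_divide Rats_mult)

lemma norm_1_square: 
  assumes "cmod \<rho> = 1" shows "\<rho> * \<rho> = 1"
proof -
  obtain m d where "\<rho> = of_int m / of_int d" using rat(1) by (cases rule: Rats_cases') auto
  then have r: "\<rho> = of_real (of_int m / of_int d)" by simp
  then have "\<bar>of_int m / of_int d :: real\<bar> = 1" using assms by (simp only: norm_of_real)
  then have "(of_int m / of_int d :: real) * (of_int m / of_int d) = 1" by (metis abs_mult_self_eq mult_1)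
  then show ?thesis unfolding r by (metis of_real_1 of_real_mult)
qed

lemma lam_less_1: 
  assumes "\<rho> * \<rho> \<noteq> 1" shows "cmod lam < 1"
proof -
  have "cmod \<rho> \<noteq> 1" using assms norm_1_square by blast
  then have "1 < cmod \<rho>" using \<rho>1 by simp
  then have "1 < cmod \<rho> * cmod \<rho>" by (simp add: less_1_mult)
  then show ?thesis by (simp add: lam_def norm_divide norm_mult)
qed

lemma lam_power_1:
  assumes \<rho>2: "\<rho> * \<rho> \<noteq> 1" and one: "lam powi n = 1" shows "n = 0"
proof -
  have pos: "lam powi m \<noteq> 1" if m: "m > 0" for m
  proof
    assume "lam powi m = 1"
    then have "cmod lam ^ nat m = 1" using m by (metis norm_one norm_power power_int_def less_imp_le)
    moreover obtain q where "nat m = Suc q" using m by (cases "nat m") auto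
    then have "cmod lam ^ nat m < 1" using power_Suc_less_one[of "cmod lam" q] lam_less_1[OF \<rho>2] lam0 by simp
    ultimately show False by simp
  qed
  have "lam powi (- n) = 1" using one by (simp add: power_int_minus)
  then show ?thesis using pos[of n] pos[of "- n"] one by (cases n "0 :: int" rule: linorder_cases) auto
qed

lemma kap_irr: "c \<notin> \<rat> \<Longrightarrow> kap c \<notin> \<rat>"
proof
  assume c: "c \<notin> \<rat>" and "kap c \<in> \<rat>"
  then have "\<rho> * kap c + 2 * \<tau> \<in> \<rat>" using rat by (intro Rats_add Rats_mult) auto
  then show False using c \<rho>0 by (simp add: kap_def)
qed

lemma Rats_mult_cancel: "(u :: complex) \<in> \<rat> \<Longrightarrow> u \<noteq> 0 \<Longrightarrow> u * z \<in> \<rat> \<Longrightarrow> z \<in> \<rat>"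
  using Rats_divide[of "u * z" u] by simp

lemma Rats_add_cancel: "(u :: complex) \<in> \<rat> \<Longrightarrow> u + z \<in> \<rat> \<Longrightarrow> z \<in> \<rat>"
  using Rats_diff[of "u + z" u] by simp

text \<open>Walking along the chain leaves the rational points for good.\<close>
lemma chain_rational:
  assumes c: "c \<notin> \<rat>" and x: "x \<in> \<rat>" and R: "\<forall>l. chain_pt c (xi c x n) s l \<in> \<rat>"
  shows "n = 0" "\<not> s"
proof -
  have X: "xi c x n \<in> \<rat>" using R[rule_format, of i] by (simp add: chain_simps)
  show n: "n = 0"
  proof (cases "\<rho> * \<rho> = 1")
    case True
    then have "x + of_int n * kap c \<in> \<rat>" using X by (simp add: xi_def)
    then have "of_int n * kap c \<in> \<rat>" by (rule Rats_add_cancel[OF x])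
    then show ?thesis using kap_irr[OF c] Rats_mult_cancel[of "of_int n"] by (metis Rats_of_int of_int_eq_0_iff)
  next
    case False
    have "fp c \<notin> \<rat>"
    proof
      assume "fp c \<in> \<rat>"
      then have "fp c * (1 - lam) \<in> \<rat>" using Rats_\<rho>(2) by (intro Rats_mult Rats_diff) auto
      then show False using kap_irr[OF c] lam_neq_1[OF False] by (simp add: fp_def)
    qed
    moreover have "lam powi n * x + (1 - lam powi n) * fp c \<in> \<rat>"
      using X False by (simp add: xi_def algebra_simps)
    moreover have ln: "lam powi n \<in> \<rat>" using Rats_\<rho>(2) by (simp add: power_int_def Rats_power Rats_inverse)
    moreover have "lam powi n * x \<in> \<rat>" using ln x by (rule Rats_mult)
    ultimately have "1 - lam powi n = 0"
      using Rats_add_cancel[of "lam powi n * x" "(1 - lam powi n) * fp c"] Rats_mult_cancel[of "1 - lam powi n" "fp c"]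
      by (metis Rats_1 Rats_diff)
    then show ?thesis using lam_power_1[OF False, of n] by simp
  qed
  show "\<not> s"
  proof
    assume s
    then have "(x / \<rho> - \<tau>) + c \<in> \<rat>" using R[rule_format, of j] by (simp add: chain_simps n xi_0 algebra_simps)
    moreover have "x / \<rho> - \<tau> \<in> \<rat>" using x rat by (intro Rats_diff Rats_divide)
    ultimately show False using c Rats_add_cancel by blast
  qed
qed

lemma chain_large:
  assumes X: "cmod X \<ge> cmod \<rho> * (T + cmod c + cmod \<tau>)" and T: "T \<ge> 0"
  shows "T \<le> cmod (chain_pt c X s i)" "T \<le> cmod (chain_pt c X s j)"
proof -
  have "1 * (T + cmod c + cmod \<tau>) \<le> cmod \<rho> * (T + cmod c + cmod \<tau>)"
    using \<rho>1 T by (intro mult_right_mono) auto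
  then have X1: "T + cmod c + cmod \<tau> \<le> cmod X" using X by simp
  then show "T \<le> cmod (chain_pt c X s i)" using norm_ge_zero[of c] norm_ge_zero[of \<tau>] unfolding chain_simps by linarith
  show "T \<le> cmod (chain_pt c X s j)"
  proof (cases s)
    case True
    have "0 < cmod \<rho>" using \<rho>1 by linarith
    then have "T + cmod c + cmod \<tau> \<le> cmod X / cmod \<rho>" using X by (simp only: pos_le_divide_eq mult.commute)
    also have "\<dots> = cmod ((X / \<rho> + c - \<tau>) - (c - \<tau>))" by (simp add: norm_divide)
    also have "\<dots> \<le> cmod (X / \<rho> + c - \<tau>) + cmod c + cmod \<tau>"
      using norm_triangle_ineq4[of "X / \<rho> + c - \<tau>" "c - \<tau>"] norm_triangle_ineq4[of c \<tau>] by linarith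
    finally show ?thesis using True by (simp add: chain_simps)
  next
    case False
    have "cmod X \<le> cmod (\<rho> * X)" using \<rho>1 by (simp add: norm_mult mult_le_cancel_right1)
    also have "\<dots> = cmod ((\<rho> * X + \<tau>) - \<tau>)" by simp
    also have "\<dots> \<le> cmod (\<rho> * X + \<tau>) + cmod \<tau>" by (rule norm_triangle_ineq4)
    finally have "T \<le> cmod (\<rho> * X + \<tau>)" using X1 norm_ge_zero[of c] by linarith
    then show ?thesis using False by (simp add: chain_simps)
  qed
qed

text \<open>
  If the parameter is small for both translations, the number of rounds is bounded by their difference, and then
  the starting point was not far away.
\<close>
lemma far_translation:
  assumes \<rho>2: "\<rho> * \<rho> = 1" and c: "c1 \<noteq> c2"
  shows "\<exists>B. \<forall>x n. B \<le> cmod x \<longrightarrow> R \<le> cmod (xi c1 x n) \<or> R \<le> cmod (xi c2 x n)"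
proof -
  define d where "d = cmod (kap c1 - kap c2)"
  have "kap c1 - kap c2 = (c1 - c2) / \<rho>" by (simp add: kap_def diff_divide_distrib)
  then have d: "d > 0" using c \<rho>0 by (simp add: d_def)
  show ?thesis
  proof (intro exI[of _ "R + (2 * R / d) * cmod (kap c1)"] allI impI)
    fix x n assume x: "R + (2 * R / d) * cmod (kap c1) \<le> cmod x"
    show "R \<le> cmod (xi c1 x n) \<or> R \<le> cmod (xi c2 x n)"
    proof (rule ccontr)
      assume "\<not> ?thesis"
      then have s: "cmod (xi c1 x n) < R" "cmod (xi c2 x n) < R" by auto
      have "of_int n * (kap c1 - kap c2) = xi c1 x n - xi c2 x n" using \<rho>2 by (simp add: xi_def algebra_simps)
      then have "\<bar>of_int n\<bar> * d = cmod (xi c1 x n - xi c2 x n)" unfolding d_def by (metis norm_mult norm_of_int)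
      also have "\<dots> < 2 * R" using norm_triangle_ineq4[of "xi c1 x n" "xi c2 x n"] s by linarith
      finally have n: "\<bar>of_int n\<bar> < 2 * R / d" using d by (simp add: field_simps)
      have "x = xi c1 x n - of_int n * kap c1" using \<rho>2 by (simp add: xi_def)
      then have "cmod x \<le> cmod (xi c1 x n) + \<bar>of_int n\<bar> * cmod (kap c1)"
        by (metis norm_mult norm_of_int norm_triangle_ineq4)
      also have "\<bar>of_int n\<bar> * cmod (kap c1) \<le> (2 * R / d) * cmod (kap c1)" using n by (intro mult_right_mono) auto
      finally show False using x s by simp
    qed
  qed
qed

lemma far_expanding:
  assumes \<rho>2: "\<rho> * \<rho> \<noteq> 1"
  shows "\<exists>B. \<forall>x n. B \<le> cmod x \<longrightarrow> n \<le> int N \<longrightarrow> R \<le> cmod (xi c x n)"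
proof -
  define e where "e = cmod lam ^ N"
  have e: "e > 0" using lam0 by (simp add: e_def)
  show ?thesis
  proof (intro exI[of _ "(\<bar>R\<bar> + cmod (fp c)) / e + cmod (fp c)"] allI impI)
    fix x n assume x: "(\<bar>R\<bar> + cmod (fp c)) / e + cmod (fp c) \<le> cmod x" and n: "n \<le> int N"
    have "cmod lam powi int N \<le> cmod lam powi n"
      using lam_less_1[OF \<rho>2] lam0 n by (intro power_int_decreasing) auto
    then have le: "e \<le> cmod (lam powi n)" by (simp add: e_def norm_power_int)
    have "(\<bar>R\<bar> + cmod (fp c)) / e \<le> cmod (x - fp c)" using x norm_triangle_ineq2[of x "fp c"] by linarith
    then have "\<bar>R\<bar> + cmod (fp c) \<le> e * cmod (x - fp c)" using e by (simp add: field_simps)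
    also have "\<dots> \<le> cmod (lam powi n) * cmod (x - fp c)" using le by (intro mult_right_mono) auto
    also have "\<dots> = cmod (xi c x n - fp c)" using \<rho>2 by (simp add: xi_def norm_mult)
    also have "\<dots> \<le> cmod (xi c x n) + cmod (fp c)" by (rule norm_triangle_ineq4)
    finally show "R \<le> cmod (xi c x n)" by linarith
  qed
qed

end

section \<open>Denominators at a prime\<close>

locale p_adic_valuation = valuation +
  fixes p :: nat
  assumes prime: "prime p" and p_small: "inverse (of_nat p) \<notin> A"
begin

definition ip :: "nat \<Rightarrow> complex" where "ip m = inverse (of_nat p) ^ m"

text \<open>
  The valuation ring may have a complicated value group. Tame elements are those that the powers of \<open>p\<close>
  can bound; all algebraic numbers belong to them.
\<close>
definition tame :: "complex \<Rightarrow> bool" where "tame z \<longleftrightarrow> (\<exists>m. vle z (ip m))"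

lemma p0: "(of_nat p :: complex) \<noteq> 0" using prime by (simp add: prime_gt_0_nat)

lemma ip_add: "ip (m + n) = ip m * ip n" by (simp add: ip_def power_add)

lemma ip_nz: "ip m \<noteq> 0" using p0 by (simp add: ip_def)

lemma one_le_ip: "vle 1 (ip m)"
proof -
  have "1 = of_nat p ^ m * ip m" using p0 by (simp add: ip_def power_inverse)
  then show ?thesis unfolding vle_def using subring_power[OF subring subring_of_nat[OF subring]] by blast
qed

lemma ip_mono: "m \<le> n \<Longrightarrow> vle (ip m) (ip n)"
  using vle_mult[OF vle_refl one_le_ip, of "ip m" "n - m"] ip_add[of m "n - m"] by simp

lemma ip_1: "\<not> vle (ip 1) 1"
  using p_small by (simp add: vle_1 ip_def)

lemma ip_strict: "m < n \<Longrightarrow> \<not> vle (ip n) (ip m)"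
proof
  assume mn: "m < n" and le: "vle (ip n) (ip m)"
  have "vle (ip (Suc m)) (ip n)" using mn by (intro ip_mono) simp
  then have "vle (ip (Suc m)) (ip m)" using le vle_trans by blast
  then have "vle (ip 1 * ip m) (1 * ip m)" using ip_add[of 1 m] by simp
  then show False using vle_cancel[OF ip_nz] ip_1 by blast
qed

lemma tame_mono: "vle z (ip m) \<Longrightarrow> m \<le> n \<Longrightarrow> vle z (ip n)"
  using ip_mono vle_trans by blast

lemma tame_add: "tame x \<Longrightarrow> tame y \<Longrightarrow> tame (x + y)"
  unfolding tame_def by (meson tame_mono vle_add max.cobounded1 max.cobounded2)

lemma tame_mult: "tame x \<Longrightarrow> tame y \<Longrightarrow> tame (x * y)"
  unfolding tame_def using vle_mult ip_add by metis

lemma tame_minus: "tame x \<Longrightarrow> tame (- x)"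
  unfolding tame_def using vle_minus by blast

lemma tame_diff: "tame x \<Longrightarrow> tame y \<Longrightarrow> tame (x - y)"
  using tame_add[OF _ tame_minus] by (metis diff_conv_add_uminus)

lemma tame_of_int: "tame (of_int n)"
  unfolding tame_def using vle_of_int one_le_ip vle_trans by blast

text \<open>
  The greatest common divisor of \<open>n\<close> and a large power of \<open>p\<close> is a smaller power of \<open>p\<close>, and by Bezout its
  absolute value is at most the larger one of theirs.
\<close>
lemma tame_inverse_of_nat:
  assumes n: "n > 0" shows "tame (inverse (of_nat n))"
proof (rule ccontr)
  assume nt: "\<not> tame (inverse (of_nat n))"
  define e where "e = gcd n (p ^ n)"
  have "e dvd p ^ n" by (simp add: e_def)
  then obtain m where m: "m \<le> n" "e = p ^ m" using prime by (auto simp: divides_primepow_nat)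
  have "n < p ^ n" using prime prime_gt_1_nat by (intro power_gt_expt) auto
  then have "\<not> p ^ n dvd n" using n by (auto dest: dvd_imp_le)
  then have mn: "m < n" using m by (metis e_def gcd_dvd1 le_neq_implies_less)
  have "int e = gcd (int n) (int (p ^ n))" by (simp only: e_def gcd_int_int_eq)
  then obtain u v where uv: "u * int n + v * int (p ^ n) = int e" using bezout_int[of "int n" "int (p ^ n)"]
    by metis
  have "of_int (u * int n + v * int (p ^ n)) = (of_int (int e) :: complex)" by (simp only: uv)
  then have eq: "of_int u * of_nat n + of_int v * of_nat p ^ n = (of_nat p ^ m :: complex)" by (simp add: m)
  have n0: "(of_nat n :: complex) \<noteq> 0" using n by simp
  have pn: "of_nat p ^ n * ip n = (1 :: complex)" using p0 by (simp add: ip_def power_inverse)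
  have "vle (ip n) (inverse (of_nat n))" using nt vle_total unfolding tame_def by blast
  then have "vle (ip n * (of_nat n * of_nat p ^ n)) (inverse (of_nat n) * (of_nat n * of_nat p ^ n))"
    using vle_mult vle_refl by blast
  moreover have "ip n * (of_nat n * of_nat p ^ n) = of_nat n" using pn by (simp add: mult.left_commute mult.commute)
  moreover have "inverse (of_nat n) * (of_nat n * of_nat p ^ n) = (of_nat p ^ n :: complex)"
    using n0 by (simp flip: mult.assoc)
  ultimately have 1: "vle (of_nat n) (of_nat p ^ n)" by (simp only:)
  have int: "vle (of_int z * y) y" for z y using vle_mult[OF vle_of_int vle_refl, of z y] by simp
  have "vle (of_nat p ^ m) (of_nat p ^ n)"
    unfolding eq[symmetric] using vle_add vle_trans[OF int 1] int by blast
  then have "vle (of_nat p ^ m * (ip n * ip m)) (of_nat p ^ n * (ip n * ip m))" using vle_mult vle_refl by blast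
  moreover have "of_nat p ^ m * ip m = (1 :: complex)" using p0 by (simp add: ip_def power_inverse)
  moreover have "of_nat p ^ m * (ip n * ip m) = ip n * (of_nat p ^ m * ip m)"
    "of_nat p ^ n * (ip n * ip m) = (of_nat p ^ n * ip n) * ip m" by (simp_all only: mult_ac)
  ultimately have "vle (ip n) (ip m)" using pn by simp
  then show False using ip_strict[OF mn] by blast
qed

lemma tame_Rats: "z \<in> \<rat> \<Longrightarrow> tame z"
proof -
  assume "z \<in> \<rat>"
  then obtain m d where d: "d > 0" "z = of_int m / of_int d" by (cases rule: Rats_cases') auto
  then have "z = of_int m * inverse (of_nat (nat d))" by (simp add: divide_inverse)
  moreover have "nat d > 0" using d(1) by simp
  ultimately show ?thesis by (simp only:) (intro tame_mult tame_of_int tame_inverse_of_nat)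
qed

lemma tame_finite:
  "finite S \<Longrightarrow> (\<And>z. z \<in> S \<Longrightarrow> tame z) \<Longrightarrow> \<exists>m. \<forall>z\<in>S. vle z (ip m)"
proof (induction S rule: finite_induct)
  case (insert z S)
  then obtain m where m: "\<forall>z\<in>S. vle z (ip m)" by auto
  obtain n where n: "vle z (ip n)" using insert.prems unfolding tame_def by blast
  have "\<forall>y\<in>insert z S. vle y (ip (m + n))"
    using m n tame_mono[of _ m "m + n"] tame_mono[of _ n "m + n"] by auto
  then show ?case by blast
qed simp

text \<open>
  A number larger than all coefficients of a monic equation for it would have a dominating highest power.
\<close>
lemma tame_algebraic:
  assumes "algebraic z" shows "tame z"
proof -
  obtain d r where d: "z ^ d = (\<Sum>k<d. of_rat (r k) * z ^ k)" using algebraic_power_relation[OF assms] by blast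
  have "finite ((\<lambda>k. of_rat (r k) :: complex) ` {..<d})" by simp
  moreover have "tame y" if "y \<in> (\<lambda>k. of_rat (r k)) ` {..<d}" for y using that tame_Rats by auto
  ultimately obtain m where m: "\<forall>y\<in>(\<lambda>k. of_rat (r k)) ` {..<d}. vle y (ip m)" using tame_finite by blast
  have "vle z (ip m)"
  proof (rule ccontr)
    assume big: "\<not> vle z (ip m)"
    then have z1: "vle 1 z" using one_le_ip vle_total vle_trans by blast
    have z0: "z \<noteq> 0" using big vle_0 by metis
    obtain e where e: "d = Suc e" using d by (cases d) auto
    have pow: "vle (z ^ k) (z ^ e)" if "k \<le> e" for k
    proof -
      have one: "vle 1 (z ^ l)" for l
      proof (induction l)
        case 0
        show ?case by (simp add: vle_refl)
      next
        case (Suc l)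
        then show ?case using vle_mult[OF z1 Suc] by simp
      qed
      have "z ^ e = z ^ k * z ^ (e - k)" using that by (simp flip: power_add)
      then show ?thesis using vle_mult[OF vle_refl one[of "e - k"], of "z ^ k"] by simp
    qed
    have sum: "vle (sum f S) y" if "finite S" "\<And>k. k \<in> S \<Longrightarrow> vle (f k) y" for f :: "nat \<Rightarrow> complex" and S y
      using that by (induction S rule: finite_induct) (auto simp: vle_0 vle_add)
    have "vle (z ^ d) (ip m * z ^ e)"
      unfolding d using m pow e by (intro sum vle_mult) auto
    then have "vle (z * z ^ e) (ip m * z ^ e)" unfolding e power_Suc .
    then show False using big vle_cancel[of "z ^ e"] z0 by simp
  qed
  then show ?thesis unfolding tame_def by blast
qed

end

section \<open>Leaving a line\<close>

context line begin

text \<open>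
  A prime factor of the numerator of \<open>\<rho>\<close>, at which the multiplier \<open>lam = 1 / (\<rho> * \<rho>)\<close> is large although its real
  absolute value is less than 1.
\<close>
lemma prime_lam:
  assumes \<rho>2: "\<rho> * \<rho> \<noteq> 1"
  shows "\<exists>p. prime (p :: nat) \<and> (\<forall>A. p_adic_valuation A p \<longrightarrow> valuation.vle A (inverse (of_nat p)) lam)"
proof -
  obtain m d where md: "d > 0" "coprime m d" "\<rho> = of_int m / of_int d" using rat(1) by (cases rule: Rats_cases') auto
  have "cmod \<rho> \<noteq> 1" using \<rho>2 norm_1_square by blast
  then have "1 < cmod \<rho>" using \<rho>1 by simp
  then have "of_int d < \<bar>of_int m :: real\<bar>" using md by (simp add: norm_divide field_simps)
  then have m1: "nat \<bar>m\<bar> \<noteq> 1" using md(1) by linarith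
  then obtain p where p: "prime p" "p dvd nat \<bar>m\<bar>" using prime_factor_nat by blast
  then have pm: "int p dvd m" by (metis abs_of_nat dvd_abs_iff int_dvd_int_iff int_nat_eq abs_ge_zero)
  then obtain m' where m': "m = int p * m'" by (rule dvdE)
  have "valuation.vle A (inverse (of_nat p)) lam" if A: "p_adic_valuation A p" for A
  proof -
    interpret p_adic_valuation A p by (rule A)
    have pp: "\<not> vle 1 (of_nat p)"
    proof
      assume "vle 1 (of_nat p)"
      then have "vle (1 * inverse (of_nat p)) (of_nat p * inverse (of_nat p))" by (rule vle_mult[OF _ vle_refl])
      then show False using p_small p0 by (simp add: vle_1)
    qed
    have int: "vle (of_int z * y) y" for z y using vle_mult[OF vle_of_int vle_refl, of z y] by simp
    have d1: "vle 1 (of_int d)"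
    proof (rule ccontr)
      assume nd: "\<not> vle 1 (of_int d)"
      have "coprime (int p) d" using md(2) pm coprime_divisors[OF _ dvd_refl] by blast
      then obtain u v where "u * int p + v * d = 1" using bezout_int[of "int p" d] by (auto simp: coprime_iff_gcd_eq_1)
      then have "of_int u * of_nat p + of_int v * of_int d = (1 :: complex)"
        by (metis of_int_1 of_int_add of_int_mult of_int_of_nat_eq)
      moreover have "\<not> vle 1 (of_int u * of_nat p)" using pp int vle_trans by blast
      moreover have "\<not> vle 1 (of_int v * of_int d)" using nd int vle_trans by blast
      ultimately show False using vless_add vle_refl by metis
    qed
    have m0: "(of_int m :: complex) \<noteq> 0" using md(3) \<rho>0 by auto
    then have m'0: "(of_int m' :: complex) \<noteq> 0" by (simp add: m')
    have "vle (1 * 1 * (1 / (of_int m * of_int m))) (of_int d * of_int d * (1 / (of_int m * of_int m)))"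
      by (intro vle_mult d1 vle_refl)
    moreover have "lam = of_int d * of_int d * (1 / (of_int m * of_int m))"
      unfolding lam_def unfolding md(3) using md(1) m0 by (simp add: field_simps)
    ultimately have 1: "vle (1 / (of_int m * of_int m)) lam" by simp
    have "inverse (of_nat p) = of_int (int p * (m' * m')) * (1 / (of_int m * of_int m) :: complex)"
      using p0 m'0 by (simp add: m' field_simps)
    then have "vle (inverse (of_nat p)) (1 / (of_int m * of_int m))" using int by metis
    then show ?thesis using 1 vle_trans by blast
  qed
  then show ?thesis using p(1) by blast
qed

text \<open>
  The two fixed points have a nonzero difference \<open>\<delta>\<close>, and after \<open>n\<close> rounds the distances of the
  two parameters to their fixed points differ by \<open>lam ^ n * \<delta>\<close>, whatever the starting point was. This
  is large at the prime, so one of the two parameters is.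
\<close>
lemma exit_p_adic:
  assumes \<rho>2: "\<rho> * \<rho> \<noteq> 1" and ne12: "\<beta>1 j \<noteq> \<beta>2 j"
    and \<beta>: "\<forall>\<beta>\<in>{\<beta>1, \<beta>2}. fits \<beta> \<and> algebraic (\<beta> j) \<and> \<beta> k \<in> \<rat>"
  shows "\<exists>A N. valuation A \<and> (\<forall>x n s. int N < n \<longrightarrow>
    (\<exists>\<beta>\<in>{\<beta>1, \<beta>2}. vieta \<beta> k (chain_pt (\<beta> j) (xi (\<beta> j) x n) s) \<in> valuation.vbig A \<beta> k))"
proof -
  obtain p where p: "prime p" "\<And>A. p_adic_valuation A p \<Longrightarrow> valuation.vle A (inverse (of_nat p)) lam"
    using prime_lam[OF \<rho>2] by blast
  obtain A where A: "valuation A" "inverse (of_nat p) \<notin> A" using p_adic[OF p(1)] by blast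
  interpret p_adic_valuation A p
    using A p(1) unfolding p_adic_valuation_def p_adic_valuation_axioms_def by blast
  have lam_ge: "vle (inverse (of_nat p)) lam" by (rule p(2)) unfold_locales
  have lam1: "1 - lam \<noteq> 0" using lam_neq_1[OF \<rho>2] by simp
  have rats: "tame \<rho>" "tame (1 / \<rho>)" "tame \<tau>" "tame ell" "tame (1 / (1 - lam))" "tame (1 - lam)"
    using rat Rats_\<rho> by (auto intro!: tame_Rats Rats_divide Rats_diff)
  have tj: "tame (\<beta> j)" if "\<beta> \<in> {\<beta>1, \<beta>2}" for \<beta> using \<beta> that tame_algebraic by blast
  have tl: "tame (\<beta> l)" if b: "\<beta> \<in> {\<beta>1, \<beta>2}" for \<beta> l
  proof -
    have "\<beta> i = (\<rho> * \<tau> - \<tau> * (1 / \<rho>)) + (- \<rho>) * \<beta> j" using \<beta> b unfolding fits_def by auto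
    also have "tame \<dots>" by (intro tame_add tame_diff tame_mult tame_minus rats tj[OF b])
    finally have "tame (\<beta> i)" .
    moreover have "tame (\<beta> k)" using \<beta> b tame_Rats by blast
    ultimately show ?thesis using tj[OF b] trio_cases[OF t, of l] by blast
  qed
  have kap': "kap c = (c - (\<tau> + \<tau>)) * (1 / \<rho>)" for c by (simp add: kap_def)
  have tf: "tame (fp (\<beta> j))" if "\<beta> \<in> {\<beta>1, \<beta>2}" for \<beta>
  proof -
    have "tame (kap (\<beta> j) * (1 / (1 - lam)))" unfolding kap'
      by (intro tame_mult tame_diff tame_add rats tj[OF that])
    then show ?thesis by (simp add: fp_def)
  qed
  define \<delta> where "\<delta> = fp (\<beta>1 j) - fp (\<beta>2 j)"
  have \<delta>: "\<delta> = (\<beta>1 j - \<beta>2 j) * (1 / \<rho>) * (1 / (1 - lam))"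
    by (simp add: \<delta>_def fp_def kap_def diff_divide_distrib)
  have \<delta>0: "\<delta> \<noteq> 0" unfolding \<delta> using ne12 \<rho>0 lam1 by simp
  have "algebraic (inverse (\<beta>1 j - \<beta>2 j))" using \<beta> by (intro algebraic_inverse algebraic_diff) blast+
  then have "tame (inverse (\<beta>1 j - \<beta>2 j) * \<rho> * (1 - lam))"
    by (intro tame_mult tame_algebraic rats)
  then have td: "tame (1 / \<delta>)" unfolding \<delta> by (simp add: field_simps)
  define S where "S = {\<rho>, 1 / \<rho>, \<tau>, ell, 1 / \<delta>, fp (\<beta>1 j), fp (\<beta>2 j), \<beta>1 j - \<tau>, \<beta>2 j - \<tau>, \<beta>1 k - ell, \<beta>2 k - ell}
     \<union> range \<beta>1 \<union> range \<beta>2"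
  have "finite S" unfolding S_def by simp
  moreover have "tame z" if "z \<in> S" for z
    using that rats td tf tl tame_diff[OF tl rats(3)] tame_diff[OF tl rats(4)] unfolding S_def by auto
  ultimately obtain m where "\<forall>z\<in>S. vle z (ip m)" using tame_finite by blast
  then have m: "z \<in> S \<Longrightarrow> vle z (ip m)" for z by blast
  have mS: "vle \<rho> (ip m)" "vle (1 / \<rho>) (ip m)" "vle \<tau> (ip m)" "vle (1 / \<delta>) (ip m)"
    by (rule m; simp add: S_def)+
  \<comment> \<open>\<open>ip m\<close> bounds all constants; a parameter above \<open>ip (3 * m)\<close> leaves room for the affine maps
    that give the other coordinate\<close>
  have trap: "vieta \<beta> k (chain_pt (\<beta> j) X s) \<in> vbig \<beta> k"
    if b: "\<beta> \<in> {\<beta>1, \<beta>2}" and X: "\<not> vle X (ip (3 * m))" for \<beta> X s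
  proof -
    have P1: "vle (ip m) (ip (2 * m))" by (rule ip_mono) simp
    have scale: "\<not> vle (u * X) (ip (2 * m))" if u: "u \<noteq> 0" "vle (1 / u) (ip m)" for u
    proof
      assume "vle (u * X) (ip (2 * m))"
      then have "vle (1 / u * (u * X)) (ip m * ip (2 * m))" by (rule vle_mult[OF u(2)])
      then have "vle X (ip (3 * m))" using u(1) ip_add[of m "2 * m"] by simp
      then show False using X by simp
    qed
    have shift: "\<not> vle (Z + z) (ip (2 * m))" if "\<not> vle Z (ip (2 * m))" "vle z (ip m)" for Z z
    proof
      assume "vle (Z + z) (ip (2 * m))"
      then have "vle ((Z + z) - z) (ip (2 * m))" using vle_trans[OF that(2) P1] by (rule vle_diff)
      then show False using that(1) by simp
    qed
    define Y where "Y = chain_pt (\<beta> j) X s j"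
    have Y: "\<not> vle Y (ip (2 * m))"
    proof (cases s)
      case True
      have "\<not> vle ((1 / \<rho>) * X + (\<beta> j - \<tau>)) (ip (2 * m))"
        using \<rho>0 mS(1) b by (intro shift scale m) (auto simp: S_def)
      then show ?thesis using True by (simp add: Y_def chain_simps add_diff_eq)
    next
      case False
      have "\<not> vle (\<rho> * X + \<tau>) (ip (2 * m))" using \<rho>0 mS by (intro shift scale)
      then show ?thesis using False by (simp add: Y_def chain_simps)
    qed
    have X1: "\<not> vle X 1" using X one_le_ip vle_trans by blast
    have Y1: "\<not> vle Y 1" using Y one_le_ip vle_trans by blast
    have Xm: "\<not> vle X (ip m)" using X ip_mono[of m "3 * m"] vle_trans by (metis le_add2 mult_le_cancel2 mult_numeral_1 nat_mult_1 one_le_numeral)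
    have X0: "X \<noteq> 0" using X1 vle_0 by metis
    have XXY: "vle X (X * Y)" using vle_mult[OF vle_refl, of 1 Y X] Y1 vle_total by auto
    have XYm: "\<not> vle (X * Y) (ip m)" using Xm XXY vle_trans by blast
    have small: "vle z (X * Y)" if "z \<in> S" for z
      using m[OF that] XYm vle_total vle_trans by blast
    show ?thesis
    proof (rule vbig_enter[OF trio_perm(5)[OF t]])
      show "\<not> vle (chain_pt (\<beta> j) X s i) 1" using X1 by (simp add: chain_simps)
      show "\<not> vle (chain_pt (\<beta> j) X s j) 1" using Y1 by (simp add: Y_def)
      have "\<beta> k - ell \<in> S" using b by (auto simp: S_def)
      then show "\<not> vle (chain_pt (\<beta> j) X s i * chain_pt (\<beta> j) X s j) (\<beta> k - chain_pt (\<beta> j) X s k)"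
        using m XYm vle_trans unfolding Y_def[symmetric] chain_simps(1,3) by blast
      have "\<beta> l \<in> S" for l using b by (auto simp: S_def)
      then show "\<forall>l. vle (\<beta> l) (chain_pt (\<beta> j) X s i * chain_pt (\<beta> j) X s j)"
        using small unfolding Y_def[symmetric] chain_simps(1) by blast
    qed
  qed
  have "\<exists>\<beta>\<in>{\<beta>1, \<beta>2}. \<not> vle (xi (\<beta> j) x n) (ip (3 * m))" if n: "int (4 * m) < n" for x n
  proof (rule ccontr)
    assume "\<not> ?thesis"
    then have small: "vle (xi (\<beta>1 j) x n) (ip (3 * m))" "vle (xi (\<beta>2 j) x n) (ip (3 * m))" by blast+
    have f: "vle (fp (\<beta>1 j)) (ip (3 * m))" "vle (fp (\<beta>2 j)) (ip (3 * m))"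
      by (rule tame_mono[OF m]; simp add: S_def)+
    have eq: "lam powi n * \<delta> = (xi (\<beta>2 j) x n - fp (\<beta>2 j)) - (xi (\<beta>1 j) x n - fp (\<beta>1 j))"
      using \<rho>2 by (simp add: xi_def \<delta>_def algebra_simps)
    have "vle (lam powi n * \<delta>) (ip (3 * m))" unfolding eq by (intro vle_diff small f)
    then have "vle (lam powi n * \<delta> * (1 / \<delta>)) (ip (3 * m) * ip m)" using mS(4) by (rule vle_mult)
    then have up: "vle (lam powi n) (ip (4 * m))" using \<delta>0 ip_add[of "3 * m" m] by simp
    have low: "vle (ip l) (lam ^ l)" for l
    proof (induction l)
      case 0
      show ?case by (simp add: ip_def vle_refl)
    next
      case (Suc l)
      then show ?case using vle_mult[OF lam_ge Suc] by (simp add: ip_def)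
    qed
    have "lam powi n = lam ^ nat n" using n by (simp add: power_int_def)
    then have "vle (ip (nat n)) (ip (4 * m))" using low up vle_trans by metis
    then show False using ip_strict[of "4 * m" "nat n"] n by linarith
  qed
  then have "\<forall>x n s. int (4 * m) < n \<longrightarrow>
    (\<exists>\<beta>\<in>{\<beta>1, \<beta>2}. vieta \<beta> k (chain_pt (\<beta> j) (xi (\<beta> j) x n) s) \<in> vbig \<beta> k)"
    using trap by blast
  then show ?thesis using A(1) by blast
qed

lemma exit_big:
  assumes T: "T \<ge> 4" "cmod (\<beta> k) \<le> T" "cmod ell \<le> T"
    and X: "cmod X \<ge> cmod \<rho> * (T + cmod (\<beta> j) + cmod \<tau>)"
  shows "vieta \<beta> k (chain_pt (\<beta> j) X s) \<in> big T k"
proof (rule big_enter[OF trio_perm(5)[OF t] T(1)])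
  show "cmod (\<beta> k) \<le> T" by (rule T(2))
  show "cmod (chain_pt (\<beta> j) X s k) \<le> T" using T(3) by (simp add: chain_simps)
  show "T \<le> cmod (chain_pt (\<beta> j) X s i)" "T \<le> cmod (chain_pt (\<beta> j) X s j)"
    using chain_large[OF X] T(1) by auto
qed

text \<open>
  Leaving the chain by the third involution leads into a trap at one of the two specialisations. If the
  chain is a translation, two real places suffice. Otherwise the chain moves away from its fixed point
  at the real place in one direction and at a \<open>p\<close>-adic place in the other.
\<close>
lemma exit_trap:
  assumes ne12: "\<beta>1 j \<noteq> \<beta>2 j"
    and \<beta>: "\<forall>\<beta>\<in>{\<beta>1, \<beta>2}. fits \<beta> \<and> algebraic (\<beta> j) \<and> (\<rho> * \<rho> \<noteq> 1 \<longrightarrow> \<beta> k \<in> \<rat>)"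
    and T: "T \<ge> 4" "\<forall>\<beta>\<in>{\<beta>1, \<beta>2}. cmod (\<beta> k) \<le> T" "cmod ell \<le> T"
  shows "\<exists>B A. valuation A \<and> (\<forall>x n s. B \<le> cmod x \<longrightarrow> (\<exists>\<beta>\<in>{\<beta>1, \<beta>2}.
     vieta \<beta> k (chain_pt (\<beta> j) (xi (\<beta> j) x n) s) \<in> big T k \<or>
     vieta \<beta> k (chain_pt (\<beta> j) (xi (\<beta> j) x n) s) \<in> valuation.vbig A \<beta> k))"
proof -
  define R where "R = cmod \<rho> * (T + (cmod (\<beta>1 j) + cmod (\<beta>2 j)) + cmod \<tau>)"
  have R: "cmod \<rho> * (T + cmod (\<beta> j) + cmod \<tau>) \<le> R" if "\<beta> \<in> {\<beta>1, \<beta>2}" for \<beta>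
    unfolding R_def using that by (intro mult_left_mono) auto
  have far: "vieta \<beta> k (chain_pt (\<beta> j) X s) \<in> big T k" if "\<beta> \<in> {\<beta>1, \<beta>2}" "R \<le> cmod X" for \<beta> X s
    using T R[OF that(1)] that by (intro exit_big) auto
  show ?thesis
  proof (cases "\<rho> * \<rho> = 1")
    case True
    obtain B where B: "\<And>x n. B \<le> cmod x \<Longrightarrow> R \<le> cmod (xi (\<beta>1 j) x n) \<or> R \<le> cmod (xi (\<beta>2 j) x n)"
      using far_translation[OF True ne12, of R] by blast
    obtain A where A: "valuation A" using p_adic[OF two_is_prime_nat] by blast
    have "\<exists>\<beta>\<in>{\<beta>1, \<beta>2}. vieta \<beta> k (chain_pt (\<beta> j) (xi (\<beta> j) x n) s) \<in> big T k"
      if x: "B \<le> cmod x" for x n s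
      using B[OF x, of n]
    proof
      assume "R \<le> cmod (xi (\<beta>1 j) x n)"
      then have "vieta \<beta>1 k (chain_pt (\<beta>1 j) (xi (\<beta>1 j) x n) s) \<in> big T k" by (intro far) simp_all
      then show ?thesis by blast
    next
      assume "R \<le> cmod (xi (\<beta>2 j) x n)"
      then have "vieta \<beta>2 k (chain_pt (\<beta>2 j) (xi (\<beta>2 j) x n) s) \<in> big T k" by (intro far) simp_all
      then show ?thesis by blast
    qed
    then show ?thesis using A by blast
  next
    case False
    have \<beta>': "\<forall>\<beta>\<in>{\<beta>1, \<beta>2}. fits \<beta> \<and> algebraic (\<beta> j) \<and> \<beta> k \<in> \<rat>" using \<beta> False by blast
    obtain A N where AN: "valuation A" "\<And>x n s. int N < n \<Longrightarrow>
      (\<exists>\<beta>\<in>{\<beta>1, \<beta>2}. vieta \<beta> k (chain_pt (\<beta> j) (xi (\<beta> j) x n) s) \<in> valuation.vbig A \<beta> k)"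
      using exit_p_adic[OF False ne12 \<beta>'] by blast
    obtain B where B: "\<And>x n. B \<le> cmod x \<Longrightarrow> n \<le> int N \<Longrightarrow> R \<le> cmod (xi (\<beta>1 j) x n)"
      using far_expanding[OF False, of N R "\<beta>1 j"] by blast
    have "\<exists>\<beta>\<in>{\<beta>1, \<beta>2}. vieta \<beta> k (chain_pt (\<beta> j) (xi (\<beta> j) x n) s) \<in> big T k \<or>
       vieta \<beta> k (chain_pt (\<beta> j) (xi (\<beta> j) x n) s) \<in> valuation.vbig A \<beta> k" if x: "B \<le> cmod x" for x n s
    proof (cases "int N < n")
      case True
      then show ?thesis using AN(2) by blast
    next
      case False
      then have "R \<le> cmod (xi (\<beta>1 j) x n)" using B[OF x] by simp
      then have "vieta \<beta>1 k (chain_pt (\<beta>1 j) (xi (\<beta>1 j) x n) s) \<in> big T k" by (intro far) simp_all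
      then show ?thesis by blast
    qed
    then show ?thesis using AN(1) by blast
  qed
qed

text \<open>
  A reduced word that starts at a large integral point of the line and ends at an integral point
  leads back to the start or to its image under the third involution, and the parity of its length
  tells which of the two it is.
\<close>
lemma line_exit:
  assumes irr: "\<alpha> j \<notin> \<rat>" and fits: "fits \<alpha>" and krat: "\<rho> * \<rho> \<noteq> 1 \<Longrightarrow> \<alpha> k \<in> \<rat>"
    and large: "\<And>y. y \<in> D \<Longrightarrow> \<forall>l. T0 \<le> cmod (pt y l) \<Longrightarrow>
      \<exists>l q. (\<forall>m. q m \<in> \<rat>) \<and> cmod (q l) < T0 \<and> pt y = vieta \<alpha> l q"
  shows "\<exists>B. \<forall>q w y. q k = ell \<longrightarrow> q j = \<rho> * q i + \<tau> \<longrightarrow> q i \<in> \<rat> \<longrightarrow> B \<le> cmod (q i) \<longrightarrow>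
     distinct_adj w \<longrightarrow> y \<in> D \<longrightarrow> walk \<alpha> w q = pt y \<longrightarrow>
     (pt y = q \<and> even (length w)) \<or> (pt y = vieta \<alpha> k q \<and> odd (length w))"
proof -
  have rs: "\<rho> * \<tau> - \<tau> / \<rho> \<in> \<rat>" "- \<rho> \<in> \<rat>" using rat by auto
  obtain \<beta>1 \<beta>2 where ne12: "\<beta>1 j \<noteq> \<beta>2 j" and \<beta>: "\<forall>\<beta>\<in>{\<beta>1, \<beta>2}. specialises \<alpha> \<beta> \<and> algebraic (\<beta> j) \<and>
     \<beta> i = (\<rho> * \<tau> - \<tau> / \<rho>) + (- \<rho>) * \<beta> j \<and> (\<alpha> k \<in> \<rat> \<longrightarrow> \<beta> k = \<alpha> k)"
    using two_specialisations[OF t irr rs fits[unfolded fits_def]] by blast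
  define T where "T = \<bar>T0\<bar> + 4 + (\<Sum>l\<in>UNIV. cmod (\<alpha> l)) + (\<Sum>l\<in>UNIV. cmod (\<beta>1 l)) + (\<Sum>l\<in>UNIV. cmod (\<beta>2 l)) + cmod ell"
  have s0: "(\<Sum>l\<in>UNIV. cmod (f l)) \<ge> 0" for f :: "3 \<Rightarrow> complex" by (rule sum_nonneg) simp
  have sl: "cmod (f l) \<le> (\<Sum>l\<in>UNIV. cmod (f l))" for l :: 3 and f by (rule member_le_sum) auto
  have T: "T \<ge> 4" "T0 \<le> T" "cmod ell \<le> T"
    unfolding T_def using s0[of \<alpha>] s0[of \<beta>1] s0[of \<beta>2] norm_ge_zero[of ell] by linarith+
  have T\<alpha>: "cmod (\<alpha> l) \<le> T" and T1: "cmod (\<beta>1 l) \<le> T" and T2: "cmod (\<beta>2 l) \<le> T" for l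
    unfolding T_def using s0[of \<alpha>] s0[of \<beta>1] s0[of \<beta>2] norm_ge_zero[of ell] sl[of \<alpha> l] sl[of \<beta>1 l] sl[of \<beta>2 l] by linarith+
  have fit: "fits \<beta>" if "\<beta> \<in> {\<beta>1, \<beta>2}" for \<beta> unfolding fits_def using \<beta> that by blast
  have \<beta>': "\<forall>\<beta>\<in>{\<beta>1, \<beta>2}. fits \<beta> \<and> algebraic (\<beta> j) \<and> (\<rho> * \<rho> \<noteq> 1 \<longrightarrow> \<beta> k \<in> \<rat>)"
    using \<beta> fit krat by metis
  have Tk: "\<forall>\<beta>\<in>{\<beta>1, \<beta>2}. cmod (\<beta> k) \<le> T" using T1 T2 by blast
  obtain B A where A: "valuation A" and B: "\<And>x n s. B \<le> cmod x \<Longrightarrow> (\<exists>\<beta>\<in>{\<beta>1, \<beta>2}.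
     vieta \<beta> k (chain_pt (\<beta> j) (xi (\<beta> j) x n) s) \<in> big T k \<or>
     vieta \<beta> k (chain_pt (\<beta> j) (xi (\<beta> j) x n) s) \<in> valuation.vbig A \<beta> k)"
    using exit_trap[OF ne12 \<beta>' T(1) Tk T(3)] by blast
  show ?thesis
  proof (intro exI[of _ B] allI impI)
    fix q w y
    assume q: "q k = ell" "q j = \<rho> * q i + \<tau>" "q i \<in> \<rat>" "B \<le> cmod (q i)"
      and w: "distinct_adj w" and y: "y \<in> D" and fin: "walk \<alpha> w q = pt y"
    have start: "q = chain_pt c (xi c (q i) 0) False" for c
      by (rule ext_trio[OF t]) (simp_all add: chain_simps xi_0 q)
    have qj: "q j \<in> \<rat>" unfolding q(2) using q(3) rat by auto
    have qrat: "\<forall>l. q l \<in> \<rat>" 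
    proof
      fix l show "q l \<in> \<rat>" using trio_cases[OF t, of l] q(1,3) qj Rats_\<rho>(1) by auto
    qed
    have yrat: "\<forall>l. pt y l \<in> \<rat>" by (simp add: pt_nth)
    have chain: "walk \<beta> u q = chain_pt (\<beta> j) (xi (\<beta> j) (q i) (fst (cidx u (0, False)))) (snd (cidx u (0, False)))"
      if "set u \<subseteq> {i, j}" "fits \<beta>" for u \<beta>
      using chain_walk[OF that(2,1), of "q i" 0 False] unfolding start[symmetric] .
    have returns: "walk \<alpha> u q = q \<and> even (length u)" if u: "set u \<subseteq> {i, j}" "\<forall>l. walk \<alpha> u q l \<in> \<rat>" for u
    proof -
      have n: "fst (cidx u (0, False)) = 0" and s: "\<not> snd (cidx u (0, False))"
        using chain_rational[OF irr q(3) u(2)[unfolded chain[OF u(1) fits]]] .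
      have "walk \<alpha> u q = chain_pt (\<alpha> j) (xi (\<alpha> j) (q i) 0) False"
        unfolding chain[OF u(1) fits] n using s by simp
      then have "walk \<alpha> u q = q" unfolding start[symmetric] .
      then show ?thesis using s cidx_parity[of u 0 False] by simp
    qed
    show "(pt y = q \<and> even (length w)) \<or> (pt y = vieta \<alpha> k q \<and> odd (length w))"
    proof (cases "k \<in> set w")
      case False
      then have "set w \<subseteq> {i, j}" using trio_cases[OF t] by blast
      then show ?thesis using returns[of w] fin yrat by simp
    next
      case True
      then obtain w1 w2 where w12: "w = w1 @ k # w2" "k \<notin> set w1" using split_list_first[OF True] by blast
      have w1: "set w1 \<subseteq> {i, j}" using w12(2) trio_cases[OF t] by blast
      have adj: "distinct_adj (k # w2)" using w unfolding w12(1) by (simp add: distinct_adj_append_iff)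
      \<comment> \<open>the first use of \<open>k\<close>, seen at a specialisation where it leads into a trap\<close>
      obtain \<gamma> where \<gamma>: "\<gamma> \<in> {\<beta>1, \<beta>2}" and trap0:
        "vieta \<gamma> k (chain_pt (\<gamma> j) (xi (\<gamma> j) (q i) (fst (cidx w1 (0, False)))) (snd (cidx w1 (0, False)))) \<in> big T k \<or>
         vieta \<gamma> k (chain_pt (\<gamma> j) (xi (\<gamma> j) (q i) (fst (cidx w1 (0, False)))) (snd (cidx w1 (0, False)))) \<in> valuation.vbig A \<gamma> k"
        using B[OF q(4)] by blast
      have trap: "vieta \<gamma> k (walk \<gamma> w1 q) \<in> big T k \<or> vieta \<gamma> k (walk \<gamma> w1 q) \<in> valuation.vbig A \<gamma> k"
        using trap0 unfolding chain[OF w1 fit[OF \<gamma>]] .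
      define z where "z = vieta \<gamma> k (walk \<gamma> w1 q)"
      have spec: "specialises \<alpha> \<gamma>" using \<beta> \<gamma> by blast
      have T\<gamma>: "\<forall>l. cmod (\<gamma> l) \<le> T" using \<gamma> T1 T2 by auto
      have "walk \<gamma> w q = pt y" using spec qrat yrat fin unfolding specialises_def by blast
      then have zy: "walk \<gamma> w2 z = pt y" by (simp add: w12 z_def)
      have notv: "z \<notin> valuation.vbig A \<gamma> k"
      proof
        assume "z \<in> valuation.vbig A \<gamma> k"
        then have "pt y \<in> valuation.vbig A \<gamma> (last (k # w2))"
          using valuation.vbig_walk[OF A _ adj] zy by metis
        then show False using valuation.vbig_not_int[OF A] by (metis pt_nth Ints_of_int)
      qed
      then have zT: "z \<in> big T k" using trap unfolding z_def by blast
      define l where "l = last (k # w2)"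
      have yl: "pt y \<in> big T l" using big_walk[OF T(1) T\<gamma> zT adj] zy unfolding l_def by simp
      have yT: "T \<le> cmod (pt y m)" for m using big_ge[OF yl] .
      have "\<forall>m. T0 \<le> cmod (pt y m)" using yT T(2) order_trans by blast
      then obtain l' q' where q': "\<forall>m. q' m \<in> \<rat>" "cmod (q' l') < T0" "pt y = vieta \<alpha> l' q'"
        using large[OF y] by blast
      obtain m n where t': "trio l' m n" using trio_ex1 by blast
      have "T \<le> cmod (q' m)" "T \<le> cmod (q' n)"
        using yT[of m] yT[of n] trio_neq[OF t'] unfolding q'(3) by (simp_all add: vieta_other)
      then have yl': "pt y \<in> big T l'" unfolding q'(3)
        using q'(2) T(2) by (intro big_enter[OF t' T(1) T\<alpha>]) auto
      have ll: "l' = l"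
      proof (rule ccontr)
        assume "l' \<noteq> l"
        then have "cmod (pt y l') < cmod (pt y l)" "cmod (pt y l) < cmod (pt y l')"
          using yl yl' unfolding big_def by auto
        then show False by simp
      qed
      \<comment> \<open>the end point lies in the real trap, so its last letter leads down to a point with a small
        coordinate; this point precedes the trap\<close>
      define v where "v = butlast (k # w2)"
      have kw: "k # w2 = v @ [l]" unfolding v_def l_def by simp
      have "walk \<alpha> w q = vieta \<alpha> l (walk \<alpha> (w1 @ v) q)" unfolding w12(1) kw by simp
      then have "walk \<alpha> (w1 @ v) q = vieta \<alpha> l (pt y)" unfolding fin[symmetric] by simp
      then have wq': "walk \<alpha> (w1 @ v) q = q'" unfolding q'(3) ll by simp
      have "w2 = []"
      proof (rule ccontr)
        assume "w2 \<noteq> []"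
        then have v: "v = k # butlast w2" by (simp add: v_def)
        have "walk \<gamma> (w1 @ v) q = q'" using spec qrat q'(1) wq' unfolding specialises_def by blast
        then have "walk \<gamma> (butlast w2) z = q'" by (simp add: v z_def)
        moreover have "distinct_adj (k # butlast w2)"
          using adj unfolding kw v by (simp only: distinct_adj_append_iff)
        ultimately have "q' \<in> big T (last (k # butlast w2))" using big_walk[OF T(1) T\<gamma> zT] by metis
        then have "T \<le> cmod (q' l')" by (rule big_ge)
        then show False using q'(2) T(2) by simp
      qed
      then have lk: "l = k" "v = []" by (simp_all add: l_def v_def)
      have "walk \<alpha> w1 q = q'" using wq' lk by simp
      then have "walk \<alpha> w1 q = q \<and> even (length w1)" using returns[OF w1] q'(1) by simp
      then show ?thesis using fin w12 \<open>w2 = []\<close> by simp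
    qed
  qed
qed

end

section \<open>Integral points when two coefficients are irrational\<close>

interpretation rat_pair: vector_space_pair "\<lambda>(r :: rat) (z :: complex). of_rat r * z" "(*) :: rat \<Rightarrow> rat \<Rightarrow> rat"
  by unfold_locales (simp_all add: algebra_simps)

definition rat_linear :: "(complex \<Rightarrow> rat) \<Rightarrow> bool" where
  "rat_linear f \<longleftrightarrow> (\<forall>u v. f (u + v) = f u + f v) \<and> (\<forall>r u. f (of_rat r * u) = r * f u)"

text \<open>
  The numbers \<open>z\<close> and 1 are linearly independent over the rationals.
\<close>
lemma rat_linear_single:
  assumes z: "z \<notin> \<rat>"
  shows "\<exists>f. rat_linear f \<and> f 1 = 0 \<and> f z \<noteq> 0"
proof -
  have z1: "z \<noteq> 1" "z \<noteq> 0" using z by auto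
  have "rat_space.independent {z, 1}"
  proof (rule rat_space.independent_insertI)
    show "z \<notin> rat_space.span {1}"
    proof
      assume "z \<in> rat_space.span {1}"
      then obtain r where "z = of_rat r * 1" unfolding rat_space.span_singleton by blast
      then show False using z by simp
    qed
    show "rat_space.independent {1}" by (rule rat_space.independent_insertI) (simp_all add: rat_space.independent_empty)
  qed
  then obtain g where g: "Vector_Spaces.linear (\<lambda>(r :: rat) (z :: complex). of_rat r * z) ((*) :: rat \<Rightarrow> rat \<Rightarrow> rat) g"
     "\<forall>x\<in>{z, 1}. g x = (if x = z then 1 else 0)"
    using rat_pair.linear_independent_extend[of "{z, 1}" "\<lambda>x. if x = z then 1 else 0"] by blast
  have "rat_linear g" unfolding rat_linear_def
    using rat_pair.linear_add[OF g(1)] rat_pair.linear_scale[OF g(1)] by blast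
  moreover have "g 1 = 0" "g z = 1" using g(2) z1 by auto
  ultimately show ?thesis by (intro exI[of _ g]) simp
qed

text \<open>
  A generic combination of the functionals for the single numbers.
\<close>
lemma rat_linear_many:
  "finite Z \<Longrightarrow> (\<And>z. z \<in> Z \<Longrightarrow> z \<notin> \<rat>) \<Longrightarrow> \<exists>f. rat_linear f \<and> f 1 = 0 \<and> (\<forall>z\<in>Z. f z \<noteq> 0)"
proof (induction Z rule: finite_induct)
  case empty
  have "rat_linear (\<lambda>_. 0)" by (simp add: rat_linear_def)
  then show ?case by blast
next
  case (insert z Z)
  then obtain f where f: "rat_linear f" "f 1 = 0" "\<forall>z\<in>Z. f z \<noteq> 0" by auto
  obtain g where g: "rat_linear g" "g 1 = 0" "g z \<noteq> 0" using rat_linear_single insert.prems by blast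
  define bad where "bad = (\<lambda>y. - f y / g y) ` insert z Z"
  have "finite bad" using insert.hyps by (simp add: bad_def)
  then obtain s where s: "s \<notin> bad" using ex_new_if_finite[OF infinite_UNIV_char_0] by blast
  define h where "h u = f u + s * g u" for u
  have "rat_linear h" using f(1) g(1) unfolding rat_linear_def h_def by (simp add: algebra_simps)
  moreover have "h 1 = 0" using f g by (simp add: h_def)
  moreover have "h y \<noteq> 0" if y: "y \<in> insert z Z" for y
  proof (cases "g y = 0")
    case True
    then have "y \<in> Z" using y g(3) by auto
    then show ?thesis using f(3) True by (simp add: h_def)
  next
    case False
    have "s \<noteq> - f y / g y" using s y unfolding bad_def by blast
    then show ?thesis using False by (simp add: h_def field_simps eq_neg_iff_add_eq_0)
  qed
  ultimately show ?case by blast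
qed

text \<open>
  A rational functional that kills 1 turns the equation of the surface at integral points into a
  linear equation.
\<close>
lemma integral_points_plane:
  "\<exists>\<nu> \<sigma>. (\<forall>l. \<nu> l \<in> \<rat> \<and> (\<nu> l = 0 \<longleftrightarrow> \<alpha> l \<in> \<rat>)) \<and> \<sigma> \<in> (\<rat> :: complex set) \<and>
     (\<forall>x i j k. trio i j k \<longrightarrow> on_surface \<alpha> b (pt x) \<longrightarrow> \<nu> i * pt x i + \<nu> j * pt x j + \<nu> k * pt x k = \<sigma>)"
proof -
  define Z where "Z = {z \<in> range \<alpha>. z \<notin> \<rat>}"
  have "finite Z" unfolding Z_def by simp
  then obtain f where f: "rat_linear f" "f 1 = 0" "\<forall>z\<in>Z. f z \<noteq> 0"
    using rat_linear_many[of Z] unfolding Z_def by blast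
  have add: "f (u + v) = f u + f v" and scale: "f (of_rat r * u) = r * f u" for u v r
    using f(1) unfolding rat_linear_def by blast+
  have frat: "f (of_rat r) = 0" for r using scale[of r 1] f(2) by simp
  have fint: "f (of_int n) = 0" for n using frat[of "of_int n"] by simp
  have fmul: "f (u * of_int n) = of_int n * f u" for u n
    using scale[of "of_int n" u] by (simp add: mult.commute)
  define \<nu> where "\<nu> l = (of_rat (f (\<alpha> l)) :: complex)" for l
  define \<sigma> where "\<sigma> = (of_rat (- f b) :: complex)"
  have "\<nu> l = 0 \<longleftrightarrow> \<alpha> l \<in> \<rat>" for l
  proof
    assume "\<nu> l = 0"
    then have "f (\<alpha> l) = 0" by (simp add: \<nu>_def)
    then show "\<alpha> l \<in> \<rat>" using f(3) unfolding Z_def by blast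
  next
    assume "\<alpha> l \<in> \<rat>"
    then obtain r where "\<alpha> l = of_rat r" using Rats_ex by blast
    then show "\<nu> l = 0" using frat by (simp add: \<nu>_def)
  qed
  moreover have "\<nu> i * pt x i + \<nu> j * pt x j + \<nu> k * pt x k = \<sigma>"
    if t: "trio i j k" and s: "on_surface \<alpha> b (pt x)" for x i j k
  proof -
    define u where "u = coords x"
    have "of_int (u i * u i + u j * u j + u k * u k + u i * u j * u k)
       = \<alpha> i * of_int (u i) + \<alpha> j * of_int (u j) + \<alpha> k * of_int (u k) + b"
      using s unfolding on_surface_trio[OF t] by (simp add: pt_nth u_def)
    then have "0 = f (\<alpha> i * of_int (u i) + \<alpha> j * of_int (u j) + \<alpha> k * of_int (u k) + b)"
      using fint by metis
    also have "\<dots> = of_int (u i) * f (\<alpha> i) + of_int (u j) * f (\<alpha> j) + of_int (u k) * f (\<alpha> k) + f b"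
      by (simp only: add fmul)
    finally have "of_int (u i) * f (\<alpha> i) + of_int (u j) * f (\<alpha> j) + of_int (u k) * f (\<alpha> k) = - f b" by linarith
    then have "of_rat (of_int (u i) * f (\<alpha> i) + of_int (u j) * f (\<alpha> j) + of_int (u k) * f (\<alpha> k)) = \<sigma>"
      by (simp only: \<sigma>_def)
    then show ?thesis by (simp add: \<nu>_def pt_nth u_def of_rat_add of_rat_mult mult.commute)
  qed
  moreover have "\<nu> l \<in> \<rat>" for l by (simp add: \<nu>_def)
  moreover have "\<sigma> \<in> \<rat>" by (simp add: \<sigma>_def)
  ultimately show ?thesis by blast
qed

lemma sorted_trio:
  fixes f :: "3 \<Rightarrow> real"
  shows "\<exists>i j k. trio i j k \<and> f i \<le> f j \<and> f j \<le> f k"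
proof -
  have t: "trio 1 2 3" "trio 1 3 2" "trio 2 1 3" "trio 2 3 1" "trio 3 1 2" "trio 3 2 1"
    by (simp_all add: trio_def)
  have "f 1 \<le> f 2 \<or> f 2 \<le> f 1" "f 2 \<le> f 3 \<or> f 3 \<le> f 2" "f 1 \<le> f 3 \<or> f 3 \<le> f 1" by linarith+
  then show ?thesis using t by blast
qed

lemma finite_integral_ball: "finite {x. \<forall>l. cmod (pt x l) \<le> R}"
proof -
  have "pt ` {x. \<forall>l. cmod (pt x l) \<le> R} \<subseteq> {p \<in> lattice 1. \<forall>l. cmod (p l) \<le> real (nat \<lceil>R\<rceil>)}"
  proof
    fix p assume "p \<in> pt ` {x. \<forall>l. cmod (pt x l) \<le> R}"
    then obtain x where x: "p = pt x" "\<forall>l. cmod (pt x l) \<le> R" by blast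
    then show "p \<in> {p \<in> lattice 1. \<forall>l. cmod (p l) \<le> real (nat \<lceil>R\<rceil>)}"
      using order_trans[OF _ real_nat_ceiling_ge] by (auto simp: lattice_def pt_nth)
  qed
  then have "finite (pt ` {x. \<forall>l. cmod (pt x l) \<le> R})"
    by (rule finite_subset) (rule finite_lattice_ball(1), simp)
  then show ?thesis by (rule finite_imageD) (simp add: inj_on_def pt_inj)
qed

text \<open>
  The data of \<open>integral_points_plane\<close> for a surface with at least two irrational coefficients.
\<close>
locale two_irrational =
  fixes \<alpha> :: "3 \<Rightarrow> complex" and b :: complex and \<nu> :: "3 \<Rightarrow> complex" and \<sigma> :: complex
  assumes two: "\<exists>l m. l \<noteq> m \<and> \<alpha> l \<notin> \<rat> \<and> \<alpha> m \<notin> \<rat>"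
    and \<nu>: "\<nu> l \<in> \<rat>" "\<nu> l = 0 \<longleftrightarrow> \<alpha> l \<in> \<rat>" and \<sigma>: "\<sigma> \<in> \<rat>"
    and plane: "trio i j k \<Longrightarrow> on_surface \<alpha> b (pt x) \<Longrightarrow> \<nu> i * pt x i + \<nu> j * pt x j + \<nu> k * pt x k = \<sigma>"
begin

text \<open>
  For fixed \<open>q a\<close> the surface cuts out a conic in the remaining coordinates. A bound for \<open>q a\<close> leaves
  only finitely many such conics for points \<open>q\<close> that come from integral points \<open>x\<close>.
\<close>
definition near :: "real \<Rightarrow> int triple \<Rightarrow> 3 \<Rightarrow> 3 \<Rightarrow> 3 \<Rightarrow> (3 \<Rightarrow> complex) \<Rightarrow> bool" where
  "near M x u v a q \<longleftrightarrow> trio u v a \<and> \<nu> u \<noteq> 0 \<and> \<nu> v \<noteq> 0 \<and> on_surface \<alpha> b q \<and> cmod (q a) \<le> M \<and>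
     (q = pt x \<or> \<alpha> a \<in> \<rat> \<and> q = vieta \<alpha> a (pt x))"

lemma near_swap: "near M x u v a q \<Longrightarrow> near M x v u a q"
  unfolding near_def using trio_perm(1) by blast

text \<open>
  Let \<open>k\<close> be the index of the largest coordinate. If its coefficient is irrational, the plane makes the second
  largest coordinate comparable with it, and the cubic term of the equation bounds the smallest one. If it is
  rational, the plane makes the other two coordinates comparable, and the product of the two roots of the equation in
  the largest coordinate shows that the other root, to which the involution leads, is bounded.
\<close>
lemma near_exists:
  "\<exists>M K. \<forall>x. on_surface \<alpha> b (pt x) \<longrightarrow> (\<exists>l. K < cmod (pt x l)) \<longrightarrow> (\<exists>u v a q. near M x u v a q)"
proof -
  define A where "A = (\<Sum>l\<in>UNIV. cmod (\<alpha> l))"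
  have A: "cmod (\<alpha> l) \<le> A" for l unfolding A_def by (rule member_le_sum) auto
  have A0: "A \<ge> 0" using A norm_ge_zero order_trans by blast
  define n where "n = (\<Sum>l\<in>UNIV. cmod (\<nu> l))"
  define \<mu> where "\<mu> = Min (insert 1 ((\<lambda>l. cmod (\<nu> l)) ` {l. \<nu> l \<noteq> 0}))"
  have \<mu>0: "\<mu> > 0" unfolding \<mu>_def by (subst Min_gr_iff) auto
  have \<mu>: "\<mu> \<le> cmod (\<nu> l)" if "\<nu> l \<noteq> 0" for l unfolding \<mu>_def using that by (intro Min_le) auto
  have n0: "n \<ge> 0" unfolding n_def by (rule sum_nonneg) simp
  define C where "C = (cmod \<sigma> + n) / \<mu> + 1"
  have C1: "C \<ge> 1" using \<mu>0 n0 by (simp add: C_def)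
  define G where "G = 3 + 3 * A + cmod b"
  have G: "G \<ge> 3" using A0 by (simp add: G_def)
  define M where "M = 2 * C * G"
  define R where "R = 1 + 2 * (A + G)"
  have R: "R \<ge> 1" using A0 G by (simp add: R_def)
  define R' where "R' = C * R"
  have R': "R \<le> R'" "R' \<ge> 0" using C1 R mult_right_mono[of 1 C R] by (simp_all add: R'_def)
  define K2 where "K2 = (A + R' * R') + (2 * A * R' + cmod b + 2 * R' * R') + 1"
  define K where "K = 1 + C * (1 + M) + \<bar>K2\<bar>"
  have M0: "M \<ge> 0" using C1 G by (simp add: M_def)
  have CM: "C \<le> C * (1 + M)" using C1 M0 by simp
  have F1: "cmod (pt x k) \<le> C * m"
    if t: "trio i j k" and s: "on_surface \<alpha> b (pt x)" and k: "\<nu> k \<noteq> 0"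
      and m: "m \<ge> 1" "\<nu> i = 0 \<or> cmod (pt x i) \<le> m" "\<nu> j = 0 \<or> cmod (pt x j) \<le> m" for x i j k m
  proof -
    have "\<nu> k * pt x k = \<sigma> - \<nu> i * pt x i - \<nu> j * pt x j" using plane[OF t s] by (simp add: algebra_simps)
    then have "cmod (\<nu> k) * cmod (pt x k) = cmod (\<sigma> - \<nu> i * pt x i - \<nu> j * pt x j)" by (metis norm_mult)
    also have "\<dots> \<le> cmod \<sigma> + cmod (\<nu> i * pt x i) + cmod (\<nu> j * pt x j)"
      using norm_triangle_ineq4[of "\<sigma> - \<nu> i * pt x i" "\<nu> j * pt x j"] norm_triangle_ineq4[of \<sigma> "\<nu> i * pt x i"] by linarith
    also have "\<dots> \<le> cmod \<sigma> * m + cmod (\<nu> i) * m + cmod (\<nu> j) * m"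
    proof -
      have "cmod \<sigma> * 1 \<le> cmod \<sigma> * m" using m(1) by (intro mult_left_mono) auto
      moreover have "cmod (\<nu> i * pt x i) \<le> cmod (\<nu> i) * m" using m(2) by (cases "\<nu> i = 0") (simp_all add: norm_mult mult_left_mono)
      moreover have "cmod (\<nu> j * pt x j) \<le> cmod (\<nu> j) * m" using m(3) by (cases "\<nu> j = 0") (simp_all add: norm_mult mult_left_mono)
      ultimately show ?thesis by linarith
    qed
    also have "\<dots> = (cmod \<sigma> + (cmod (\<nu> i) + cmod (\<nu> j))) * m" by (simp add: algebra_simps)
    also have "\<dots> \<le> (cmod \<sigma> + n) * m"
    proof -
      have "cmod (\<nu> i) + cmod (\<nu> j) \<le> n" unfolding n_def trio_UNIV[OF t] using trio_neq[OF t] by simp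
      then show ?thesis using m(1) by (intro mult_right_mono) auto
    qed
    finally have "cmod (\<nu> k) * cmod (pt x k) \<le> (cmod \<sigma> + n) * m" .
    moreover have "\<mu> * cmod (pt x k) \<le> cmod (\<nu> k) * cmod (pt x k)" using \<mu>[OF k] by (rule mult_right_mono) simp
    ultimately have "cmod (pt x k) * \<mu> \<le> (cmod \<sigma> + n) * m" by (simp add: mult.commute)
    then have "cmod (pt x k) \<le> (cmod \<sigma> + n) * m / \<mu>" unfolding pos_le_divide_eq[OF \<mu>0] .
    also have "\<dots> \<le> C * m" using m(1) by (simp add: C_def algebra_simps)
    finally show ?thesis .
  qed
  have "\<exists>u v a q. near M x u v a q" if s: "on_surface \<alpha> b (pt x)" and big: "K < cmod (pt x l)" for x l
  proof -
    obtain i j k where t: "trio i j k" and ij: "cmod (pt x i) \<le> cmod (pt x j)" and jk: "cmod (pt x j) \<le> cmod (pt x k)"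
      using sorted_trio[of "\<lambda>l. cmod (pt x l)"] by blast
    define p where "p = pt x"
    have t': "trio j i k" "trio i k j" using trio_perm[OF t] by blast+
    have "cmod (pt x l) \<le> cmod (p k)" using trio_cases[OF t, of l] ij jk unfolding p_def by auto
    then have H: "K < cmod (p k)" using big by simp
    have H1: "1 < cmod (p k)" and HCM: "C * (1 + M) < cmod (p k)" and HK2: "K2 < cmod (p k)"
      using H C1 CM unfolding K_def by linarith+
    have ab: "cmod (\<alpha> l * p l) \<le> A * y" if "cmod (p l) \<le> y" for l y
      unfolding norm_mult using A[of l] that A0 by (intro mult_mono) auto
    have surf: "p i * p i + p j * p j + p k * p k + p i * p j * p k = \<alpha> i * p i + \<alpha> j * p j + \<alpha> k * p k + b"
      using s unfolding on_surface_trio[OF t] p_def .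
    have ij: "cmod (p i) \<le> cmod (p j)" and jk: "cmod (p j) \<le> cmod (p k)" using ij jk by (simp_all add: p_def)
    show ?thesis
    proof (cases "\<nu> k = 0")
      case False
      define y where "y = cmod (p j)"
      define h where "h = cmod (p k)"
      have h1: "h > 1" using H1 by (simp add: h_def)
      have "h \<le> C * max 1 y"
        unfolding h_def p_def using ij by (intro F1[OF t s False]) (auto simp: y_def p_def)
      moreover have "h > C" using HCM CM by (simp add: h_def)
      ultimately have hy: "h \<le> C * y" by (cases "y \<le> 1") (simp_all add: max_absorb1 max_absorb2)
      have "cmod (p i) * y * h = cmod (\<alpha> i * p i + \<alpha> j * p j + \<alpha> k * p k + b - p i * p i - p j * p j - p k * p k)"
      proof -
        have "p i * p j * p k = \<alpha> i * p i + \<alpha> j * p j + \<alpha> k * p k + b - p i * p i - p j * p j - p k * p k"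
          using surf by (simp add: algebra_simps)
        then show ?thesis unfolding y_def h_def by (metis norm_mult)
      qed
      also have "\<dots> \<le> A * h + A * h + A * h + cmod b + h * h + h * h + h * h"
      proof -
        have 1: "cmod (p i * p i) \<le> h * h" "cmod (p j * p j) \<le> h * h" "cmod (p k * p k) \<le> h * h"
          unfolding norm_mult h_def using ij jk by (auto intro!: mult_mono)
        have 2: "cmod (\<alpha> i * p i) \<le> A * h" "cmod (\<alpha> j * p j) \<le> A * h" "cmod (\<alpha> k * p k) \<le> A * h"
          using ij jk by (auto intro!: ab simp: h_def)
        show ?thesis using 1 2
          norm_triangle_ineq4[of "\<alpha> i * p i + \<alpha> j * p j + \<alpha> k * p k + b - p i * p i - p j * p j" "p k * p k"]
          norm_triangle_ineq4[of "\<alpha> i * p i + \<alpha> j * p j + \<alpha> k * p k + b - p i * p i" "p j * p j"]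
          norm_triangle_ineq4[of "\<alpha> i * p i + \<alpha> j * p j + \<alpha> k * p k + b" "p i * p i"]
          norm_triangle_ineq[of "\<alpha> i * p i + \<alpha> j * p j + \<alpha> k * p k" b]
          norm_triangle_ineq[of "\<alpha> i * p i + \<alpha> j * p j" "\<alpha> k * p k"]
          norm_triangle_ineq[of "\<alpha> i * p i" "\<alpha> j * p j"] by linarith
      qed
      also have "\<dots> \<le> G * (h * h)"
      proof -
        have "A * h \<le> A * (h * h)" using h1 A0 by (intro mult_left_mono) auto
        moreover have "h * h \<ge> 1" using h1 mult_mono[of 1 h 1 h] by simp
        then have "cmod b * 1 \<le> cmod b * (h * h)" by (intro mult_left_mono) auto
        moreover have "G * (h * h) = 3 * (h * h) + 3 * (A * (h * h)) + cmod b * (h * h)" by (simp add: G_def algebra_simps)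
        ultimately show ?thesis by linarith
      qed
      finally have "cmod (p i) * y * h \<le> (G * h) * h" by (simp add: mult.assoc)
      then have "cmod (p i) * y \<le> G * h" using h1 by (simp only: mult_le_cancel_right_pos)
      also have "\<dots> \<le> G * (C * y)" using hy G by (intro mult_left_mono) auto
      finally have "cmod (p i) * y \<le> (G * C) * y" by (simp add: mult.assoc)
      moreover have "y > 0"
      proof (rule ccontr)
        assume "\<not> y > 0"
        then have "C * y \<le> 0" using C1 by (intro mult_nonneg_nonpos) auto
        then show False using hy h1 by linarith
      qed
      ultimately have piM: "cmod (p i) \<le> G * C" by (simp only: mult_le_cancel_right_pos)
      have "0 \<le> G * C" using G C1 by simp
      then have piM: "cmod (p i) \<le> M" using piM unfolding M_def by (simp add: mult.commute mult.left_commute)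
      have "\<nu> j \<noteq> 0"
      proof
        assume j0: "\<nu> j = 0"
        have "h \<le> C * (1 + M)" unfolding h_def p_def
          using j0 piM M0 by (intro F1[OF t s False]) (auto simp: p_def)
        then show False using HCM by (simp add: h_def)
      qed
      then have "near M x j k i p"
        unfolding near_def using t trio_perm[OF t] False piM s p_def by blast
      then show ?thesis by blast
    next
      case True
      then have kQ: "\<alpha> k \<in> \<rat>" using \<nu>(2) by blast
      obtain l m where lm: "l \<noteq> m" "\<alpha> l \<notin> \<rat>" "\<alpha> m \<notin> \<rat>" using two by blast
      then have "\<nu> i \<noteq> 0" "\<nu> j \<noteq> 0" using kQ \<nu>(2) trio_cases[OF t, of l] trio_cases[OF t, of m] by metis+
      note nij = this
      define X where "X = cmod (p i)"
      define y where "y = cmod (p j)"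
      define h where "h = cmod (p k)"
      have Xy: "X \<le> y" and yh: "y \<le> h" using ij jk by (simp_all add: X_def y_def h_def)
      have XR: "X > R"
      proof (rule ccontr)
        assume "\<not> X > R"
        then have XR: "X \<le> R" by simp
        have yR: "y \<le> R'" unfolding R'_def y_def p_def
          using XR R True by (intro F1[OF t'(2) s nij(2)]) (auto simp: X_def p_def)
        have XR': "X \<le> R'" using XR R' by simp
        have "p k * p k = (\<alpha> k - p i * p j) * p k + (\<alpha> i * p i + \<alpha> j * p j + b - p i * p i - p j * p j)"
          using surf by (simp add: algebra_simps)
        moreover have "cmod (\<alpha> k - p i * p j) \<le> A + R' * R'"
        proof -
          have "cmod (p i * p j) \<le> R' * R'" unfolding norm_mult using XR' yR R'
            by (intro mult_mono) (auto simp: X_def y_def)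
          then show ?thesis using norm_triangle_ineq4[of "\<alpha> k" "p i * p j"] A[of k] by linarith
        qed
        moreover have "cmod (\<alpha> i * p i + \<alpha> j * p j + b - p i * p i - p j * p j) \<le> 2 * A * R' + cmod b + 2 * R' * R'"
        proof -
          have 1: "cmod (p i * p i) \<le> R' * R'" "cmod (p j * p j) \<le> R' * R'" unfolding norm_mult using XR' yR R'
            by (auto intro!: mult_mono simp: X_def y_def)
          have 2: "cmod (\<alpha> i * p i) \<le> A * R'" "cmod (\<alpha> j * p j) \<le> A * R'" using XR' yR by (auto intro!: ab simp: X_def y_def)
          show ?thesis using 1 2
            norm_triangle_ineq4[of "\<alpha> i * p i + \<alpha> j * p j + b - p i * p i" "p j * p j"]
            norm_triangle_ineq4[of "\<alpha> i * p i + \<alpha> j * p j + b" "p i * p i"]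
            norm_triangle_ineq[of "\<alpha> i * p i + \<alpha> j * p j" b]
            norm_triangle_ineq[of "\<alpha> i * p i" "\<alpha> j * p j"] by (simp add: mult.assoc)
        qed
        ultimately have "cmod (p k) \<le> K2" unfolding K2_def by (rule quadratic_root_bound)
        then show False using HK2 by simp
      qed
      have X1: "X > 1" "y > 1" "h > 1" using XR R Xy yh by linarith+
      have yC: "y \<le> C * X" unfolding y_def p_def
        using X1 True by (intro F1[OF t'(2) s nij(2)]) (auto simp: X_def p_def)
      define z where "z = vieta \<alpha> k p k"
      have z: "z = \<alpha> k - p i * p j - p k" unfolding z_def using vieta_same[OF trio_perm(5)[OF t]] .
      have "p k * z = p i * p i + p j * p j - \<alpha> i * p i - \<alpha> j * p j - b"
        using surf unfolding z by (simp add: algebra_simps)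
      then have "h * cmod z = cmod (p i * p i + p j * p j - \<alpha> i * p i - \<alpha> j * p j - b)" unfolding h_def by (metis norm_mult)
      also have "\<dots> \<le> y * y + y * y + A * y + A * y + cmod b"
      proof -
        have 1: "cmod (p i * p i) \<le> y * y" "cmod (p j * p j) \<le> y * y" unfolding norm_mult y_def using ij
          by (auto intro!: mult_mono)
        have 2: "cmod (\<alpha> i * p i) \<le> A * y" "cmod (\<alpha> j * p j) \<le> A * y" using ij by (auto intro!: ab simp: y_def)
        show ?thesis using 1 2
          norm_triangle_ineq4[of "p i * p i + p j * p j - \<alpha> i * p i - \<alpha> j * p j" b]
          norm_triangle_ineq4[of "p i * p i + p j * p j - \<alpha> i * p i" "\<alpha> j * p j"]
          norm_triangle_ineq4[of "p i * p i + p j * p j" "\<alpha> i * p i"]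
          norm_triangle_ineq[of "p i * p i" "p j * p j"] by linarith
      qed
      also have "\<dots> \<le> G * (y * y)"
      proof -
        have "A * y \<le> A * (y * y)" using X1 A0 by (intro mult_left_mono) auto
        moreover have yy: "y * y \<ge> 1" using X1 mult_mono[of 1 y 1 y] by simp
        then have "cmod b * 1 \<le> cmod b * (y * y)" by (intro mult_left_mono) auto
        moreover have "G * (y * y) = 3 * (y * y) + 3 * (A * (y * y)) + cmod b * (y * y)" by (simp add: G_def algebra_simps)
        moreover have "0 \<le> A * (y * y)" using A0 yy by simp
        ultimately show ?thesis using yy by linarith
      qed
      finally have hz: "h * cmod z \<le> G * (y * y)" .
      have "y * cmod z \<le> h * cmod z" using yh by (intro mult_right_mono) auto
      then have "y * cmod z \<le> y * (G * y)" using hz by (simp add: mult.left_commute)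
      then have zy: "cmod z \<le> G * y" using X1 by (simp only: mult_le_cancel_left_pos)
      have "X * y = cmod (\<alpha> k - z - p k)" unfolding z X_def y_def by (simp add: norm_mult)
      also have "\<dots> \<le> A + cmod z + h"
        using norm_triangle_ineq4[of "\<alpha> k - z" "p k"] norm_triangle_ineq4[of "\<alpha> k" z] A[of k] unfolding h_def by linarith
      finally have "X * y \<le> A + G * y + h" using zy by linarith
      moreover have "A \<le> A * y" using X1 A0 mult_left_mono[of 1 y A] by simp
      ultimately have hb: "X * y - (A + G) * y \<le> h" by (simp add: algebra_simps)
      have "(A + G) * y \<le> X / 2 * y" using XR X1 unfolding R_def by (intro mult_right_mono) auto
      then have hXy: "X * y / 2 \<le> h" using hb by linarith
      have "y * y \<le> C * X * y" using yC X1 by (intro mult_right_mono) auto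
      also have "\<dots> = 2 * C * (X * y / 2)" by simp
      also have "\<dots> \<le> 2 * C * h" using hXy C1 by (intro mult_left_mono) auto
      finally have "G * (y * y) \<le> G * (2 * C * h)" using G by (intro mult_left_mono) auto
      then have "h * cmod z \<le> h * M" using hz by (simp add: M_def mult_ac)
      then have zM: "cmod z \<le> M" using X1 by (simp only: mult_le_cancel_left_pos)
      have "near M x i j k (vieta \<alpha> k p)"
        unfolding near_def using t nij zM kQ on_surface_vieta[OF s, of k] unfolding z_def p_def by blast
      then show ?thesis by blast
    qed
  qed
  then show ?thesis by blast
qed

end

section \<open>Lines through almost all integral points\<close>

lemma add_inverse_integral:
  assumes r: "\<rho> \<in> \<rat>" "\<rho> \<noteq> 0" and int: "\<rho> + 1 / \<rho> \<in> \<int>"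
  shows "\<rho> * \<rho> = (1 :: complex)"
proof -
  obtain m d where md: "d > 0" "coprime m d" "\<rho> = of_int m / of_int d" using r(1) by (cases rule: Rats_cases') auto
  obtain n where n: "\<rho> + 1 / \<rho> = of_int n" using int by (auto elim: Ints_cases)
  have m0: "m \<noteq> 0" using md(3) r(2) by auto
  have "of_int (m * m + d * d) = (of_int (n * (m * d)) :: complex)"
    using n md(1) m0 unfolding md(3) by (simp add: field_simps)
  then have eq: "m * m + d * d = n * (m * d)" by (simp only: of_int_eq_iff)
  have "d * d = m * (n * d - m)" "m * m = d * (n * m - d)" using eq by (simp_all add: algebra_simps)
  then have dv: "m dvd d * d" "d dvd m * m" by (metis dvd_triv_left)+
  have "coprime m (d * d)" "coprime d (m * m)" using md(2) by (simp_all add: coprime_commute)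
  then have "is_unit m" "is_unit d" using dv by (metis coprime_common_divisor dvd_refl)+
  then have "\<bar>m\<bar> = 1" "d = 1" using md(1) by auto
  then have "m * m = 1" by (metis abs_mult_self_eq mult_1)
  then have "of_int m * of_int m = (1 :: complex)" by (metis of_int_1 of_int_mult)
  then show ?thesis using \<open>d = 1\<close> md(3) by simp
qed

context two_irrational begin

definition rho :: "3 \<Rightarrow> 3 \<Rightarrow> complex" where "rho u v = - \<nu> u / \<nu> v"
definition axis :: "3 \<Rightarrow> 3 \<Rightarrow> complex" where "axis u v = - (rho u v + 1 / rho u v)"
definition shift :: "3 \<Rightarrow> 3 \<Rightarrow> 3 \<Rightarrow> complex" where "shift u v a = (\<sigma> - \<nu> a * axis u v) / \<nu> v"

text \<open>The plane meets the section at \<open>axis u v\<close> in a line, and this line lies on the surface.\<close>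
definition has_line :: "3 \<Rightarrow> 3 \<Rightarrow> 3 \<Rightarrow> bool" where
  "has_line u v a \<longleftrightarrow> trio u v a \<and> \<nu> u \<noteq> 0 \<and> \<nu> v \<noteq> 0 \<and> 1 \<le> cmod (rho u v) \<and>
     \<alpha> u = (rho u v * shift u v a - shift u v a / rho u v) + (- rho u v) * \<alpha> v \<and>
     (rho u v * rho u v \<noteq> 1 \<longrightarrow> \<alpha> a \<in> \<rat>)"

definition on_line :: "3 \<Rightarrow> 3 \<Rightarrow> 3 \<Rightarrow> (3 \<Rightarrow> complex) \<Rightarrow> bool" where
  "on_line u v a q \<longleftrightarrow> q a = axis u v \<and> q v = rho u v * q u + shift u v a \<and> q u \<in> \<int>"

definition regular :: "3 \<Rightarrow> 3 \<Rightarrow> 3 \<Rightarrow> int triple \<Rightarrow> (3 \<Rightarrow> complex) \<Rightarrow> bool" where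
  "regular u v a x q \<longleftrightarrow> has_line u v a \<and> on_line u v a q \<and> (q = pt x \<or> q = vieta \<alpha> a (pt x))"

lemma rho_rat: "rho u v \<in> \<rat>" "axis u v \<in> \<rat>" "shift u v a \<in> \<rat>"
  using \<nu>(1) \<sigma> by (auto simp: rho_def axis_def shift_def intro!: Rats_divide Rats_diff Rats_mult Rats_add)

lemma near_order:
  assumes "near M x u v a q" shows "\<exists>u v. near M x u v a q \<and> 1 \<le> cmod (rho u v)"
proof (cases "cmod (\<nu> v) \<le> cmod (\<nu> u)")
  case True
  have "\<nu> v \<noteq> 0" using assms unfolding near_def by blast
  then have "1 \<le> cmod (rho u v)" using True by (simp add: rho_def norm_divide field_simps)
  then show ?thesis using assms by blast
next
  case False
  have "\<nu> u \<noteq> 0" using assms unfolding near_def by blast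
  then have "1 \<le> cmod (rho v u)" using False by (simp add: rho_def norm_divide field_simps)
  then show ?thesis using near_swap[OF assms] by blast
qed

text \<open>
  The equation of the conic in the parameter \<open>q u\<close> of the line that the plane cuts out of the section \<open>q a = l\<close>.
  If it does not vanish identically, at most two points are left.
\<close>
definition conic :: "3 \<Rightarrow> 3 \<Rightarrow> 3 \<Rightarrow> complex \<Rightarrow> complex poly" where
  "conic u v a l = (let \<rho> = rho u v; \<tau> = (\<sigma> - \<nu> a * l) / \<nu> v in
     [: \<tau> * \<tau> + l * l - \<alpha> v * \<tau> - \<alpha> a * l - b, 2 * \<rho> * \<tau> + l * \<tau> - \<alpha> u - \<alpha> v * \<rho>, 1 + \<rho> * \<rho> + l * \<rho> :])"

lemma near_plane:
  assumes n: "near M x u v a q" and s: "on_surface \<alpha> b (pt x)"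
  shows "q v = rho u v * q u + (\<sigma> - \<nu> a * q a) / \<nu> v"
proof -
  have t: "trio u v a" and nz: "\<nu> v \<noteq> 0" and q: "q = pt x \<or> \<alpha> a \<in> \<rat> \<and> q = vieta \<alpha> a (pt x)"
    using n unfolding near_def by blast+
  have rel: "\<nu> u * pt x u + \<nu> v * pt x v + \<nu> a * pt x a = \<sigma>" by (rule plane[OF t s])
  have "\<nu> u * q u + \<nu> v * q v + \<nu> a * q a = \<sigma>"
    using q
  proof
    assume "\<alpha> a \<in> \<rat> \<and> q = vieta \<alpha> a (pt x)"
    then have "\<nu> a = 0" "q u = pt x u" "q v = pt x v" using \<nu>(2) trio_neq[OF t] by (auto simp: vieta_other)
    then show ?thesis using rel by simp
  qed (use rel in simp)
  then have "\<nu> v * q v = \<sigma> - \<nu> a * q a - \<nu> u * q u" by (simp add: algebra_simps)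
  then have "q v = (\<sigma> - \<nu> a * q a - \<nu> u * q u) / \<nu> v" using nz by (simp add: field_simps)
  then show ?thesis by (simp add: rho_def diff_divide_distrib)
qed

lemma near_conic:
  assumes n: "near M x u v a q" and s: "on_surface \<alpha> b (pt x)"
  shows "poly (conic u v a (q a)) (q u) = 0"
proof -
  have t: "trio u v a" and sq: "on_surface \<alpha> b q" using n unfolding near_def by blast+
  show ?thesis using sq unfolding on_surface_trio[OF t] near_plane[OF n s] conic_def Let_def
    by (simp add: algebra_simps)
qed

lemma near_int:
  assumes n: "near M x u v a q"
  shows "q u \<in> \<int>" "q a \<in> \<int> \<or> \<alpha> a - q a \<in> \<int> \<and> \<alpha> a \<in> \<rat>"
proof -
  have t: "trio u v a" and q: "q = pt x \<or> \<alpha> a \<in> \<rat> \<and> q = vieta \<alpha> a (pt x)" using n unfolding near_def by blast+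
  have "vieta \<alpha> a (pt x) a = \<alpha> a - pt x u * pt x v - pt x a" by (rule vieta_same[OF trio_perm(5)[OF t]])
  then have "\<alpha> a - vieta \<alpha> a (pt x) a = pt x u * pt x v + pt x a" by simp
  then have "\<alpha> a - vieta \<alpha> a (pt x) a \<in> \<int>" by (simp add: pt_nth)
  then show "q u \<in> \<int>" "q a \<in> \<int> \<or> \<alpha> a - q a \<in> \<int> \<and> \<alpha> a \<in> \<rat>"
    using q trio_neq[OF t] by (auto simp: vieta_other pt_nth)
qed

text \<open>
  If the conic contains the line, comparing coefficients determines \<open>q a\<close> and gives the relation between the
  coefficients of the surface. When \<open>q\<close> itself is integral, the axis coordinate is an integer, and then \<open>rho\<close> is 1 or -1.
\<close>
lemma near_regular:
  assumes n: "near M x u v a q" and s: "on_surface \<alpha> b (pt x)" and r1: "1 \<le> cmod (rho u v)"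
    and z: "conic u v a (q a) = 0"
  shows "regular u v a x q"
proof -
  have t: "trio u v a" and nz: "\<nu> u \<noteq> 0" "\<nu> v \<noteq> 0" and q: "q = pt x \<or> \<alpha> a \<in> \<rat> \<and> q = vieta \<alpha> a (pt x)"
    using n unfolding near_def by blast+
  have r0: "rho u v \<noteq> 0" using r1 by auto
  define \<tau> where "\<tau> = (\<sigma> - \<nu> a * q a) / \<nu> v"
  have 1: "1 + rho u v * rho u v + q a * rho u v = 0"
    and 2: "2 * rho u v * \<tau> + q a * \<tau> - \<alpha> u - \<alpha> v * rho u v = 0"
    using z unfolding conic_def Let_def \<tau>_def by simp_all
  have "q a * rho u v = - (rho u v * rho u v + 1)" using 1 by (simp add: eq_neg_iff_add_eq_0 algebra_simps)
  then have "q a = - (rho u v * rho u v + 1) / rho u v" using r0 by (simp add: field_simps)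
  then have qa: "q a = axis u v" using r0 by (simp add: axis_def field_simps)
  have \<tau>: "\<tau> = shift u v a" by (simp add: \<tau>_def shift_def qa)
  have "\<alpha> u = 2 * rho u v * \<tau> + q a * \<tau> - \<alpha> v * rho u v" using 2 by (simp add: algebra_simps)
  also have "\<dots> = (rho u v * \<tau> - \<tau> / rho u v) + (- rho u v) * \<alpha> v"
    unfolding qa axis_def using r0 by (simp add: field_simps)
  finally have au: "\<alpha> u = (rho u v * shift u v a - shift u v a / rho u v) + (- rho u v) * \<alpha> v" unfolding \<tau> .
  have "\<alpha> a \<in> \<rat>" if r2: "rho u v * rho u v \<noteq> 1"
  proof (rule ccontr)
    assume "\<alpha> a \<notin> \<rat>"
    then have "axis u v \<in> \<int>" using q qa by (metis Ints_of_int pt_nth)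
    then have "rho u v + 1 / rho u v \<in> \<int>" unfolding axis_def by (metis Ints_minus minus_minus)
    then show False using add_inverse_integral[OF rho_rat(1) r0] r2 by blast
  qed
  then have "has_line u v a" unfolding has_line_def using t nz r1 au by blast
  moreover have "on_line u v a q"
    unfolding on_line_def using qa near_plane[OF n s] near_int(1)[OF n] unfolding \<tau>_def[symmetric] \<tau> by blast
  ultimately show ?thesis unfolding regular_def using q by blast
qed

lemma finite_section: 
  "finite {q. q u \<in> S \<and> q v = f (q u) \<and> q a = (c :: complex)}" if "trio u v a" "finite S" for S f
proof (rule finite_subset)
  show "{q. q u \<in> S \<and> q v = f (q u) \<and> q a = c} \<subseteq> (\<lambda>X l. if l = u then X else if l = v then f X else c) ` S"
  proof
    fix q assume q: "q \<in> {q. q u \<in> S \<and> q v = f (q u) \<and> q a = c}"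
    then have "q = (\<lambda>l. if l = u then q u else if l = v then f (q u) else c)"
      using trio_neq[OF that(1)] by (intro ext_trio[OF that(1)]) auto
    then show "q \<in> (\<lambda>X l. if l = u then X else if l = v then f X else c) ` S" using q by blast
  qed
qed (use that in simp)

lemma finite_integral_disc: "finite {z :: complex. c - z \<in> \<int> \<and> cmod z \<le> M}"
proof -
  have "{z. c - z \<in> \<int> \<and> cmod z \<le> M} \<subseteq> (\<lambda>m. c - of_int m) ` {- \<lceil>cmod c + M\<rceil>..\<lceil>cmod c + M\<rceil>}"
  proof
    fix z assume "z \<in> {z. c - z \<in> \<int> \<and> cmod z \<le> M}"
    then obtain m where m: "c - z = of_int m" and z: "cmod z \<le> M" by (auto elim: Ints_cases)
    have "\<bar>of_int m\<bar> = cmod (c - z)" by (simp add: m)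
    also have "\<dots> \<le> cmod c + M" using norm_triangle_ineq4[of c z] z by linarith
    finally have "\<bar>m\<bar> \<le> \<lceil>cmod c + M\<rceil>" by linarith
    moreover have "z = c - of_int m" using m by (simp add: algebra_simps)
    ultimately show "z \<in> (\<lambda>m. c - of_int m) ` {- \<lceil>cmod c + M\<rceil>..\<lceil>cmod c + M\<rceil>}" by (intro image_eqI[of _ _ m]) (auto simp: abs_le_iff)
  qed
  then show ?thesis by (rule finite_subset) simp
qed

text \<open>A near point is regular or a root of one of finitely many nonzero quadratic polynomials, and points
  outside every near region are bounded.\<close>
lemma finite_irregular: "finite {x. on_surface \<alpha> b (pt x) \<and> (\<forall>u v a q. \<not> regular u v a x q)}" (is "finite ?E")
proof -
  obtain M K where MK: "\<And>x. on_surface \<alpha> b (pt x) \<Longrightarrow> \<exists>l. K < cmod (pt x l) \<Longrightarrow> \<exists>u v a q. near M x u v a q"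
    using near_exists by blast
  define \<Lambda> where "\<Lambda> a = {z :: complex. 0 - z \<in> \<int> \<and> cmod z \<le> M} \<union> {z. \<alpha> a - z \<in> \<int> \<and> cmod z \<le> M}" for a
  have fin\<Lambda>: "finite (\<Lambda> a)" for a unfolding \<Lambda>_def using finite_integral_disc by blast
  define Q where "Q u v a = (\<Union>c\<in>\<Lambda> a. {q. trio u v a \<and> conic u v a c \<noteq> 0 \<and> q u \<in> {X. poly (conic u v a c) X = 0} \<and>
    q v = rho u v * q u + (\<sigma> - \<nu> a * c) / \<nu> v \<and> q a = c})" for u v a
  have finQ: "finite (Q u v a)" for u v a
  proof -
    have "finite {q. trio u v a \<and> conic u v a c \<noteq> 0 \<and> q u \<in> {X. poly (conic u v a c) X = 0} \<and>
       q v = rho u v * q u + (\<sigma> - \<nu> a * c) / \<nu> v \<and> q a = c}" for c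
    proof (cases "trio u v a \<and> conic u v a c \<noteq> 0")
      case True
      then have "trio u v a" "finite {X. poly (conic u v a c) X = 0}" using poly_roots_finite by blast+
      from finite_section[OF this, of "\<lambda>X. rho u v * X + (\<sigma> - \<nu> a * c) / \<nu> v" c]
      show ?thesis using True by simp
    qed auto
    then show ?thesis unfolding Q_def using fin\<Lambda> by blast
  qed
  define F where "F = (\<Union>u. \<Union>v. \<Union>a. Q u v a \<union> vieta \<alpha> a ` Q u v a)"
  have finF: "finite F" unfolding F_def using finQ by (intro finite_UN_I finite_UnI finite_imageI) simp_all
  have "?E \<subseteq> {x. \<forall>l. cmod (pt x l) \<le> K} \<union> pt -` F"
  proof
    fix x assume x: "x \<in> ?E"
    then have s: "on_surface \<alpha> b (pt x)" and nr: "\<And>u v a q. \<not> regular u v a x q" by blast+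
    show "x \<in> {x. \<forall>l. cmod (pt x l) \<le> K} \<union> pt -` F"
    proof (cases "\<exists>l. K < cmod (pt x l)")
      case True
      then obtain u0 v0 a q where "near M x u0 v0 a q" using MK[OF s] by blast
      then obtain u v where n: "near M x u v a q" and r: "1 \<le> cmod (rho u v)" using near_order by blast
      have nz: "conic u v a (q a) \<noteq> 0" using near_regular[OF n s r] nr by blast
      have q: "q = pt x \<or> q = vieta \<alpha> a (pt x)" and t: "trio u v a" and M: "cmod (q a) \<le> M"
        using n unfolding near_def by blast+
      have "q a \<in> \<Lambda> a" using near_int(2)[OF n] M unfolding \<Lambda>_def by auto
      then have "q \<in> Q u v a" unfolding Q_def using t nz near_conic[OF n s] near_plane[OF n s] by blast
      moreover have "pt x = q \<or> pt x = vieta \<alpha> a q" using q by auto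
      ultimately have "pt x \<in> F" unfolding F_def by blast
      then show ?thesis by blast
    qed (auto simp: not_less)
  qed
  moreover have "finite (pt -` F)" using finF by (rule finite_vimageI) (simp add: inj_def pt_inj)
  ultimately show ?thesis using finite_integral_ball finite_subset by blast
qed

text \<open>
  For a regular point far out on its line, a reduced word to another integral point is controlled by
  \<open>line_exit\<close>. If the point is the image of the point \<open>q\<close> on the line under the involution \<open>a\<close>, the letter
  \<open>a\<close> is put in front of the word, which makes its length odd and identifies the end with the
  start.
\<close>
lemma decidable_two_irrational:
  assumes D: "\<And>x. x \<in> D \<Longrightarrow> on_surface \<alpha> b (pt x)"
  shows "decidable_on encode_pair (D \<times> D) (\<lambda>(x, y). \<exists>ws. even (length ws) \<and> walk \<alpha> ws (pt x) = pt y)"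
proof -
  define E where "E = {x. on_surface \<alpha> b (pt x) \<and> (\<forall>u v a q. \<not> regular u v a x q)}"
  have finE: "finite E" unfolding E_def by (rule finite_irregular)
  \<comment> \<open>a point with all coordinates above \<open>T0\<close> is neither irregular nor on a line itself\<close>
  define T0 where "T0 = 1 + (\<Sum>x\<in>E. height (pt x)) + (\<Sum>(u, v)\<in>UNIV. cmod (axis u v))"
  have h0: "height p \<ge> 0" for p unfolding height_def by (rule sum_nonneg) simp
  have sE: "(\<Sum>x\<in>E. height (pt x)) \<ge> 0" by (rule sum_nonneg) (rule h0)
  have sA: "(\<Sum>(u, v)\<in>UNIV. cmod (axis u v)) \<ge> 0" by (rule sum_nonneg) auto
  have axisT: "cmod (axis u v) < T0" for u v
  proof -
    have "cmod (axis u v) \<le> (\<Sum>(u, v)\<in>UNIV. cmod (axis u v))"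
      using member_le_sum[of "(u, v)" UNIV "\<lambda>(u, v). cmod (axis u v)"] by auto
    then show ?thesis using sE unfolding T0_def by linarith
  qed
  have ET: "\<not> (\<forall>l. T0 \<le> cmod (pt x l))" if "x \<in> E" for x
  proof
    assume "\<forall>l. T0 \<le> cmod (pt x l)"
    then have "T0 \<le> cmod (pt x 1)" by blast
    also have "\<dots> \<le> height (pt x)" unfolding height_def by (rule member_le_sum) auto
    also have "\<dots> \<le> (\<Sum>x\<in>E. height (pt x))" using that h0 finE by (intro member_le_sum) auto
    finally show False using sA unfolding T0_def by linarith
  qed
  have line_rat: "q m \<in> \<rat>" if q: "on_line u v a q" and t: "trio u v a" for u v a q m
    using q trio_cases[OF t, of m] rho_rat Ints_subset_Rats unfolding on_line_def
    by (auto intro!: Rats_add Rats_mult)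
  have large: "\<exists>l q. (\<forall>m. q m \<in> \<rat>) \<and> cmod (q l) < T0 \<and> pt y = vieta \<alpha> l q"
    if y: "y \<in> D" and big: "\<forall>l. T0 \<le> cmod (pt y l)" for y
  proof -
    have "y \<notin> E" using ET big by blast
    then obtain u v a q where r: "regular u v a y q" using D[OF y] unfolding E_def by blast
    have q: "on_line u v a q" "trio u v a" "q = pt y \<or> q = vieta \<alpha> a (pt y)"
      using r unfolding regular_def has_line_def by blast+
    have qa: "cmod (q a) < T0" using q(1) axisT unfolding on_line_def by simp
    have "q \<noteq> pt y"
    proof
      assume "q = pt y"
      then show False using qa big[rule_format, of a] by simp
    qed
    then have "pt y = vieta \<alpha> a q" using q(3) by auto
    then show ?thesis using qa line_rat[OF q(1,2)] by blast
  qed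
  have "\<exists>B. \<forall>q w y. on_line u v a q \<longrightarrow> B \<le> cmod (q u) \<longrightarrow> distinct_adj w \<longrightarrow> y \<in> D \<longrightarrow> walk \<alpha> w q = pt y \<longrightarrow>
     (pt y = q \<and> even (length w)) \<or> (pt y = vieta \<alpha> a q \<and> odd (length w))" if h: "has_line u v a" for u v a
  proof -
    have L: "line u v a (rho u v) (shift u v a)"
      using h rho_rat unfolding has_line_def by unfold_locales blast+
    interpret line u v a "rho u v" "shift u v a" by (rule L)
    have ell: "ell = axis u v" by (simp add: ell_def axis_def)
    have irr: "\<alpha> v \<notin> \<rat>" using h \<nu>(2) unfolding has_line_def by blast
    have fit: "fits \<alpha>" unfolding fits_def using h unfolding has_line_def by blast
    have kr: "rho u v * rho u v \<noteq> 1 \<Longrightarrow> \<alpha> a \<in> \<rat>" using h unfolding has_line_def by blast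
    obtain B where B: "\<forall>q w y. q a = ell \<longrightarrow> q v = rho u v * q u + shift u v a \<longrightarrow> q u \<in> \<rat> \<longrightarrow> B \<le> cmod (q u) \<longrightarrow>
     distinct_adj w \<longrightarrow> y \<in> D \<longrightarrow> walk \<alpha> w q = pt y \<longrightarrow>
     (pt y = q \<and> even (length w)) \<or> (pt y = vieta \<alpha> a q \<and> odd (length w))"
      using line_exit[OF irr fit kr large] by blast
    show ?thesis
    proof (intro exI[of _ B] allI impI)
      fix q w y assume q: "on_line u v a q" and w: "B \<le> cmod (q u)" "distinct_adj w" "y \<in> D" "walk \<alpha> w q = pt y"
      have "q a = ell" "q v = rho u v * q u + shift u v a" "q u \<in> \<rat>"
        using q Ints_subset_Rats unfolding on_line_def ell by blast+
      then show "(pt y = q \<and> even (length w)) \<or> (pt y = vieta \<alpha> a q \<and> odd (length w))"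
        using B w by blast
    qed
  qed
  then have "\<forall>u v a. \<exists>B. has_line u v a \<longrightarrow> (\<forall>q w y. on_line u v a q \<longrightarrow> B \<le> cmod (q u) \<longrightarrow> distinct_adj w \<longrightarrow> y \<in> D \<longrightarrow> walk \<alpha> w q = pt y \<longrightarrow>
     (pt y = q \<and> even (length w)) \<or> (pt y = vieta \<alpha> a q \<and> odd (length w)))" by blast
  then obtain B where B: "\<And>u v a q w y. has_line u v a \<Longrightarrow> on_line u v a q \<Longrightarrow> B u v a \<le> cmod (q u) \<Longrightarrow>
     distinct_adj w \<Longrightarrow> y \<in> D \<Longrightarrow> walk \<alpha> w q = pt y \<Longrightarrow>
     (pt y = q \<and> even (length w)) \<or> (pt y = vieta \<alpha> a q \<and> odd (length w))" by metis
  define Q where "Q u v a = {q. trio u v a \<and> q u \<in> {z. 0 - z \<in> \<int> \<and> cmod z \<le> B u v a} \<and>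
     q v = rho u v * q u + shift u v a \<and> q a = axis u v}" for u v a
  have finQ: "finite (Q u v a)" for u v a
  proof (cases "trio u v a")
    case True
    show ?thesis unfolding Q_def
      using finite_section[OF True finite_integral_disc, of 0 "B u v a" "\<lambda>X. rho u v * X + shift u v a" "axis u v"] True by simp
  qed (simp add: Q_def)
  define F where "F = (\<Union>u. \<Union>v. \<Union>a. Q u v a \<union> vieta \<alpha> a ` Q u v a)"
  have finF: "finite F" unfolding F_def using finQ by (intro finite_UN_I finite_UnI finite_imageI) simp_all
  define E' where "E' = E \<union> pt -` F"
  have finE': "finite E'" unfolding E'_def using finE finF by (intro finite_UnI finite_vimageI) (simp_all add: inj_def pt_inj)
  have triv: "x = y" if x: "x \<in> D" "x \<notin> E'" and y: "y \<in> D" and w: "even (length w)" "walk \<alpha> w (pt x) = pt y" for x y w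
  proof -
    obtain u v a q where r: "regular u v a x q" using D[OF x(1)] x(2) unfolding E'_def E_def by blast
    have h: "has_line u v a" and l: "on_line u v a q" and t: "trio u v a" and q: "q = pt x \<or> q = vieta \<alpha> a (pt x)"
      using r unfolding regular_def has_line_def by blast+
    have px: "pt x = q \<or> pt x = vieta \<alpha> a q" using q by auto
    have big: "B u v a \<le> cmod (q u)"
    proof (rule ccontr)
      assume "\<not> B u v a \<le> cmod (q u)"
      then have "q \<in> Q u v a" unfolding Q_def using l t unfolding on_line_def by auto
      then have "pt x \<in> F" unfolding F_def using px by blast
      then show False using x(2) unfolding E'_def by blast
    qed
    from px show "x = y"
    proof
      assume xq: "pt x = q"
      obtain us where us: "distinct_adj us" "even (length us) = even (length w)"
        "\<forall>\<alpha> p :: 3 \<Rightarrow> complex. walk \<alpha> us p = walk \<alpha> w p" using reduce_word[of w] by blast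
      have "walk \<alpha> us q = pt y" using us(3) w(2) xq by simp
      then show ?thesis using B[OF h l big us(1) y] us(2) w(1) xq pt_inj by metis
    next
      assume xq: "pt x = vieta \<alpha> a q"
      obtain us where us: "distinct_adj us" "even (length us) = even (length (a # w))"
        "\<forall>\<alpha> p :: 3 \<Rightarrow> complex. walk \<alpha> us p = walk \<alpha> (a # w) p" using reduce_word[of "a # w"] by blast
      have "walk \<alpha> us q = pt y" using us(3) w(2) xq by simp
      moreover have "odd (length us)" using us(2) w(1) by simp
      ultimately show ?thesis using B[OF h l big us(1) y] xq pt_inj by metis
    qed
  qed
  show ?thesis
  proof (rule decidable_on_finite_exceptions[OF finE'])
    fix x assume "x \<in> D"
    show "\<exists>ws. even (length ws) \<and> walk \<alpha> ws (pt x) = pt x" by (rule exI[of _ "[]"]) simp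
  next
    fix x y assume xy: "x \<in> D" "y \<in> D" and "\<exists>ws. even (length ws) \<and> walk \<alpha> ws (pt x) = pt y"
    then obtain w where w: "even (length w)" "walk \<alpha> w (pt x) = pt y" by blast
    have "walk \<alpha> (rev w) (pt y) = pt x" using walk_rev[of \<alpha> w "pt x"] w(2) by simp
    then show "x = y \<or> x \<in> E' \<and> y \<in> E'"
      using triv[OF xy(1) _ xy(2) w] triv[OF xy(2) _ xy(1), of "rev w"] w(1) by auto
  qed
qed

end

section \<open>Decidability\<close>

theorem theorem1p3:
  fixes k :: "complex ^ 4"
  shows "decidable_on encode_pair (surface_int k \<times> surface_int k)
           (\<lambda>(x, y). same_mcg_orbit k x y)"
proof -
  let ?\<alpha> = "alphas k"
  have D: "x \<in> surface_int k \<Longrightarrow> on_surface ?\<alpha> (beta k) (pt x)" for x using on_surface_pt by blast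
  have "decidable_on encode_pair (surface_int k \<times> surface_int k)
     (\<lambda>(x, y). \<exists>ws. even (length ws) \<and> walk ?\<alpha> ws (pt x) = pt y)"
  proof (cases "\<forall>l. ?\<alpha> l \<in> \<rat>")
    case True
    then show ?thesis by (rule decidable_rational) (rule D)
  next
    case False
    then obtain i where i: "?\<alpha> i \<notin> \<rat>" by blast
    show ?thesis
    proof (cases "\<forall>l. l \<noteq> i \<longrightarrow> ?\<alpha> l \<in> \<rat>")
      case True
      show ?thesis by (rule decidable_one_irrational[OF i True]) (rule D)
    next
      case False
      then have two: "\<exists>l m. l \<noteq> m \<and> ?\<alpha> l \<notin> \<rat> \<and> ?\<alpha> m \<notin> \<rat>" using i by blast
      obtain \<nu> \<sigma> where \<nu>: "\<forall>l. \<nu> l \<in> \<rat> \<and> (\<nu> l = 0 \<longleftrightarrow> ?\<alpha> l \<in> \<rat>)" "\<sigma> \<in> \<rat>"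
        "\<forall>x i j k'. trio i j k' \<longrightarrow> on_surface ?\<alpha> (beta k) (pt x) \<longrightarrow> \<nu> i * pt x i + \<nu> j * pt x j + \<nu> k' * pt x k' = \<sigma>"
        using integral_points_plane[of ?\<alpha> "beta k"] by blast
      interpret two_irrational ?\<alpha> "beta k" \<nu> \<sigma>
        using two \<nu> by unfold_locales blast+
      show ?thesis by (rule decidable_two_irrational) (rule D)
    qed
  qed
  then show ?thesis by (simp only: same_orbit_iff_even_word)
qed

end
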